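(* Let $A$ be a compact metric space, let $(I,\mathcal{I},\lambda)$ be an atomless probability space, and let $G\colon (I,\mathcal{I},\lambda)\to \mathcal{C}_A\times\mathcal{U}_A$ be any large game. Then the Nash equilibrium correspondence of $G$ has the general closed graph property, that is, the following holds. Let $\{(I^n,\mathcal{I}^n,\lambda^n)\}_{n\in\mathbb{Z}_+}$ be any sequence of finite probability spaces with $|I^n|=n$, $\mathcal{I}^n$ the power set of $I^n$, and $\sup_{i\in I^n}\lambda^n(i)\to 0$ as $n\to\infty$. For each $n$ let $G^n\colon I^n\to\mathcal{C}_A\times\mathcal{U}_A$ be a finite-player game, and suppose that: (i) $\{\lambda^n (G^n)^{-1}\}_{n\in\mathbb{Z}_+}$ converges weakly to $\lambda G^{-1}$ (as Borel probability measures on $\mathcal{C}_A\times\mathcal{U}_A$); (ii) for each $n$, $g^n$ is a (randomized strategy) Nash equilibrium of $G^n$, and the sequence of societal summaries $\{s(g^n)\}_{n\in\mathbb{Z}_+}$ converges weakly to some $\tau^*\in\mathcal{M}(A)$. Then there exists a (randomized strategy) Nash equilibrium $g$ of the large game $G$ such that $s(g)=\tau^*$.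
   Context: Probability spaces are complete and countably additive. $A$ is a compact metric space (common action space) with Borel $\sigma$-algebra $\mathcal{B}(A)$. $\mathcal{M}(A)$ is the set of Borel probability measures on $A$ with the topology of weak convergence (and its Borel $\sigma$-algebra). $\mathcal{C}_A$ is the set of nonempty compact subsets of $A$ with the Hausdorff metric. $\mathcal{U}_A$ is the space of bounded continuous real functions on $A\times\mathcal{M}(A)$ with the sup norm. $\mathcal{C}_A\times\mathcal{U}_A$ has the product topology and its Borel $\sigma$-algebra. Large game: a measurable map $G\colon(I,\mathcal{I},\lambda)\to\mathcal{C}_A\times\mathcal{U}_A$, where $(I,\mathcal{I},\lambda)$ is an atomless probability space; write $G(i)=(A_i,u_i)$, where $A_i$ is player $i$'s feasible action set and $u_i$ her payoff function. A randomized strategy profile of $G$ is a measurable $g\colon I\to\mathcal{M}(A)$ with $g(i,A_i)=1$ for $\lambda$-almost all $i$ (where $g(i,B)=g(i)(B)$). Its societal summary is $s(g)=\int_I g(i)\,d\lambda(i)\in\mathcal{M}(A)$, i.e. $s(g)(B)=\int_I g(i,B)\,d\lambda(i)$ for all $B\in\mathcal{B}(A)$. It is a (randomized strategy) Nash equilibrium of $G$ if for $\lambda$-almost all $i\in I$, $\int_{A_i}u_i(a,s(g))\,g(i,da)\ge\int_{A_i}u_i(a,s(g))\,d\mu(a)$ for all $\mu\in\mathcal{M}(A_i)$. Finite-player game: a map $G^n\colon I^n\to\mathcal{C}_A\times\mathcal{U}_A$, $G^n(i)=(A_i^n,u_i^n)$, on a finite probability space $(I^n,\mathcal{I}^n,\lambda^n)$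 with $|I^n|=n$ and $\mathcal{I}^n$ the power set. A randomized strategy profile of $G^n$ is a map $g^n\colon I^n\to\mathcal{M}(A)$ with $g^n(i,A_i^n)=1$ for all $i\in I^n$. Player $i$'s expected payoff is $$u_i^n(g^n)=\int_{\prod_{j\in I^n}A_j^n}u_i^n\Bigl(a_i,\sum_{j\in I^n}\lambda^n(j)\delta_{a_j}\Bigr)\bigotimes_{j\in I^n}g^n(j,da_j),$$ with $\delta_a$ the Dirac measure at $a$ and players randomizing independently (product measure). The societal summary is $s(g^n)=\sum_{i\in I^n}\lambda^n(i)g^n(i)$. $g^n$ is a (randomized strategy) Nash equilibrium of $G^n$ if for all $i\in I^n$, $u_i^n(g^n)\ge u_i^n(\mu,g^n_{-i})$ for all $\mu\in\mathcal{M}(A_i^n)$, where $(\mu,g^n_{-i})$ is the profile in which $i$ plays $\mu$ and each $j\ne i$ plays $g^n(j)$. *)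

theory Defs
  imports "HOL-Probability.Probability"
begin

section \<open>Compact metric spaces\<close>

class compact_metric_space = metric_space +
  assumes compact_UNIV_metric: "compact (UNIV :: 'a set)"

instance compact_metric_space \<subseteq> polish_space
proof
  fix X :: "nat \<Rightarrow> 'a" assume "Cauchy X"
  moreover have "Topological_Spaces.complete (UNIV :: 'a set)"
    by (rule compact_imp_complete[OF compact_UNIV_metric])
  ultimately show "convergent X"
    by (auto simp: complete_def convergent_def)
next
  have "\<exists>k. finite k \<and> (UNIV :: 'a set) \<subseteq> (\<Union>x\<in>k. ball x (inverse (real (Suc n))))" for n
    using compact_UNIV_metric[where 'a = 'a] unfolding compact_eq_totally_bounded
    by (auto dest: spec[of _ "inverse (real (Suc n))"])
  then obtain k :: "nat \<Rightarrow> 'a set" where fin: "\<And>n. finite (k n)"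
    and cov: "\<And>n. UNIV \<subseteq> (\<Union>x\<in>k n. ball x (inverse (real (Suc n))))"
    by metis
  define B where "B = (\<Union>n. (\<lambda>x. ball x (inverse (real (Suc n)))) ` k n)"
  have "countable B"
    unfolding B_def using fin by (intro countable_UN) (auto intro: countable_finite)
  moreover have "topological_basis B"
  proof (rule topological_basisI)
    show "open U" if "U \<in> B" for U using that by (auto simp: B_def)
    fix U :: "'a set" and x assume "open U" "x \<in> U"
    then obtain e where e: "e > 0" "ball x e \<subseteq> U" by (auto simp: open_contains_ball)
    obtain n where n: "inverse (real (Suc n)) < e / 2"
      using reals_Archimedean[of "e / 2"] e by auto
    obtain y where y: "y \<in> k n" "x \<in> ball y (inverse (real (Suc n)))"
      using cov[of n] by blast
    have "ball y (inverse (real (Suc n))) \<subseteq> ball x e"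
    proof
      fix z assume "z \<in> ball y (inverse (real (Suc n)))"
      moreover have "dist x z \<le> dist y x + dist y z"
        by (metis dist_commute dist_triangle)
      ultimately show "z \<in> ball x e" using y n by auto
    qed
    then show "\<exists>V\<in>B. x \<in> V \<and> V \<subseteq> U"
      using y e(2) by (intro bexI[of _ "ball y (inverse (real (Suc n)))"]) (auto simp: B_def)
  qed
  ultimately show "\<exists>B :: 'a set set. countable B \<and> open = generate_topology B"
    using topological_basis_imp_subbasis by blast
qed


section \<open>Nonempty compact sets with the Hausdorff metric\<close>

typedef (overloaded) 'a compacts = "{K :: 'a::metric_space set. compact K \<and> K \<noteq> {}}"
  morphisms set_of_compacts Compacts
  by (rule exI[of _ "{undefined}"]) auto

lemma compact_set_of_compacts [simp]: "compact (set_of_compacts K)"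
  and set_of_compacts_nonempty [simp]: "set_of_compacts K \<noteq> {}"
  using set_of_compacts[of K] by auto

definition hausdorff_dist :: "'a::metric_space set \<Rightarrow> 'a set \<Rightarrow> real" where
  "hausdorff_dist K L = max (SUP x\<in>K. infdist x L) (SUP y\<in>L. infdist y K)"

lemma hausdorff_dist_le_iff:
  assumes "compact K" "K \<noteq> {}" "compact L" "L \<noteq> {}"
  shows "hausdorff_dist K L \<le> e \<longleftrightarrow> (\<forall>x\<in>K. infdist x L \<le> e) \<and> (\<forall>y\<in>L. infdist y K \<le> e)"
proof -
  have bdd: "bdd_above ((\<lambda>x. infdist x B) ` A)" if "compact A" for A B :: "'a set"
    by (intro bounded_imp_bdd_above compact_imp_bounded compact_continuous_image
        continuous_on_infdist continuous_on_id that)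
  show ?thesis
    unfolding hausdorff_dist_def using assms bdd by (auto simp: cSUP_le_iff)
qed

instantiation compacts :: (metric_space) metric_space
begin

definition dist_compacts :: "'a compacts \<Rightarrow> 'a compacts \<Rightarrow> real" where
  "dist_compacts K L = hausdorff_dist (set_of_compacts K) (set_of_compacts L)"

definition uniformity_compacts :: "('a compacts \<times> 'a compacts) filter" where
  "uniformity_compacts = (INF e\<in>{0 <..}. principal {(x, y). dist x y < e})"

definition open_compacts :: "'a compacts set \<Rightarrow> bool" where
  "open_compacts S = (\<forall>x\<in>S. \<forall>\<^sub>F (x', y) in uniformity. x' = x \<longrightarrow> y \<in> S)"

instance
proof
  have le: "dist K L \<le> e \<longleftrightarrow> (\<forall>x\<in>set_of_compacts K. infdist x (set_of_compacts L) \<le> e) \<and>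
      (\<forall>y\<in>set_of_compacts L. infdist y (set_of_compacts K) \<le> e)" for K L :: "'a compacts" and e
    unfolding dist_compacts_def by (rule hausdorff_dist_le_iff) auto
  have nonneg: "0 \<le> dist K L" for K L :: "'a compacts"
  proof -
    obtain x where "x \<in> set_of_compacts K" using set_of_compacts_nonempty by blast
    then have "infdist x (set_of_compacts L) \<le> dist K L" using le[of K L "dist K L"] by auto
    then show ?thesis using infdist_nonneg order_trans by blast
  qed
  have zero: "infdist x (set_of_compacts L) \<le> 0 \<longleftrightarrow> x \<in> set_of_compacts L" for x and L :: "'a compacts"
    using infdist_nonneg[of x "set_of_compacts L"]
      in_closed_iff_infdist_zero[of "set_of_compacts L" x] by (auto simp: compact_imp_closed)
  fix K L N :: "'a compacts"
  have "dist K L = 0 \<longleftrightarrow> dist K L \<le> 0" using nonneg[of K L] by auto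
  also have "\<dots> \<longleftrightarrow> set_of_compacts K = set_of_compacts L" unfolding le zero by auto
  finally show "dist K L = 0 \<longleftrightarrow> K = L" by (simp add: set_of_compacts_inject)
  have tri: "infdist x (set_of_compacts L) \<le> dist K N + dist L N"
    if x: "x \<in> set_of_compacts K" for x and K L N :: "'a compacts"
  proof -
    obtain z where z: "z \<in> set_of_compacts N" "infdist x (set_of_compacts N) = dist x z"
    proof -
      obtain z where z: "z \<in> set_of_compacts N" "\<And>y. y \<in> set_of_compacts N \<Longrightarrow> dist x z \<le> dist x y"
        using continuous_attains_inf[of "set_of_compacts N" "dist x"]
          continuous_on_dist[OF continuous_on_const continuous_on_id, of "set_of_compacts N" x]
        by auto
      have "infdist x (set_of_compacts N) = dist x z"
      proof (rule antisym)
        show "infdist x (set_of_compacts N) \<le> dist x z" using z(1) by (rule infdist_le)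
        show "dist x z \<le> infdist x (set_of_compacts N)"
          using z(2) by (auto simp: infdist_notempty intro!: cINF_greatest)
      qed
      with z(1) that show ?thesis by blast
    qed
    have "infdist x (set_of_compacts L) \<le> infdist z (set_of_compacts L) + dist x z"
      by (rule infdist_triangle)
    moreover have "infdist z (set_of_compacts L) \<le> dist L N"
      using le[of L N "dist L N"] z by auto
    moreover have "dist x z \<le> dist K N" using le[of K N "dist K N"] x z by auto
    ultimately show ?thesis by simp
  qed
  show "dist K L \<le> dist K N + dist L N"
    unfolding le using tri[of _ K L N] tri[of _ L K N] by (auto simp: add.commute)
qed (simp_all add: uniformity_compacts_def open_compacts_def)

end


section \<open>Borel probability measures with the topology of weak convergence\<close>

typedef (overloaded) 'a borel_prob =
    "{\<mu> :: 'a::topological_space measure. prob_space \<mu> \<and> sets \<mu> = sets borel}"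
  morphisms measure_of_bp Borel_prob
  by (rule exI[of _ "return borel undefined"]) (auto intro!: prob_space_return)

lemma prob_space_measure_of_bp [simp]: "prob_space (measure_of_bp \<mu>)"
  and sets_measure_of_bp [simp, measurable_cong]: "sets (measure_of_bp \<mu>) = sets borel"
  using measure_of_bp[of \<mu>] by auto

lemma space_measure_of_bp [simp]: "space (measure_of_bp \<mu>) = UNIV"
  using sets_eq_imp_space_eq[OF sets_measure_of_bp[of \<mu>]] by simp

instantiation borel_prob :: (topological_space) topological_space
begin

text \<open>The coarsest topology that makes \<open>\<mu> \<mapsto> \<integral>f d\<mu>\<close> continuous for every bounded continuous
  real function \<open>f\<close>.\<close>

definition open_borel_prob :: "'a borel_prob set \<Rightarrow> bool" where
  "open_borel_prob = generate_topology
     {{\<mu>. (LINT x|measure_of_bp \<mu>. apply_bcontfun f x) \<in> U} |(f :: 'a \<Rightarrow>\<^sub>C real) U. open U}"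

instance
proof
qed (auto simp: open_borel_prob_def intro: generate_topology.intros)

end

lemma tendsto_borel_prob_iff:
  fixes X :: "'b \<Rightarrow> 'a::topological_space borel_prob"
  shows "(X \<longlongrightarrow> \<mu>) F \<longleftrightarrow>
    (\<forall>f :: 'a \<Rightarrow>\<^sub>C real. ((\<lambda>b. LINT x|measure_of_bp (X b). apply_bcontfun f x) \<longlongrightarrow>
       (LINT x|measure_of_bp \<mu>. apply_bcontfun f x)) F)" (is "?L \<longleftrightarrow> ?R")
proof
  assume L: ?L
  show ?R
  proof (intro allI topological_tendstoI)
    fix f :: "'a \<Rightarrow>\<^sub>C real" and U
    assume U: "open U" "(LINT x|measure_of_bp \<mu>. apply_bcontfun f x) \<in> U"
    have "open {\<mu>. (LINT x|measure_of_bp \<mu>. apply_bcontfun f x) \<in> U}"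
      unfolding open_borel_prob_def using U(1) by (intro generate_topology.Basis) blast
    from topological_tendstoD[OF L this] U(2)
    show "\<forall>\<^sub>F b in F. (LINT x|measure_of_bp (X b). apply_bcontfun f x) \<in> U" by simp
  qed
next
  assume R: ?R
  show ?L
  proof (rule topological_tendstoI)
    fix S assume "open S" "\<mu> \<in> S"
    then have "generate_topology
     {{\<mu>. (LINT x|measure_of_bp \<mu>. apply_bcontfun f x) \<in> U} |(f :: 'a \<Rightarrow>\<^sub>C real) U. open U} S"
      by (simp add: open_borel_prob_def)
    then show "\<forall>\<^sub>F b in F. X b \<in> S" using \<open>\<mu> \<in> S\<close>
    proof induction
      case UNIV
      then show ?case by simp
    next
      case (Int a b)
      then show ?case by (auto intro: eventually_conj)
    next
      case (UN K)
      then obtain k where k: "k \<in> K" "\<mu> \<in> k" by blast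
      with UN have "\<forall>\<^sub>F b in F. X b \<in> k" by blast
      then show ?case by (rule eventually_mono) (use k in blast)
    next
      case (Basis s)
      then show ?case using R by (auto dest!: topological_tendstoD)
    qed
  qed
qed

lemma continuous_on_integral_bp:
  fixes f :: "'a::topological_space \<Rightarrow>\<^sub>C real"
  shows "continuous_on UNIV (\<lambda>\<mu>. LINT x|measure_of_bp \<mu>. apply_bcontfun f x)"
  unfolding continuous_on_def
proof
  fix \<nu> :: "'a borel_prob"
  show "((\<lambda>\<mu>. LINT x|measure_of_bp \<mu>. apply_bcontfun f x) \<longlongrightarrow>
      (LINT x|measure_of_bp \<nu>. apply_bcontfun f x)) (at \<nu>)"
    using tendsto_ident_at[of \<nu> UNIV] unfolding tendsto_borel_prob_iff by blast
qed

text \<open>The evaluations \<open>\<mu> \<mapsto> \<mu> B\<close> are measurable for the Borel sets of the weak topology.\<close>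

lemma measurable_measure_of_bp:
  "measure_of_bp \<in> (borel :: 'a::metric_space borel_prob measure) \<rightarrow>\<^sub>M prob_algebra (borel :: 'a measure)"
proof (rule measurable_prob_algebra_generated
    [where \<Omega> = UNIV and G = "Collect closed"])
  show "sets (borel :: 'a measure) = sigma_sets UNIV (Collect closed)"
    by (simp add: borel_eq_closed)
  show "Int_stable (Collect closed :: 'a set set)" by (auto simp: Int_stable_def)
  fix C :: "'a set" assume "C \<in> Collect closed"
  then have C: "closed C" by simp
  show "(\<lambda>\<mu>. emeasure (measure_of_bp \<mu>) C) \<in> borel_measurable borel"
  proof (cases "C = {}")
    case False
    define f where "f n x = max 0 (1 - real n * infdist x C)" for n :: nat and x
    have cont: "continuous_on UNIV (f n)" for n
      unfolding f_def by (intro continuous_intros)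
    have f01: "0 \<le> f n x" "f n x \<le> 1" for n x
      unfolding f_def using infdist_nonneg[of x C] by auto
    have "f n \<in> bcontfun" for n
      unfolding bcontfun_def using cont f01 by (auto simp: bounded_iff intro!: exI[of _ 1])
    then have app: "apply_bcontfun (Bcontfun (f n)) = f n" for n by (rule Bcontfun_inverse)
    have meas: "(\<lambda>\<mu>. LINT x|measure_of_bp \<mu>. f n x) \<in> borel_measurable borel" for n
      using borel_measurable_continuous_onI[OF continuous_on_integral_bp[of "Bcontfun (f n)"]]
      by (simp add: app)
    have lim: "(\<lambda>n. f n x) \<longlonglongrightarrow> indicator C x" for x
    proof (cases "x \<in> C")
      case True
      then show ?thesis by (simp add: f_def)
    next
      case False
      then have "infdist x C > 0" using C \<open>C \<noteq> {}\<close> by (simp add: infdist_pos_not_in_closed)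
      then obtain m :: nat where m: "1 < real m * infdist x C"
        using reals_Archimedean3 by blast
      have "f n x = 0" if "n \<ge> m" for n
      proof -
        have "real m * infdist x C \<le> real n * infdist x C"
          using that infdist_nonneg by (intro mult_right_mono) auto
        then show ?thesis using m by (simp add: f_def)
      qed
      then have "\<forall>\<^sub>F n in sequentially. f n x = indicator C x"
        using False by (auto simp: eventually_sequentially)
      then show ?thesis by (rule tendsto_eventually)
    qed
    have Cb: "C \<in> sets borel" using C by simp
    have "(\<lambda>n. LINT x|measure_of_bp \<mu>. f n x) \<longlonglongrightarrow> (LINT x|measure_of_bp \<mu>. indicator C x)" for \<mu>
    proof (rule integral_dominated_convergence[where w = "\<lambda>_. 1"])
      interpret prob_space "measure_of_bp \<mu>" by simp
      show "integrable (measure_of_bp \<mu>) (\<lambda>_. 1 :: real)" by simp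
      show "f n \<in> borel_measurable (measure_of_bp \<mu>)" for n
        using borel_measurable_continuous_onI[OF cont[of n]]
        by (simp cong: measurable_cong_sets)
      show "(indicator C :: 'a \<Rightarrow> real) \<in> borel_measurable (measure_of_bp \<mu>)" using Cb by simp
    qed (use lim f01 in auto)
    moreover have "(LINT x|measure_of_bp \<mu>. indicator C x) = measure (measure_of_bp \<mu>) C" for \<mu>
      using Cb by simp
    ultimately have "(\<lambda>n. LINT x|measure_of_bp \<mu>. f n x) \<longlonglongrightarrow> measure (measure_of_bp \<mu>) C" for \<mu>
      by simp
    then have "(\<lambda>\<mu>. measure (measure_of_bp \<mu>) C) \<in> borel_measurable borel"
      by (intro borel_measurable_LIMSEQ_real[OF _ meas])
    then have "(\<lambda>\<mu>. ennreal (measure (measure_of_bp \<mu>) C)) \<in> borel_measurable borel" by simp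
    moreover have "ennreal (measure (measure_of_bp \<mu>) C) = emeasure (measure_of_bp \<mu>) C" for \<mu>
    proof -
      interpret prob_space "measure_of_bp \<mu>" by simp
      show ?thesis by (simp add: emeasure_eq_measure)
    qed
    ultimately show ?thesis by simp
  qed simp
qed auto

definition dirac :: "'a::topological_space \<Rightarrow> 'a borel_prob" where
  "dirac a = Borel_prob (return borel a)"

lemma measure_of_bp_dirac: "measure_of_bp (dirac a) = return borel a"
  unfolding dirac_def by (rule Borel_prob_inverse) (auto intro!: prob_space_return)

definition law :: "'i measure \<Rightarrow> ('i \<Rightarrow> 'b::topological_space) \<Rightarrow> 'b borel_prob" where
  "law M X = Borel_prob (distr M borel X)"

lemma measure_of_bp_law:
  assumes "prob_space M" "X \<in> borel_measurable M"
  shows "measure_of_bp (law M X) = distr M borel X"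
  unfolding law_def using assms by (intro Borel_prob_inverse) (auto intro: prob_space.prob_space_distr)


section \<open>Player spaces\<close>

definition atomless :: "'i measure \<Rightarrow> bool" where
  "atomless M \<longleftrightarrow>
     (\<forall>E\<in>sets M. emeasure M E > 0 \<longrightarrow>
        (\<exists>F\<in>sets M. F \<subseteq> E \<and> 0 < emeasure M F \<and> emeasure M F < emeasure M E))"

definition finite_player_space :: "'j measure \<Rightarrow> bool" where
  "finite_player_space P \<longleftrightarrow> prob_space P \<and> finite (space P) \<and> sets P = Pow (space P)"


section \<open>Games\<close>

type_synonym 'a characteristic = "'a compacts \<times> (('a \<times> 'a borel_prob) \<Rightarrow>\<^sub>C real)"

abbreviation actions :: "'a::metric_space characteristic \<Rightarrow> 'a set" where
  "actions c \<equiv> set_of_compacts (fst c)"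

abbreviation payoff :: "'a::metric_space characteristic \<Rightarrow> 'a \<times> 'a borel_prob \<Rightarrow> real" where
  "payoff c \<equiv> apply_bcontfun (snd c)"

text \<open>\<open>\<M>(K)\<close> for \<open>K \<subseteq> A\<close>, its elements being regarded as measures on all of \<open>A\<close>.\<close>

definition probs_on :: "'a::topological_space set \<Rightarrow> 'a borel_prob set" where
  "probs_on K = {\<mu>. measure (measure_of_bp \<mu>) K = 1}"


subsection \<open>Large games\<close>

definition large_game :: "'i measure \<Rightarrow> ('i \<Rightarrow> 'a::metric_space characteristic) \<Rightarrow> bool" where
  "large_game M G \<longleftrightarrow> prob_space M \<and> complete_measure M \<and> atomless M \<and> G \<in> M \<rightarrow>\<^sub>M borel"

definition large_profile ::
    "'i measure \<Rightarrow> ('i \<Rightarrow> 'a::metric_space characteristic) \<Rightarrow> ('i \<Rightarrow> 'a borel_prob) \<Rightarrow> bool" where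
  "large_profile M G g \<longleftrightarrow> g \<in> M \<rightarrow>\<^sub>M borel \<and> (AE i in M. g i \<in> probs_on (actions (G i)))"

definition large_summary :: "'i measure \<Rightarrow> ('i \<Rightarrow> 'a::topological_space borel_prob) \<Rightarrow> 'a borel_prob" where
  "large_summary M g = Borel_prob (measure_of UNIV (sets borel)
     (\<lambda>B. \<integral>\<^sup>+ i. emeasure (measure_of_bp (g i)) B \<partial>M))"

lemma emeasure_large_summary:
  fixes g :: "'i \<Rightarrow> 'a::metric_space borel_prob"
  assumes M: "prob_space M" and g: "g \<in> M \<rightarrow>\<^sub>M borel" and B: "B \<in> sets borel"
  shows "emeasure (measure_of_bp (large_summary M g)) B =
    (\<integral>\<^sup>+ i. emeasure (measure_of_bp (g i)) B \<partial>M)"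
proof -
  interpret prob_space M by (rule M)
  define m where "m B = (\<integral>\<^sup>+ i. emeasure (measure_of_bp (g i)) B \<partial>M)" for B
  define N where "N = measure_of UNIV (sets borel) m"
  have meas: "(\<lambda>i. emeasure (measure_of_bp (g i)) B) \<in> borel_measurable M"
    if "B \<in> sets borel" for B
    using measurable_compose[OF measurable_compose[OF g measurable_prob_algebraD
      [OF measurable_measure_of_bp]] measurable_emeasure_subprob_algebra[OF that]] .
  have ca: "countably_additive (sets borel) m"
  proof (rule countably_additiveI)
    fix A :: "nat \<Rightarrow> 'a set" assume A: "range A \<subseteq> sets borel" "disjoint_family A"
    have "(\<Sum>n. m (A n)) = (\<integral>\<^sup>+ i. (\<Sum>n. emeasure (measure_of_bp (g i)) (A n)) \<partial>M)"
      unfolding m_def using A by (intro nn_integral_suminf[symmetric] meas) auto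
    also have "\<dots> = m (\<Union>n. A n)"
      unfolding m_def using A by (intro nn_integral_cong suminf_emeasure) auto
    finally show "(\<Sum>n. m (A n)) = m (\<Union>n. A n)" .
  qed
  have setsN: "sets N = sets borel"
    unfolding N_def using sets.sigma_sets_eq[of "borel :: 'a measure"] by simp
  have em: "emeasure N B = m B" if "B \<in> sets borel" for B
    using that emeasure_measure_of_sigma[OF _ _ ca, of UNIV B] sets.sigma_algebra_axioms[of "borel :: 'a measure"]
    unfolding N_def by (simp add: positive_def m_def)
  have "m UNIV = 1"
  proof -
    have "emeasure (measure_of_bp (g i)) UNIV = 1" for i
      using prob_space.emeasure_space_1[of "measure_of_bp (g i)"] by simp
    then show ?thesis by (simp add: m_def emeasure_space_1)
  qed
  then have "prob_space N"
    using em[of UNIV] sets_eq_imp_space_eq[OF setsN] by (intro prob_spaceI) simp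
  then have "measure_of_bp (Borel_prob N) = N" using setsN by (intro Borel_prob_inverse) simp
  then show ?thesis using em[OF B] unfolding large_summary_def N_def m_def by simp
qed

definition large_nash ::
    "'i measure \<Rightarrow> ('i \<Rightarrow> 'a::metric_space characteristic) \<Rightarrow> ('i \<Rightarrow> 'a borel_prob) \<Rightarrow> bool" where
  "large_nash M G g \<longleftrightarrow> large_profile M G g \<and>
     (AE i in M. \<forall>\<mu>\<in>probs_on (actions (G i)).
        (LINT a:actions (G i)|measure_of_bp (g i). payoff (G i) (a, large_summary M g)) \<ge>
        (LINT a:actions (G i)|measure_of_bp \<mu>. payoff (G i) (a, large_summary M g)))"


subsection \<open>Finite-player games\<close>

definition finite_profile ::
    "'j measure \<Rightarrow> ('j \<Rightarrow> 'a::metric_space characteristic) \<Rightarrow> ('j \<Rightarrow> 'a borel_prob) \<Rightarrow> bool" where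
  "finite_profile P G g \<longleftrightarrow> (\<forall>i\<in>space P. g i \<in> probs_on (actions (G i)))"

definition finite_summary :: "'j measure \<Rightarrow> ('j \<Rightarrow> 'a::topological_space borel_prob) \<Rightarrow> 'a borel_prob" where
  "finite_summary P g = Borel_prob (measure_of UNIV (sets borel)
     (\<lambda>B. \<Sum>i\<in>space P. emeasure P {i} * emeasure (measure_of_bp (g i)) B))"

lemma emeasure_finite_summary:
  fixes g :: "'j \<Rightarrow> 'a::topological_space borel_prob"
  assumes P: "finite_player_space P" and B: "B \<in> sets borel"
  shows "emeasure (measure_of_bp (finite_summary P g)) B =
    (\<Sum>i\<in>space P. emeasure P {i} * emeasure (measure_of_bp (g i)) B)"
proof -
  interpret prob_space P using P by (simp add: finite_player_space_def)
  have fin: "finite (space P)" and setsP: "sets P = Pow (space P)"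
    using P by (auto simp: finite_player_space_def)
  define m where "m B = (\<Sum>i\<in>space P. emeasure P {i} * emeasure (measure_of_bp (g i)) B)" for B
  define N where "N = measure_of UNIV (sets borel) m"
  have ca: "countably_additive (sets borel) m"
  proof (rule countably_additiveI)
    fix A :: "nat \<Rightarrow> 'a set" assume A: "range A \<subseteq> sets borel" "disjoint_family A"
    have "(\<Sum>n. m (A n)) = (\<Sum>i\<in>space P. \<Sum>n. emeasure P {i} * emeasure (measure_of_bp (g i)) (A n))"
      unfolding m_def by (intro suminf_sum) simp
    also have "\<dots> = (\<Sum>i\<in>space P. emeasure P {i} * (\<Sum>n. emeasure (measure_of_bp (g i)) (A n)))"
      by simp
    also have "\<dots> = m (\<Union>n. A n)"
      unfolding m_def using A by (intro sum.cong arg_cong2[where f = "(*)"] suminf_emeasure) auto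
    finally show "(\<Sum>n. m (A n)) = m (\<Union>n. A n)" .
  qed
  have setsN: "sets N = sets borel"
    unfolding N_def using sets.sigma_sets_eq[of "borel :: 'a measure"] by simp
  have em: "emeasure N B = m B" if "B \<in> sets borel" for B
    using that emeasure_measure_of_sigma[OF _ _ ca, of UNIV B] sets.sigma_algebra_axioms[of "borel :: 'a measure"]
    unfolding N_def by (simp add: positive_def m_def)
  have "m UNIV = 1"
  proof -
    have "emeasure (measure_of_bp (g i)) UNIV = 1" for i
      using prob_space.emeasure_space_1[of "measure_of_bp (g i)"] by simp
    moreover have "(\<Sum>i\<in>space P. emeasure P {i}) = emeasure P (space P)"
      using fin setsP by (intro emeasure_eq_sum_singleton[symmetric]) auto
    ultimately show ?thesis by (simp add: m_def emeasure_space_1)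
  qed
  then have "prob_space N"
    using em[of UNIV] sets_eq_imp_space_eq[OF setsN] by (intro prob_spaceI) simp
  then have "measure_of_bp (Borel_prob N) = N" using setsN by (intro Borel_prob_inverse) simp
  then show ?thesis using em[OF B] unfolding finite_summary_def N_def m_def by simp
qed

definition expected_payoff ::
    "'j measure \<Rightarrow> ('j \<Rightarrow> 'a::metric_space characteristic) \<Rightarrow> 'j \<Rightarrow> ('j \<Rightarrow> 'a borel_prob) \<Rightarrow> real" where
  "expected_payoff P G i g =
     (LINT a:(\<Pi>\<^sub>E j\<in>space P. actions (G j))|(\<Pi>\<^sub>M j\<in>space P. measure_of_bp (g j)).
        payoff (G i) (a i, finite_summary P (\<lambda>j. dirac (a j))))"

definition finite_nash ::
    "'j measure \<Rightarrow> ('j \<Rightarrow> 'a::metric_space characteristic) \<Rightarrow> ('j \<Rightarrow> 'a borel_prob) \<Rightarrow> bool" where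
  "finite_nash P G g \<longleftrightarrow> finite_profile P G g \<and>
     (\<forall>i\<in>space P. \<forall>\<mu>\<in>probs_on (actions (G i)).
        expected_payoff P G i g \<ge> expected_payoff P G i (g(i := \<mu>)))"

end

theory Submission
  imports Defs
begin

text \<open>Record an equilibrium of the \<open>n\<close>-th game by the joint law of characteristic and action. By
  Tychonoff all integrals of bounded functions of the characteristic against the cells of a dyadic
  tree of partitions of \<open>A\<close> converge along one filter finer than \<open>sequentially\<close>; no separability of the
  space of characteristics is needed. On sets that are squeezed between continuous functions the
  limits are finitely additive and dominated by the limit law, hence extend to measures with
  densities, and the densities of the cells assemble to a kernel from characteristics to actions,
  realised as the law of a random branch of the tree. Since no player matters in the limit,
  the empirical distribution of independent play concentrates at \<open>\<tau>\<close>, also after a unilateral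
  deviation, so equilibrium actions are on average almost optimal against \<open>\<tau>\<close>. Regret is
  continuous in the characteristic, uniformly in the action, so this passes to the limit: the
  kernel is carried by the actions without regret, and evaluating it at \<open>G i\<close> gives the equilibrium.\<close>

section \<open>Densities of dominated functionals\<close>

text \<open>The obstacle is the joint limit of characteristics and actions: only the two marginals
  are assumed to converge, payoffs have neither a common bound nor a common modulus of continuity,
  and indicators of cells in \<open>A\<close> are not continuous. Cell masses are therefore made to
  converge by the choice of a filter, at the price of countable additivity, which domination by the
  law of \<open>G\<close> restores. The cells need no continuity property. Mass may drift to the
  boundary of a cell in the limit, but a branch of the tree only remembers a sequence of shrinking
  cells, and both the regret of a fixed characteristic and the test functions for the summary are
  continuous in the action. The missing uniformity of payoffs is supplied by test functions of the
  characteristic, such as the oscillation of the payoff around \<open>\<tau>\<close>, to which the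
  weak convergence of the games applies directly.\<close>

lemma ex_filter_bounded_sequences_converge:
  fixes X :: "nat \<Rightarrow> 'j \<Rightarrow> real"
  obtains F where "F \<noteq> bot" "F \<le> sequentially"
    "\<And>j. bounded (range (\<lambda>n. X n j)) \<Longrightarrow> \<exists>L. ((\<lambda>n. X n j) \<longlongrightarrow> L) F"
proof -
  \<comment> \<open>The index family may be uncountable, so a diagonal subsequence is out of reach
    and a filter takes its place. Unbounded sequences are replaced by 0 to make every factor of the
    product compact.\<close>
  define Z where "Z n j = (if bounded (range (\<lambda>n. X n j)) then X n j else 0)" for n j
  define K where "K j = closure (range (\<lambda>n. Z n j))" for j
  have "bounded (range (\<lambda>n. Z n j))" for j
    by (cases "bounded (range (\<lambda>n. X n j))") (simp_all add: Z_def)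
  then have "compact (K j)" for j
    unfolding K_def compact_closure .
  then have "compactin (product_topology (\<lambda>_. euclidean) UNIV) (Pi\<^sub>E UNIV K)"
    by (simp add: compactin_PiE)
  then have K: "compact (Pi\<^sub>E UNIV K)"
    by (simp add: euclidean_product_topology)
  have "Z n j \<in> K j" for n j
    unfolding K_def by (rule subsetD[OF closure_subset]) simp
  then have "\<forall>\<^sub>F z in filtermap Z sequentially. z \<in> Pi\<^sub>E UNIV K"
    by (simp add: eventually_filtermap PiE_iff)
  with K obtain z where z: "inf (nhds z) (filtermap Z sequentially) \<noteq> bot"
    unfolding compact_filter by (metis filtermap_bot_iff sequentially_bot)
  \<comment> \<open>The coarsest filter below \<open>sequentially\<close> along which
    \<open>Z\<close> tends to \<open>z\<close>; it is proper because \<open>z\<close> is a cluster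
    point.\<close>
  define F where "F = inf (filtercomap Z (nhds z)) sequentially"
  have "F \<noteq> bot"
  proof
    assume "F = bot"
    then have "eventually (\<lambda>_. False) F" by simp
    then obtain S R where S: "eventually S (nhds z)" and R: "eventually R sequentially"
      and SR: "\<And>n. S (Z n) \<Longrightarrow> R n \<Longrightarrow> False"
      unfolding F_def eventually_inf eventually_filtercomap by blast
    from R have "eventually (\<lambda>y. \<not> S y) (filtermap Z sequentially)"
      unfolding eventually_filtermap by (rule eventually_mono) (use SR in blast)
    with S have "eventually (\<lambda>_. False) (inf (nhds z) (filtermap Z sequentially))"
      unfolding eventually_inf by blast
    with z show False by (simp add: trivial_limit_def)
  qed
  moreover have "F \<le> sequentially" by (simp add: F_def)
  moreover have "\<exists>L. ((\<lambda>n. X n j) \<longlongrightarrow> L) F" if "bounded (range (\<lambda>n. X n j))" for j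
  proof -
    have "(Z \<longlongrightarrow> z) F"
      unfolding F_def by (rule filterlim_mono[OF filterlim_filtercomap order_refl]) simp
    then have "((\<lambda>n. Z n j) \<longlongrightarrow> z j) F"
      by (rule continuous_on_tendsto_compose[OF continuous_on_product_coordinates]) simp_all
    then show ?thesis using that by (auto simp: Z_def)
  qed
  ultimately show thesis using that by blast
qed

section \<open>Continuous test functions and finite Borel measures\<close>

lemma closed_indicator_approx:
  fixes C :: "'a::metric_space set"
  assumes C: "closed C"
  obtains f :: "nat \<Rightarrow> 'a \<Rightarrow> real"
  where "\<And>n. continuous_on UNIV (f n)" "\<And>n x. 0 \<le> f n x \<and> f n x \<le> 1"
    "\<And>x. (\<lambda>n. f n x) \<longlonglongrightarrow> indicator C x"
proof (cases "C = {}")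
  case True
  then show ?thesis by (intro that[of "\<lambda>_ _. 0"]) auto
next
  case False
  define f where "f n x = max 0 (1 - real n * infdist x C)" for n :: nat and x
  have "(\<lambda>n. f n x) \<longlonglongrightarrow> indicator C x" for x
  proof (cases "x \<in> C")
    case False
    then have "infdist x C > 0" using C \<open>C \<noteq> {}\<close> by (simp add: infdist_pos_not_in_closed)
    then have "filterlim (\<lambda>n. infdist x C * real n) at_top sequentially"
      by (intro filterlim_tendsto_pos_mult_at_top[OF tendsto_const]
        filterlim_real_sequentially)
    then have "\<forall>\<^sub>F n in sequentially. infdist x C * real n \<ge> 1"
      by (simp add: filterlim_at_top)
    then have "\<forall>\<^sub>F n in sequentially. f n x = indicator C x"
      by (rule eventually_mono) (use False in \<open>auto simp: f_def mult.commute\<close>)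
    then show ?thesis by (rule tendsto_eventually)
  qed (simp add: f_def)
  moreover have "continuous_on UNIV (f n)" for n
    unfolding f_def by (intro continuous_intros)
  moreover have "0 \<le> f n x \<and> f n x \<le> 1" for n x
    unfolding f_def using infdist_nonneg[of x C] by auto
  ultimately show ?thesis by (rule that[rotated 2])
qed

text \<open>Closed sets form an intersection-stable generator, and their indicators are pointwise
  limits of continuous functions with values in [0,1], so dominated convergence settles equality on
  the generator.\<close>

lemma measure_eqI_continuous:
  fixes N1 N2 :: "'a::metric_space measure"
  assumes "finite_measure N1" "finite_measure N2"
    and sets: "sets N1 = sets borel" "sets N2 = sets borel"
    and eq: "\<And>h. continuous_on UNIV h \<Longrightarrow> (\<And>x. 0 \<le> h x \<and> h x \<le> 1) \<Longrightarrow>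
      (LINT x|N1. h x) = (LINT x|N2. h x :: real)"
  shows "N1 = N2"
proof (rule measure_eqI_generator_eq[where \<Omega> = UNIV and E = "Collect closed" and A = "\<lambda>_. UNIV"])
  interpret N1: finite_measure N1 by fact
  interpret N2: finite_measure N2 by fact
  show "Int_stable (Collect closed :: 'a set set)" by (auto simp: Int_stable_def)
  show "sets N1 = sigma_sets UNIV (Collect closed)" "sets N2 = sigma_sets UNIV (Collect closed)"
    by (simp_all add: sets borel_eq_closed)
  fix C :: "'a set" assume "C \<in> Collect closed"
  then have C: "closed C" by simp
  obtain f :: "nat \<Rightarrow> 'a \<Rightarrow> real" where f: "\<And>n. continuous_on UNIV (f n)"
    "\<And>n x. 0 \<le> f n x \<and> f n x \<le> 1" "\<And>x. (\<lambda>n. f n x) \<longlonglongrightarrow> indicator C x"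
    using closed_indicator_approx[OF C] by metis
  have lim: "(\<lambda>n. LINT x|N. f n x) \<longlonglongrightarrow> measure N C"
    if "finite_measure N" and [measurable_cong]: "sets N = sets borel" for N
  proof -
    interpret finite_measure N by fact
    have "(\<lambda>n. LINT x|N. f n x) \<longlonglongrightarrow> (LINT x|N. indicator C x)"
    proof (rule integral_dominated_convergence[where w = "\<lambda>_. 1"])
      show "f n \<in> borel_measurable N" for n
        using borel_measurable_continuous_onI[OF f(1)] by simp
      show "(indicator C :: _ \<Rightarrow> real) \<in> borel_measurable N"
        using C by (intro borel_measurable_indicator) (simp add: that(2))
    qed (use f in auto)
    then show ?thesis using C sets_eq_imp_space_eq[OF that(2)] by (simp add: that(2))
  qed
  have "(\<lambda>n. LINT x|N1. f n x) \<longlonglongrightarrow> measure N2 C"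
    using lim[OF assms(2) sets(2)] by (simp add: eq f(1,2))
  then have "measure N1 C = measure N2 C"
    using lim[OF assms(1) sets(1)] LIMSEQ_unique by blast
  then show "emeasure N1 C = emeasure N2 C"
    by (simp add: N1.emeasure_eq_measure N2.emeasure_eq_measure)
qed (use finite_measure.emeasure_finite[OF assms(1)] in \<open>auto simp: image_def\<close>)

text \<open>Domination replaces countable additivity: along sets decreasing to the empty set,
  \<open>Q\<close> is forced to 0 by \<open>P\<close>, and this continuity at the empty set is all
  that Caratheodory's theorem asks of a finite content.\<close>

lemma dominated_content_extends:
  fixes Q :: "'x set \<Rightarrow> real"
  assumes P: "finite_measure P" and alg: "algebra (space P) \<A>"
    and sets: "sets P = sigma_sets (space P) \<A>"
    and Q: "\<And>E. E \<in> \<A> \<Longrightarrow> 0 \<le> Q E" "\<And>E. E \<in> \<A> \<Longrightarrow> Q E \<le> measure P E"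
    and add: "\<And>D E. D \<in> \<A> \<Longrightarrow> E \<in> \<A> \<Longrightarrow> D \<inter> E = {} \<Longrightarrow> Q (D \<union> E) = Q D + Q E"
  obtains N where "finite_measure N" "sets N = sets P" "\<And>E. E \<in> \<A> \<Longrightarrow> measure N E = Q E"
proof -
  interpret finite_measure P by fact
  interpret algebra "space P" \<A> by fact
  have Q0: "Q {} = 0" using Q[of "{}"] by simp
  have sub: "\<A> \<subseteq> sets P" using sets by (auto intro: sigma_sets.Basic)
  have "\<exists>\<mu>. (\<forall>E\<in>\<A>. \<mu> E = ennreal (Q E)) \<and> measure_space (space P) (sigma_sets (space P) \<A>) \<mu>"
  proof (rule caratheodory_empty_continuous)
    show "positive \<A> (\<lambda>E. ennreal (Q E))" by (simp add: positive_def Q0)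
    show "additive \<A> (\<lambda>E. ennreal (Q E))"
      unfolding additive_def using Q add by (auto simp: ennreal_plus)
    fix A :: "nat \<Rightarrow> 'x set" assume A: "range A \<subseteq> \<A>" "decseq A" "(\<Inter>i. A i) = {}"
    have "(\<lambda>i. measure P (A i)) \<longlonglongrightarrow> measure P (\<Inter>i. A i)"
      using A sub by (intro finite_Lim_measure_decseq) auto
    then have lim: "(\<lambda>i. measure P (A i)) \<longlonglongrightarrow> 0" using A(3) by simp
    have "(\<lambda>i. Q (A i)) \<longlonglongrightarrow> 0"
    proof (rule tendsto_sandwich[OF _ _ tendsto_const lim]; intro always_eventually allI)
      show "0 \<le> Q (A i)" "Q (A i) \<le> measure P (A i)" for i using A(1) Q by auto
    qed
    from tendsto_ennrealI[OF this] show "(\<lambda>i. ennreal (Q (A i))) \<longlonglongrightarrow> 0" by simp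
  qed simp
  then obtain \<mu> where \<mu>: "\<And>E. E \<in> \<A> \<Longrightarrow> \<mu> E = ennreal (Q E)"
    "measure_space (space P) (sets P) \<mu>" unfolding sets by blast
  define N where "N = measure_of (space P) (sets P) \<mu>"
  have setsN: "sets N = sets P" and spN: "space N = space P"
    by (simp_all add: N_def space_measure_of[OF sets.space_closed])
  have em: "emeasure N E = \<mu> E" if "E \<in> sets P" for E
    using \<mu>(2) that unfolding measure_space_def N_def
    by (intro emeasure_measure_of_sigma) auto
  have "emeasure N (space N) = ennreal (Q (space P))"
    using em \<mu>(1) spN by simp
  then have "finite_measure N" by (intro finite_measureI) simp
  moreover have "measure N E = Q E" if "E \<in> \<A>" for E
    using em[of E] \<mu>(1)[OF that] that sub Q(1)[OF that] by (auto simp: measure_def)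
  ultimately show thesis using that setsN by blast
qed

text \<open>Domination by \<open>P\<close> is known on the algebra only. Extending the complementary
  content \<open>measure P E - Q E\<close> as well carries it over to all measurable sets: by
  Dynkin's argument the two extensions add up to \<open>P\<close>, so both are absolutely continuous
  and their densities add up to 1 almost everywhere.\<close>

lemma dominated_content_density:
  fixes Q :: "'x set \<Rightarrow> real"
  assumes P: "finite_measure P" and alg: "algebra (space P) \<A>"
    and sets: "sets P = sigma_sets (space P) \<A>"
    and Q: "\<And>E. E \<in> \<A> \<Longrightarrow> 0 \<le> Q E" "\<And>E. E \<in> \<A> \<Longrightarrow> Q E \<le> measure P E"
    and add: "\<And>D E. D \<in> \<A> \<Longrightarrow> E \<in> \<A> \<Longrightarrow> D \<inter> E = {} \<Longrightarrow> Q (D \<union> E) = Q D + Q E"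
  obtains w :: "'x \<Rightarrow> real" where "w \<in> borel_measurable P" "\<And>x. 0 \<le> w x \<and> w x \<le> 1"
    "\<And>E. E \<in> \<A> \<Longrightarrow> (LINT x|P. w x * indicator E x) = Q E"
proof -
  interpret finite_measure P by fact
  interpret algebra "space P" \<A> by fact
  have sub: "\<A> \<subseteq> sets P" using sets by (auto intro: sigma_sets.Basic)
  obtain N1 where N1: "finite_measure N1" "sets N1 = sets P" "\<And>E. E \<in> \<A> \<Longrightarrow> measure N1 E = Q E"
    by (rule dominated_content_extends[OF P alg sets, where Q = Q]) (use Q add in auto)
  obtain N2 where N2: "finite_measure N2" "sets N2 = sets P"
    "\<And>E. E \<in> \<A> \<Longrightarrow> measure N2 E = measure P E - Q E"
  proof (rule dominated_content_extends[OF P alg sets, where Q = "\<lambda>E. measure P E - Q E"])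
    show "measure P (D \<union> E) - Q (D \<union> E) = measure P D - Q D + (measure P E - Q E)"
      if "D \<in> \<A>" "E \<in> \<A>" "D \<inter> E = {}" for D E
      using add[OF that] finite_measure_Union[of D E] that sub by auto
  qed (use Q in auto)
  interpret N1: finite_measure N1 by fact
  interpret N2: finite_measure N2 by fact
  have sp: "space N1 = space P" "space N2 = space P"
    using sets_eq_imp_space_eq N1(2) N2(2) by auto
  have sum: "measure N1 E + measure N2 E = measure P E" if "E \<in> sets P" for E
  proof -
    have "E \<in> sigma_sets (space P) \<A>" using that sets by simp
    with Int_stable space_closed show ?thesis
    proof (induction rule: sigma_sets_induct_disjoint)
      case (basic A)
      then show ?case by (simp add: N1 N2)
    next
      case (compl A)
      then have "A \<in> sets P" by (simp add: sets)
      then show ?case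
        using compl N1.finite_measure_compl[of A] N2.finite_measure_compl[of A] finite_measure_compl[of A]
          N1(3)[of "space P"] N2(3)[of "space P"]
        by (simp add: sp N1(2) N2(2))
    next
      case (union A)
      then have A: "range A \<subseteq> sets P" "disjoint_family A" by (simp_all add: sets)
      have "(\<lambda>i. measure N1 (A i) + measure N2 (A i)) sums (measure N1 (\<Union>i. A i) + measure N2 (\<Union>i. A i))"
        using A N1(2) N2(2) by (intro sums_add N1.finite_measure_UNION N2.finite_measure_UNION) auto
      moreover have "(\<lambda>i. measure P (A i)) sums measure P (\<Union>i. A i)"
        using A by (rule finite_measure_UNION)
      ultimately show ?case using union by (simp add: sums_unique2)
    qed simp
  qed
  have ac: "absolutely_continuous P N1" "absolutely_continuous P N2"
  proof -
    have "emeasure N1 E = 0 \<and> emeasure N2 E = 0" if "E \<in> sets P" "emeasure P E = 0" for E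
      using sum[OF that(1)] that(2) measure_nonneg[of N1 E] measure_nonneg[of N2 E]
      by (simp add: N1.emeasure_eq_measure N2.emeasure_eq_measure emeasure_eq_measure add_nonneg_eq_0_iff)
    then show "absolutely_continuous P N1" "absolutely_continuous P N2"
      using N1(2) N2(2) by (auto simp: absolutely_continuous_def null_sets_def)
  qed
  obtain w1 where w1[measurable]: "w1 \<in> borel_measurable P" "density P w1 = N1"
    using Radon_Nikodym[OF ac(1) N1(2)] by blast
  obtain w2 where w2[measurable]: "w2 \<in> borel_measurable P" "density P w2 = N2"
    using Radon_Nikodym[OF ac(2) N2(2)] by blast
  have "AE x in P. w1 x + w2 x = 1"
  proof (rule density_unique_finite_measure)
    fix E assume E: "E \<in> sets P"
    then have "(\<integral>\<^sup>+x. (w1 x + w2 x) * indicator E x \<partial>P) = emeasure N1 E + emeasure N2 E"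
      using w1 w2 by (simp add: emeasure_density[symmetric] distrib_right nn_integral_add)
    also have "\<dots> = emeasure P E"
      using sum[OF E] by (simp add: N1.emeasure_eq_measure N2.emeasure_eq_measure emeasure_eq_measure
          flip: ennreal_plus)
    finally show "(\<integral>\<^sup>+x. (w1 x + w2 x) * indicator E x \<partial>P) = (\<integral>\<^sup>+x. 1 * indicator E x \<partial>P)"
      using E by simp
  qed auto
  then have le1: "AE x in P. w1 x \<le> 1"
    by eventually_elim (metis le_iff_add)
  \<comment> \<open>Truncation at 1 turns the almost sure bound into a bound everywhere and alters
    the density on a null set only.\<close>
  define w where "w x = enn2real (min 1 (w1 x))" for x
  have w01: "0 \<le> w x \<and> w x \<le> 1" for x
    unfolding w_def by (auto simp: enn2real_leI min.coboundedI1)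
  have [measurable]: "w \<in> borel_measurable P" unfolding w_def by measurable
  have "(LINT x|P. w x * indicator E x) = Q E" if E: "E \<in> \<A>" for E
  proof -
    have [measurable]: "E \<in> sets P" using E sub by auto
    have "ennreal (LINT x|P. w x * indicator E x) = (\<integral>\<^sup>+x. ennreal (w x * indicator E x) \<partial>P)"
      using w01 by (intro nn_integral_eq_integral[symmetric] integrable_const_bound[where B = 1])
        (auto simp: indicator_def)
    also have "\<dots> = (\<integral>\<^sup>+x. w1 x * indicator E x \<partial>P)"
    proof (rule nn_integral_cong_AE)
      show "AE x in P. ennreal (w x * indicator E x) = w1 x * indicator E x"
        using le1
      proof eventually_elim
        case (elim x)
        then have "min 1 (w1 x) = w1 x" "w1 x < top"
          by (auto simp: min_def intro: le_less_trans)
        then show ?case by (auto simp: w_def indicator_def)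
      qed
    qed
    also have "\<dots> = ennreal (Q E)"
      using w1 N1(3)[OF E] by (simp add: emeasure_density[symmetric] N1.emeasure_eq_measure)
    finally show ?thesis
      using Q(1)[OF E] w01 by (simp add: integral_nonneg_AE)
  qed
  then show thesis by (rule that[OF \<open>w \<in> borel_measurable P\<close> w01])
qed

text \<open>These sets take the place of the continuity sets in the portmanteau theorem: weak convergence
  controls their masses through the squeezing functions alone.\<close>

definition squeezed_sets :: "'x::metric_space measure \<Rightarrow> 'x set set" where
  "squeezed_sets P = {E \<in> sets borel. \<forall>\<epsilon>>0. \<exists>f g :: 'x \<Rightarrow> real.
     continuous_on UNIV f \<and> continuous_on UNIV g \<and>
     (\<forall>x. 0 \<le> f x \<and> f x \<le> indicator E x \<and> indicator E x \<le> g x \<and> g x \<le> 1) \<and>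
     (LINT x|P. g x - f x) < \<epsilon>}"

lemma squeezed_setsE:
  assumes "E \<in> squeezed_sets P" "\<epsilon> > 0"
  obtains f g :: "'x::metric_space \<Rightarrow> real" where "continuous_on UNIV f" "continuous_on UNIV g"
    "\<And>x. 0 \<le> f x" "\<And>x. f x \<le> indicator E x" "\<And>x. indicator E x \<le> g x" "\<And>x. g x \<le> 1"
    "(LINT x|P. g x - f x) < \<epsilon>"
  using assms unfolding squeezed_sets_def by blast

lemma integrable_continuous_01:
  fixes h :: "'x::metric_space \<Rightarrow> real"
  assumes "finite_measure P" and [measurable_cong]: "sets P = sets borel"
    and "continuous_on UNIV h" "\<And>x. 0 \<le> h x" "\<And>x. h x \<le> 1"
  shows "integrable P h"
proof -
  interpret finite_measure P by fact
  have "h \<in> borel_measurable P"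
    using borel_measurable_continuous_onI[OF assms(3)] by simp
  then show ?thesis using assms(4,5) by (intro integrable_const_bound[where B = 1]) auto
qed

text \<open>For a complement the squeezing functions swap roles as \<open>1 - g\<close> and
  \<open>1 - f\<close>. For an intersection pointwise minima serve, since the gap between the minima
  is at most the sum of the two gaps.\<close>

lemma algebra_squeezed_sets:
  assumes P: "finite_measure P" and sets: "sets P = sets borel"
  shows "algebra UNIV (squeezed_sets P)"
  unfolding algebra_iff_Int
proof (intro conjI ballI)
  show "{} \<in> squeezed_sets P"
    unfolding squeezed_sets_def by (auto intro!: exI[of _ "\<lambda>_. 0"])
  show "UNIV - E \<in> squeezed_sets P" if E: "E \<in> squeezed_sets P" for E
    unfolding squeezed_sets_def
  proof (intro CollectI conjI allI impI)
    show "UNIV - E \<in> sets borel" using E by (auto simp: squeezed_sets_def)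
    fix \<epsilon> :: real assume "\<epsilon> > 0"
    from E this obtain f g where fg: "continuous_on UNIV f" "continuous_on UNIV g"
      "\<And>x. 0 \<le> f x" "\<And>x. f x \<le> indicator E x" "\<And>x. indicator E x \<le> g x" "\<And>x. g x \<le> 1"
      "(LINT x|P. g x - f x) < \<epsilon>" by (rule squeezed_setsE) blast
    have "0 \<le> 1 - g x \<and> 1 - g x \<le> indicator (UNIV - E) x \<and>
        indicator (UNIV - E) x \<le> 1 - f x \<and> 1 - f x \<le> 1" for x
      using fg(3-6)[of x] by (cases "x \<in> E") simp_all
    with fg(1,2,7) show "\<exists>f g. continuous_on UNIV f \<and> continuous_on UNIV g \<and>
       (\<forall>x. 0 \<le> f x \<and> f x \<le> indicator (UNIV - E) x \<and> indicator (UNIV - E) x \<le> g x \<and> g x \<le> 1) \<and>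
       (LINT x|P. g x - f x) < \<epsilon>"
      by (intro exI[of _ "\<lambda>x. 1 - g x"] exI[of _ "\<lambda>x. 1 - f x"])
        (simp add: continuous_on_diff)
  qed
  show "D \<inter> E \<in> squeezed_sets P" if D: "D \<in> squeezed_sets P" and E: "E \<in> squeezed_sets P" for D E
    unfolding squeezed_sets_def
  proof (intro CollectI conjI allI impI)
    show "D \<inter> E \<in> sets borel" using D E by (auto simp: squeezed_sets_def)
    fix \<epsilon> :: real assume "\<epsilon> > 0"
    then have "\<epsilon> / 2 > 0" by simp
    from D this obtain f g where fg: "continuous_on UNIV f" "continuous_on UNIV g"
      "\<And>x. 0 \<le> f x" "\<And>x. f x \<le> indicator D x" "\<And>x. indicator D x \<le> g x" "\<And>x. g x \<le> 1"
      "(LINT x|P. g x - f x) < \<epsilon> / 2" by (rule squeezed_setsE) blast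
    from E \<open>\<epsilon> / 2 > 0\<close> obtain f' g' where fg': "continuous_on UNIV f'" "continuous_on UNIV g'"
      "\<And>x. 0 \<le> f' x" "\<And>x. f' x \<le> indicator E x" "\<And>x. indicator E x \<le> g' x" "\<And>x. g' x \<le> 1"
      "(LINT x|P. g' x - f' x) < \<epsilon> / 2" by (rule squeezed_setsE) blast
    have b: "f x \<le> 1" "0 \<le> g x" "f' x \<le> 1" "0 \<le> g' x" for x
      using fg(3-6)[of x] fg'(3-6)[of x] by (auto simp: indicator_def split: if_splits)
    have int: "integrable P f" "integrable P g" "integrable P f'" "integrable P g'"
      by (intro integrable_continuous_01[OF P sets] fg fg' b)+
    have int2: "integrable P (\<lambda>x. min (g x) (g' x) - min (f x) (f' x))"
      using int by (intro Bochner_Integration.integrable_diff integrable_min)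
    have "(LINT x|P. min (g x) (g' x) - min (f x) (f' x)) \<le>
        (LINT x|P. (g x - f x) + (g' x - f' x))"
    proof (rule integral_mono[OF int2])
      show "integrable P (\<lambda>x. g x - f x + (g' x - f' x))" using int by simp
      show "min (g x) (g' x) - min (f x) (f' x) \<le> g x - f x + (g' x - f' x)" for x
        using order_trans[OF fg(4,5)[of x]] order_trans[OF fg'(4,5)[of x]] by linarith
    qed
    also have "\<dots> = (LINT x|P. g x - f x) + (LINT x|P. g' x - f' x)" using int by simp
    also have "\<dots> < \<epsilon>" using fg fg' by simp
    finally have small: "(LINT x|P. min (g x) (g' x) - min (f x) (f' x)) < \<epsilon>" .
    have "0 \<le> min (f x) (f' x) \<and> min (f x) (f' x) \<le> indicator (D \<inter> E) x \<and>
        indicator (D \<inter> E) x \<le> min (g x) (g' x) \<and> min (g x) (g' x) \<le> 1" for x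
      using fg(3-6)[of x] fg'(3-6)[of x] by (auto simp: indicator_def split: if_splits)
    with small show "\<exists>f g. continuous_on UNIV f \<and> continuous_on UNIV g \<and>
       (\<forall>x. 0 \<le> f x \<and> f x \<le> indicator (D \<inter> E) x \<and> indicator (D \<inter> E) x \<le> g x \<and> g x \<le> 1) \<and>
       (LINT x|P. g x - f x) < \<epsilon>"
      using fg(1,2) fg'(1,2)
      by (intro exI[of _ "\<lambda>x. min (f x) (f' x)"] exI[of _ "\<lambda>x. min (g x) (g' x)"]) (auto intro!: continuous_intros)
  qed
qed simp

text \<open>The image measure of \<open>P\<close> under \<open>h\<close> has only countably many
  atoms, so some level \<open>t\<close> between \<open>a\<close> and \<open>b\<close> has a null
  level set. For such a level, steep ramps on either side of \<open>t\<close> squeeze the superlevel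
  set.\<close>

lemma ex_level_squeezed:
  fixes h :: "'x::metric_space \<Rightarrow> real"
  assumes P: "finite_measure P" and sets [measurable_cong]: "sets P = sets borel"
    and h: "continuous_on UNIV h" and "a < b"
  obtains t where "a < t" "t < b" "{x. t < h x} \<in> squeezed_sets P"
proof -
  interpret finite_measure P by fact
  have h_meas[measurable]: "h \<in> borel_measurable borel" using h by (rule borel_measurable_continuous_onI)
  have sp: "space P = UNIV" using sets_eq_imp_space_eq[OF sets] by simp
  interpret D: finite_measure "distr P borel h" by (rule finite_measure_distr) simp
  have "uncountable ({a<..<b} - {t. measure (distr P borel h) {t} \<noteq> 0})"
    using \<open>a < b\<close> D.countable_support by (simp add: uncountable_minus_countable uncountable_open_interval)
  then obtain t where t: "a < t" "t < b" "measure (distr P borel h) {t} = 0"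
    by (force dest: uncountable_infinite infinite_imp_nonempty)
  then have null: "measure P {x. h x = t} = 0"
    by (simp add: measure_distr sp vimage_def)
  \<comment> \<open>\<open>f n\<close> climbs from 0 to 1 just above the level \<open>t\<close> and
    \<open>g n\<close> just below it, both with slope \<open>n\<close> in \<open>h\<close>; in the
    limit they differ on the level set alone.\<close>
  define f g where "f n x = max 0 (min 1 (real n * (h x - t)))"
    and "g n x = max 0 (min 1 (1 + real n * (h x - t)))" for n :: nat and x
  have cont: "continuous_on UNIV (f n)" "continuous_on UNIV (g n)" for n
    unfolding f_def g_def by (intro continuous_intros h)+
  have [measurable]: "f n \<in> borel_measurable borel" "g n \<in> borel_measurable borel" for n
    using cont by (auto intro: borel_measurable_continuous_onI)
  have lim: "(\<lambda>n. g n x - f n x) \<longlonglongrightarrow> indicator {x. h x = t} x" for x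
  proof (cases "h x = t")
    case True
    then show ?thesis by (simp add: f_def g_def)
  next
    case False
    obtain m :: nat where m: "1 < real m * \<bar>h x - t\<bar>"
      using reals_Archimedean3[of "\<bar>h x - t\<bar>"] False by auto
    have "g n x - f n x = 0" if "n \<ge> m" for n
    proof -
      have "1 < real n * \<bar>h x - t\<bar>"
        using m that by (smt (verit) mult_right_mono of_nat_mono)
      then show ?thesis
        using False by (cases "h x < t") (auto simp: f_def g_def abs_if algebra_simps split: if_splits)
    qed
    then have "\<forall>\<^sub>F n in sequentially. g n x - f n x = indicator {x. h x = t} x"
      using False by (auto simp: eventually_sequentially)
    then show ?thesis by (rule tendsto_eventually)
  qed
  have "(\<lambda>n. LINT x|P. g n x - f n x) \<longlonglongrightarrow> (LINT x|P. indicator {x. h x = t} x)"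
  proof (rule integral_dominated_convergence[where w = "\<lambda>_. 1"])
    show "AE x in P. norm (g n x - f n x) \<le> 1" for n
      by (auto simp: f_def g_def)
  qed (use lim in auto)
  then have to0: "(\<lambda>n. LINT x|P. g n x - f n x) \<longlonglongrightarrow> 0"
    using null by (simp add: sp)
  have "{x. t < h x} \<in> squeezed_sets P"
    unfolding squeezed_sets_def
  proof (intro CollectI conjI allI impI)
    show "{x. t < h x} \<in> sets borel" by measurable
    fix \<epsilon> :: real assume "\<epsilon> > 0"
    from order_tendstoD(2)[OF to0 this] obtain n where n: "(LINT x|P. g n x - f n x) < \<epsilon>"
      by (auto simp: eventually_sequentially)
    have "0 \<le> f n x \<and> f n x \<le> indicator {x. t < h x} x \<and> indicator {x. t < h x} x \<le> g n x \<and> g n x \<le> 1" for x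
    proof (cases "t < h x")
      case True
      then have "0 \<le> real n * (h x - t)" by simp
      with True show ?thesis by (simp add: f_def g_def)
    next
      case False
      then have "real n * (h x - t) \<le> 0" by (simp add: mult_le_0_iff)
      with False show ?thesis by (simp add: f_def g_def)
    qed
    with n cont show "\<exists>f g. continuous_on UNIV f \<and> continuous_on UNIV g \<and>
       (\<forall>x. 0 \<le> f x \<and> f x \<le> indicator {x. t < h x} x \<and> indicator {x. t < h x} x \<le> g x \<and> g x \<le> 1) \<and>
       (LINT x|P. g x - f x) < \<epsilon>" by blast
  qed
  with t that show thesis by blast
qed

text \<open>An open set is exhausted by superlevel sets of the distance to its complement, at
  squeezed levels tending to 0. The whole space is treated apart, since the distance to the empty
  set is 0 by convention.\<close>

lemma sigma_sets_squeezed_sets: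
  assumes P: "finite_measure P" and sets: "sets P = sets (borel :: 'x::metric_space measure)"
  shows "sigma_sets UNIV (squeezed_sets P) = sets borel"
proof
  show "sigma_sets UNIV (squeezed_sets P) \<subseteq> sets borel"
    using sets.sigma_sets_subset[of "squeezed_sets P" "borel :: 'x measure"]
    by (auto simp: squeezed_sets_def)
  have "U \<in> sigma_sets UNIV (squeezed_sets P)" if "open U" for U
  proof (cases "U = UNIV")
    case True
    then show ?thesis by (simp add: sigma_sets_top)
  next
    case False
    have "\<exists>t. 0 < t \<and> t < 1 / real (Suc n) \<and> {x. t < infdist x (- U)} \<in> squeezed_sets P" for n
      by (rule ex_level_squeezed[OF P sets, of "\<lambda>x. infdist x (- U)" 0 "1 / real (Suc n)"])
        (auto intro: continuous_intros)
    then obtain t where t: "\<And>n. 0 < t n" "\<And>n. t n < 1 / real (Suc n)"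
      "\<And>n. {x. t n < infdist x (- U)} \<in> squeezed_sets P" by metis
    have "U = (\<Union>n. {x. t n < infdist x (- U)})"
    proof safe
      fix x assume "x \<in> U"
      then have "infdist x (- U) > 0"
        using False \<open>open U\<close> by (intro infdist_pos_not_in_closed) auto
      then obtain n where "1 / real (Suc n) < infdist x (- U)"
        using nat_approx_posE by blast
      then show "x \<in> (\<Union>n. {x. t n < infdist x (- U)})" using t(2)[of n] by (auto intro!: exI[of _ n])
    next
      fix x n assume "t n < infdist x (- U)"
      then show "x \<in> U" using t(1)[of n] by (cases "x \<in> U") auto
    qed
    also have "\<dots> \<in> sigma_sets UNIV (squeezed_sets P)"
      using t(3) by (intro sigma_sets.Union sigma_sets.Basic)
    finally show ?thesis .
  qed
  then show "sets borel \<subseteq> sigma_sets UNIV (squeezed_sets P)"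
    unfolding borel_def by (auto intro!: sigma_sets_mono)
qed

text \<open>The thresholds are not the grid points but one free level inside each grid interval,
  because levels must be chosen to give squeezed sets. The number of thresholds below
  \<open>y\<close> still differs from \<open>real N * y\<close> by at most 1.\<close>

lemma step_approximation:
  fixes t :: "nat \<Rightarrow> real" and y :: real
  assumes N: "N > 0" and t: "\<And>j. j < N \<Longrightarrow> real j / real N < t j \<and> t j < real (Suc j) / real N"
    and y: "0 \<le> y" "y \<le> 1"
  shows "\<bar>y - (\<Sum>j<N. of_bool (t j < y) / real N)\<bar> \<le> 1 / real N"
proof -
  define S where "S = {j. j < N \<and> t j < y}"
  have fin: "finite S" by (simp add: S_def)
  have "(\<Sum>j<N. of_bool (t j < y) / real N) = (\<Sum>j<N. of_bool (t j < y)) / real N"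
    by (rule sum_divide_distrib[symmetric])
  also have "(\<Sum>j<N. of_bool (t j < y)) = real (card S)"
    by (simp add: S_def Int_def conj_commute)
  finally have eq: "(\<Sum>j<N. of_bool (t j < y) / real N) = real (card S) / real N" .
  define z where "z = real N * y"
  have z: "0 \<le> z" "z \<le> real N" using N y by (auto simp: z_def mult_left_le)
  have "{..<nat \<lfloor>z\<rfloor>} \<subseteq> S"
  proof
    fix j assume "j \<in> {..<nat \<lfloor>z\<rfloor>}"
    then have j: "real (Suc j) \<le> z" by simp linarith
    then have "real (Suc j) \<le> real N" using z by linarith
    then have jN: "j < N" by simp
    have "real (Suc j) / real N \<le> y" using j N by (simp add: z_def field_simps)
    with t[OF jN] jN show "j \<in> S" by (auto simp: S_def)
  qed
  from card_mono[OF fin this] have "z - 1 \<le> real (card S)" by simp linarith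
  moreover have "S \<subseteq> {..<nat \<lceil>z\<rceil>}"
  proof
    fix j assume "j \<in> S"
    then have "real j / real N < y" using t[of j] by (auto simp: S_def)
    then have "real j < z" using N by (simp add: z_def field_simps)
    then show "j \<in> {..<nat \<lceil>z\<rceil>}" by simp linarith
  qed
  from card_mono[OF _ this] have "real (card S) \<le> z + 1" using z by simp linarith
  ultimately have "\<bar>z - real (card S)\<bar> \<le> 1" by linarith
  then have "\<bar>z - real (card S)\<bar> / real N \<le> 1 / real N" by (rule divide_right_mono) simp
  moreover have "y - real (card S) / real N = (z - real (card S)) / real N"
    using N by (simp add: z_def field_simps)
  ultimately show ?thesis unfolding eq by (simp add: abs_divide)
qed

text \<open>A cluster point of averages is defined on all bounded functions but is only finitely
  additive there. On indicators of squeezed sets it is a content dominated by \<open>P\<close>,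
  hence has a density; a continuous function is recovered from its superlevel sets at squeezed
  levels by uniform approximation.\<close>

lemma dominated_functional_density:
  fixes P :: "'x::metric_space measure" and \<Lambda> :: "('x \<Rightarrow> real) \<Rightarrow> real"
  assumes P: "prob_space P" and sets [measurable_cong]: "sets P = sets borel"
    and add: "\<And>f g. bounded (range f) \<Longrightarrow> bounded (range g) \<Longrightarrow> \<Lambda> (\<lambda>x. f x + g x) = \<Lambda> f + \<Lambda> g"
    and scale: "\<And>f c. bounded (range f) \<Longrightarrow> \<Lambda> (\<lambda>x. c * f x) = c * \<Lambda> f"
    and nonneg: "\<And>f. bounded (range f) \<Longrightarrow> (\<And>x. 0 \<le> f x) \<Longrightarrow> 0 \<le> \<Lambda> f"
    and dom: "\<And>h. continuous_on UNIV h \<Longrightarrow> (\<And>x. 0 \<le> h x \<and> h x \<le> 1) \<Longrightarrow> \<Lambda> h \<le> (LINT x|P. h x)"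
  obtains w :: "'x \<Rightarrow> real" where "w \<in> borel_measurable borel" "\<And>x. 0 \<le> w x \<and> w x \<le> 1"
    "\<And>h. continuous_on UNIV h \<Longrightarrow> (\<And>x. 0 \<le> h x \<and> h x \<le> 1) \<Longrightarrow> \<Lambda> h = (LINT x|P. h x * w x)"
proof -
  interpret prob_space P by fact
  have fP: "finite_measure P" by unfold_locales
  have sp: "space P = UNIV" using sets_eq_imp_space_eq[OF sets] by simp
  have bdd01: "bounded (range f)" if "\<And>x. 0 \<le> f x \<and> f x \<le> 1" for f :: "'x \<Rightarrow> real"
    using that by (auto simp: bounded_iff intro!: exI[of _ 1])
  have mono: "\<Lambda> f \<le> \<Lambda> g" if b: "bounded (range f)" "bounded (range g)" and le: "\<And>x. f x \<le> g x" for f g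
  proof -
    have b': "bounded (range (\<lambda>x. g x - f x))"
      using b by (simp add: bounded_minus_comp)
    have "\<Lambda> g = \<Lambda> (\<lambda>x. f x + (g x - f x))" by simp
    also have "\<dots> = \<Lambda> f + \<Lambda> (\<lambda>x. g x - f x)" using b(1) b' by (rule add)
    finally show ?thesis using nonneg[OF b'] le by simp
  qed
  define Q where "Q E = \<Lambda> (indicator E)" for E
  have ind: "bounded (range (indicator E :: 'x \<Rightarrow> real))" for E
    by (intro bdd01) (simp add: indicator_def)
  have alg: "algebra (space P) (squeezed_sets P)"
    using algebra_squeezed_sets[OF fP sets] by (simp add: sp)
  have sig: "sets P = sigma_sets (space P) (squeezed_sets P)"
    using sigma_sets_squeezed_sets[OF fP sets] by (simp add: sp sets)
  have Qle: "Q E \<le> measure P E" if E: "E \<in> squeezed_sets P" for E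
  proof (rule field_le_epsilon)
    fix \<epsilon> :: real assume "\<epsilon> > 0"
    from E this obtain f g where fg: "continuous_on UNIV f" "continuous_on UNIV g"
      "\<And>x. 0 \<le> f x" "\<And>x. f x \<le> indicator E x" "\<And>x. indicator E x \<le> g x" "\<And>x. g x \<le> 1"
      "(LINT x|P. g x - f x) < \<epsilon>" by (rule squeezed_setsE) blast
    have b: "f x \<le> 1" "0 \<le> g x" for x
      using fg(3-6)[of x] by (auto simp: indicator_def split: if_splits)
    have Eb: "E \<in> sets P" using E by (simp add: squeezed_sets_def sets)
    have int: "integrable P f" "integrable P g"
      by (intro integrable_continuous_01[OF fP sets] fg b)+
    \<comment> \<open>Domination speaks of continuous functions only: the indicator is enlarged to
      \<open>g\<close>, and the integral of \<open>g\<close> exceeds that of \<open>f\<close>, which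
      lies below the indicator, by less than \<open>\<epsilon>\<close>.\<close>
    have "Q E \<le> \<Lambda> g" unfolding Q_def using fg b by (intro mono ind bdd01) auto
    also have "\<dots> \<le> (LINT x|P. g x)" using fg b by (intro dom) auto
    also have "\<dots> = (LINT x|P. f x) + (LINT x|P. g x - f x)" using int by simp
    also have "(LINT x|P. f x) \<le> (LINT x|P. indicator E x)"
      using Eb fg(4) by (intro integral_mono int) (auto simp: integrable_indicator_iff less_top[symmetric])
    finally show "Q E \<le> measure P E + \<epsilon>" using fg(7) Eb by (simp add: sets.sets_into_space Int_absorb2)
  qed
  obtain w where w: "w \<in> borel_measurable P" "\<And>x. 0 \<le> w x \<and> w x \<le> 1"
    "\<And>E. E \<in> squeezed_sets P \<Longrightarrow> (LINT x|P. w x * indicator E x) = Q E"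
  proof (rule dominated_content_density[OF fP alg sig, where Q = Q])
    show "Q (D \<union> E) = Q D + Q E" if "D \<inter> E = {}" for D E
      using add[OF ind ind, of D E] that unfolding Q_def
      by (simp add: indicator_add[OF that] del: indicator_add)
  qed (use Qle nonneg[OF ind] in \<open>auto simp: Q_def\<close>)
  note [measurable] = w(1)
  have "\<Lambda> h = (LINT x|P. h x * w x)"
    if h: "continuous_on UNIV h" and h01: "\<And>x. 0 \<le> h x \<and> h x \<le> 1" for h
  proof -
    have h_meas[measurable]: "h \<in> borel_measurable borel" using h by (rule borel_measurable_continuous_onI)
    \<comment> \<open>One \<open>1 / real N\<close> is lost when \<open>\<Lambda>\<close> passes
      from \<open>h\<close> to the step function \<open>s\<close>, the other when the integral
      does.\<close>
    have est: "\<bar>\<Lambda> h - (LINT x|P. h x * w x)\<bar> \<le> 2 / real N" if N: "N > 0" for N :: nat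
    proof -
      have "\<exists>t. real j / real N < t \<and> t < real (Suc j) / real N \<and> {x. t < h x} \<in> squeezed_sets P" for j
        by (rule ex_level_squeezed[OF fP sets h, of "real j / real N" "real (Suc j) / real N"])
          (use N in \<open>auto simp: divide_strict_right_mono\<close>)
      then obtain t where t: "\<And>j. real j / real N < t j \<and> t j < real (Suc j) / real N"
        and tE: "\<And>j. {x. t j < h x} \<in> squeezed_sets P" by metis
      define E where "E j = {x. t j < h x}" for j
      define s where "s x = (\<Sum>j<N. 1 / real N * indicator (E j) x)" for x
      have E_meas[measurable]: "E j \<in> sets borel" for j unfolding E_def by measurable
      have near: "\<bar>h x - s x\<bar> \<le> 1 / real N" for x
        using step_approximation[OF N t, of "h x"] h01[of x]
        by (simp add: s_def E_def indicator_def)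
      have s0: "\<Lambda> (\<lambda>x. \<Sum>j<k. 1 / real N * indicator (E j) x) = (\<Sum>j<k. 1 / real N * Q (E j)) \<and>
          bounded (range (\<lambda>x. \<Sum>j<k. 1 / real N * indicator (E j) x :: real))" for k
      proof (induction k)
        case 0
        show ?case using scale[OF ind, of 0] by (simp add: image_constant_conv)
      next
        case (Suc k)
        have b: "bounded (range (\<lambda>x. 1 / real N * indicator (E k) x :: real))"
          using bounded_scaleR_comp[OF ind[of "E k"], of "1 / real N"] by simp
        show ?case using Suc b add[OF conjunct2[OF Suc] b] scale[OF ind[of "E k"], of "1 / real N"]
          bounded_plus_comp[OF conjunct2[OF Suc] b] by (simp add: Q_def)
      qed
      have \<Lambda>s: "\<Lambda> s = (\<Sum>j<N. 1 / real N * Q (E j))" and bs: "bounded (range s)"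
        using s0[of N] by (simp_all add: s_def[abs_def])
      have ints: "(LINT x|P. s x * w x) = \<Lambda> s"
      proof -
        have i: "integrable P (\<lambda>x. w x * indicator (E j) x)" for j
          using w(2) by (intro integrable_const_bound[where B = 1]) (auto simp: indicator_def)
        have "(LINT x|P. s x * w x) = (LINT x|P. (\<Sum>j<N. 1 / real N * (w x * indicator (E j) x)))"
          by (simp add: s_def sum_distrib_left mult.commute mult.left_commute)
        also have "\<dots> = (\<Sum>j<N. 1 / real N * (LINT x|P. w x * indicator (E j) x))"
          using i by (subst Bochner_Integration.integral_sum) auto
        also have "\<dots> = \<Lambda> s" using w(3)[OF tE] unfolding \<Lambda>s E_def by simp
        finally show ?thesis .
      qed
      have c1: "bounded (range (\<lambda>_ :: 'x. 1 :: real))" by (rule bdd01) simp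
      \<comment> \<open>Together with monotonicity, domination at the constant 1 bounds the effect
        of a uniform error on \<open>\<Lambda>\<close>.\<close>
      have "\<Lambda> (\<lambda>_. 1) \<le> 1" using dom[of "\<lambda>_. 1"] by (simp add: prob_space)
      then have c: "\<Lambda> (\<lambda>_. 1 / real N) \<le> 1 / real N"
        using scale[OF c1, of "1 / real N"] N by (simp add: divide_right_mono)
      have bh: "bounded (range h)" by (rule bdd01) (rule h01)
      have bc: "bounded (range (\<lambda>_ :: 'x. 1 / real N))" by (simp add: image_constant_conv)
      have "\<Lambda> h \<le> \<Lambda> (\<lambda>x. s x + 1 / real N)"
        using near by (intro mono bh bounded_plus_comp bs bc) (simp add: abs_le_iff algebra_simps)
      moreover have "\<Lambda> s \<le> \<Lambda> (\<lambda>x. h x + 1 / real N)"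
        using near by (intro mono bs bounded_plus_comp bh bc) (simp add: abs_le_iff algebra_simps)
      ultimately have 1: "\<bar>\<Lambda> h - \<Lambda> s\<bar> \<le> 1 / real N"
        using c add[OF bs bc] add[OF bh bc] by linarith
      have [measurable]: "s \<in> borel_measurable borel" unfolding s_def by measurable
      have i: "integrable P (\<lambda>x. h x * w x)"
        using w(2) h01 by (intro integrable_const_bound[where B = 1]) (auto intro!: mult_le_one)
      obtain B where B: "\<And>x. \<bar>s x\<bar> \<le> B" using bs by (auto simp: bounded_iff)
      have i2: "integrable P (\<lambda>x. s x * w x)"
      proof (rule integrable_const_bound[where B = B])
        show "AE x in P. norm (s x * w x) \<le> B"
        proof (rule AE_I2)
          fix x
          have "\<bar>s x\<bar> * \<bar>w x\<bar> \<le> B * 1" using B[of x] w(2)[of x] by (intro mult_mono) auto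
          then show "norm (s x * w x) \<le> B" by (simp add: abs_mult)
        qed
      qed simp
      have "\<bar>(LINT x|P. h x * w x) - (LINT x|P. s x * w x)\<bar> \<le> (LINT x|P. \<bar>h x * w x - s x * w x\<bar>)"
        using integral_abs_bound[of P "\<lambda>x. h x * w x - s x * w x"] i i2 by simp
      also have "\<dots> \<le> (LINT x|P. 1 / real N)"
      proof (rule integral_mono)
        show "\<bar>h x * w x - s x * w x\<bar> \<le> 1 / real N" for x
        proof -
          have "\<bar>h x - s x\<bar> * \<bar>w x\<bar> \<le> 1 / real N * 1"
            using near[of x] w(2)[of x] by (intro mult_mono) auto
          then show ?thesis by (simp add: abs_mult[symmetric] algebra_simps)
        qed
      qed (use i i2 in auto)
      finally have "\<bar>(LINT x|P. h x * w x) - (LINT x|P. s x * w x)\<bar> \<le> 1 / real N"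
        by (simp add: prob_space)
      with 1 show ?thesis unfolding ints by (simp add: field_simps)
    qed
    have "\<bar>\<Lambda> h - (LINT x|P. h x * w x)\<bar> \<le> 0"
    proof (rule field_le_epsilon)
      fix e :: real assume "e > 0"
      then obtain N :: nat where N: "2 / e < real N" using reals_Archimedean2 by blast
      then have "N > 0" using \<open>e > 0\<close> by (cases N) (auto simp: divide_less_0_iff)
      have "2 / real N \<le> e" using N \<open>e > 0\<close> \<open>N > 0\<close> by (simp add: field_simps)
      with est[OF \<open>N > 0\<close>] show "\<bar>\<Lambda> h - (LINT x|P. h x * w x)\<bar> \<le> 0 + e" by simp
    qed
    then show ?thesis by simp
  qed
  moreover have "w \<in> borel_measurable borel" using w(1) by simp
  ultimately show thesis using that w(2) by blast
qed

text \<open>Identities between limit masses are available only against continuous functions of the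
  characteristic; this turns them into almost sure identities between weights. The bound is a
  parameter because a sum of two weights is among the densities compared.\<close>

lemma density_unique_continuous:
  fixes w1 w2 :: "'x::metric_space \<Rightarrow> real"
  assumes Q: "finite_measure Q" and sets [measurable_cong]: "sets Q = sets borel"
    and w1: "w1 \<in> borel_measurable borel" "\<And>x. 0 \<le> w1 x \<and> w1 x \<le> B"
    and w2: "w2 \<in> borel_measurable borel" "\<And>x. 0 \<le> w2 x \<and> w2 x \<le> B"
    and eq: "\<And>h. continuous_on UNIV h \<Longrightarrow> (\<And>x. 0 \<le> h x \<and> h x \<le> 1) \<Longrightarrow>
      (LINT x|Q. h x * w1 x) = (LINT x|Q. h x * w2 x)"
  shows "AE x in Q. w1 x = w2 x"
proof -
  interpret finite_measure Q by fact
  note [measurable] = w1(1) w2(1)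
  have fin: "finite_measure (density Q (\<lambda>x. ennreal (w x)))"
    if [measurable]: "w \<in> borel_measurable borel" and w: "\<And>x. 0 \<le> w x \<and> w x \<le> B" for w
  proof (rule finite_measureI)
    have "integrable Q w" using w by (intro integrable_const_bound[where B = B]) auto
    then show "emeasure (density Q (\<lambda>x. ennreal (w x))) (space (density Q (\<lambda>x. ennreal (w x)))) \<noteq> \<infinity>"
      using w by (simp add: emeasure_density nn_integral_eq_integral cong: nn_integral_cong)
  qed
  have "density Q (\<lambda>x. ennreal (w1 x)) = density Q (\<lambda>x. ennreal (w2 x))"
  proof (rule measure_eqI_continuous[OF fin[OF w1] fin[OF w2]])
    fix h :: "'x \<Rightarrow> real" assume h: "continuous_on UNIV h" "\<And>x. 0 \<le> h x \<and> h x \<le> 1"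
    have [measurable]: "h \<in> borel_measurable borel" using h(1) by (rule borel_measurable_continuous_onI)
    have "(LINT x|density Q (\<lambda>x. ennreal (w1 x)). h x) = (LINT x|Q. w1 x * h x)"
      using w1(2) by (intro integral_real_density) auto
    also have "\<dots> = (LINT x|Q. w2 x * h x)" using eq[OF h] by (simp add: mult.commute)
    also have "\<dots> = (LINT x|density Q (\<lambda>x. ennreal (w2 x)). h x)"
      using w2(2) by (intro integral_real_density[symmetric]) auto
    finally show "(LINT x|density Q (\<lambda>x. ennreal (w1 x)). h x) = (LINT x|density Q (\<lambda>x. ennreal (w2 x)). h x)" .
  qed (simp_all add: sets)
  then have "AE x in Q. ennreal (w1 x) = ennreal (w2 x)"
    by (intro density_unique) auto
  then show ?thesis using w1(2) w2(2) by (auto elim!: eventually_mono)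
qed

section \<open>Borel probability measures on a compact metric space\<close>

abbreviation bp_mean :: "'a::topological_space borel_prob \<Rightarrow> ('a \<Rightarrow>\<^sub>C real) \<Rightarrow> real" where
  "bp_mean \<mu> f \<equiv> LINT x|measure_of_bp \<mu>. apply_bcontfun f x"

lemma apply_Bcontfun_continuous:
  fixes f :: "'a::compact_metric_space \<Rightarrow> real"
  assumes "continuous_on UNIV f"
  shows "apply_bcontfun (Bcontfun f) = f"
proof (rule Bcontfun_inverse)
  have "bounded (range f)"
    using compact_continuous_image[OF assms compact_UNIV_metric] by (rule compact_imp_bounded)
  with assms show "f \<in> bcontfun" by (simp add: bcontfun_def)
qed

text \<open>A partition of unity subordinate to a finite net, with rational coefficients:
  \<open>F n q x\<close> is a weighted average of the values \<open>q c\<close> at net points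
  \<open>c\<close> near \<open>x\<close>, so uniform continuity makes it close to
  \<open>f x\<close>. Countability comes from the finiteness of the nets.\<close>

lemma bcontfun_compact_separable:
  "\<exists>D :: ('a::compact_metric_space \<Rightarrow>\<^sub>C real) set. countable D \<and>
    (\<forall>f. \<forall>\<epsilon>>0. \<exists>d\<in>D. \<forall>x. \<bar>apply_bcontfun f x - apply_bcontfun d x\<bar> \<le> \<epsilon>)"
proof -
  have "\<exists>p. finite p \<and> (UNIV :: 'a set) \<subseteq> (\<Union>x\<in>p. ball x (inverse (real (Suc n))))" for n
    using compact_UNIV_metric[where 'a = 'a] unfolding compact_eq_totally_bounded
    by (auto dest: spec[of _ "inverse (real (Suc n))"])
  then obtain p :: "nat \<Rightarrow> 'a set" where fin: "\<And>n. finite (p n)"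
    and cov: "\<And>n. UNIV \<subseteq> (\<Union>x\<in>p n. ball x (inverse (real (Suc n))))" by metis
  define \<psi> where "\<psi> n c x = max 0 (inverse (real (Suc n)) - dist c x)" for n and c x :: 'a
  define S where "S n x = (\<Sum>c\<in>p n. \<psi> n c x)" for n x
  have \<psi>0: "\<psi> n c x \<ge> 0" for n c x by (simp add: \<psi>_def)
  have S0: "S n x > 0" for n x
  proof -
    have "x \<in> (\<Union>c\<in>p n. ball c (inverse (real (Suc n))))" using cov by blast
    then obtain c where c: "c \<in> p n" "dist c x < inverse (real (Suc n))" by auto
    then have "\<psi> n c x > 0" by (simp add: \<psi>_def)
    then show ?thesis unfolding S_def using fin c(1) \<psi>0 by (intro sum_pos2) auto
  qed
  define F where "F n q x = (\<Sum>c\<in>p n. real_of_rat (q c) * \<psi> n c x) / S n x" for n q x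
  have contF: "continuous_on UNIV (F n q)" for n q
    unfolding F_def S_def \<psi>_def
    by (intro continuous_intros) (use S0[unfolded S_def \<psi>_def] in \<open>metis less_irrefl\<close>)
  define D where "D = (\<Union>n. (\<lambda>q. Bcontfun (F n q)) ` (p n \<rightarrow>\<^sub>E UNIV))"
  have "countable D"
    unfolding D_def using fin by (intro countable_UN countable_image countable_PiE) auto
  moreover have "\<exists>d\<in>D. \<forall>x. \<bar>apply_bcontfun f x - apply_bcontfun d x\<bar> \<le> \<epsilon>" if "\<epsilon> > 0" for f \<epsilon>
  proof -
    have "uniformly_continuous_on UNIV (apply_bcontfun f)"
      by (intro compact_uniformly_continuous compact_UNIV_metric) simp
    then obtain \<delta> where \<delta>: "\<delta> > 0"
      "\<And>x y. dist x y < \<delta> \<Longrightarrow> dist (apply_bcontfun f x) (apply_bcontfun f y) < \<epsilon> / 2"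
      unfolding uniformly_continuous_on_def using \<open>\<epsilon> > 0\<close> by (metis UNIV_I half_gt_zero)
    obtain n where n: "inverse (real (Suc n)) < \<delta>" using reals_Archimedean[OF \<delta>(1)] by auto
    have "\<exists>q. \<bar>real_of_rat q - apply_bcontfun f c\<bar> < \<epsilon> / 2" for c
    proof -
      obtain q where "apply_bcontfun f c < real_of_rat q" "real_of_rat q < apply_bcontfun f c + \<epsilon> / 2"
        using of_rat_dense[of "apply_bcontfun f c" "apply_bcontfun f c + \<epsilon> / 2"] \<open>\<epsilon> > 0\<close> by auto
      then show ?thesis by (intro exI[of _ q]) auto
    qed
    then obtain q where q: "\<And>c. \<bar>real_of_rat (q c) - apply_bcontfun f c\<bar> < \<epsilon> / 2" by metis
    have near: "\<bar>apply_bcontfun f x - F n q x\<bar> \<le> \<epsilon>" for x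
    proof -
      have "\<bar>apply_bcontfun f x * S n x - (\<Sum>c\<in>p n. real_of_rat (q c) * \<psi> n c x)\<bar>
          = \<bar>\<Sum>c\<in>p n. (apply_bcontfun f x - real_of_rat (q c)) * \<psi> n c x\<bar>"
        by (simp add: S_def sum_distrib_left sum_subtractf[symmetric] left_diff_distrib)
      also have "\<dots> \<le> (\<Sum>c\<in>p n. \<bar>(apply_bcontfun f x - real_of_rat (q c)) * \<psi> n c x\<bar>)"
        by (rule sum_abs)
      also have "\<dots> \<le> (\<Sum>c\<in>p n. \<epsilon> * \<psi> n c x)"
      proof (rule sum_mono)
        fix c
        show "\<bar>(apply_bcontfun f x - real_of_rat (q c)) * \<psi> n c x\<bar> \<le> \<epsilon> * \<psi> n c x"
        proof (cases "\<psi> n c x = 0")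
          case False
          then have "dist x c < \<delta>" using n by (auto simp: \<psi>_def dist_commute max_def split: if_splits)
          then have "\<bar>apply_bcontfun f x - apply_bcontfun f c\<bar> < \<epsilon> / 2"
            using \<delta>(2) by (simp add: dist_real_def)
          with q[of c] have "\<bar>apply_bcontfun f x - real_of_rat (q c)\<bar> \<le> \<epsilon>" by linarith
          then show ?thesis using \<psi>0 by (simp add: abs_mult mult_right_mono)
        qed simp
      qed
      also have "\<dots> = \<epsilon> * S n x" by (simp add: S_def sum_distrib_left)
      finally have "\<bar>apply_bcontfun f x * S n x - (\<Sum>c\<in>p n. real_of_rat (q c) * \<psi> n c x)\<bar> / S n x \<le> \<epsilon>"
        using S0[of n x] by (simp add: pos_divide_le_eq)
      moreover have "apply_bcontfun f x - F n q x =
          (apply_bcontfun f x * S n x - (\<Sum>c\<in>p n. real_of_rat (q c) * \<psi> n c x)) / S n x"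
        using S0[of n x] by (simp add: F_def field_simps)
      ultimately show ?thesis using S0[of n x] by (simp add: abs_divide)
    qed
    \<comment> \<open>Only the values of \<open>q\<close> on the finite net enter, and restricting
      \<open>q\<close> to the net lands in a countable set of index functions.\<close>
    have "F n (restrict q (p n)) = F n q"
      unfolding F_def by (intro ext arg_cong2[where f = "(/)"] sum.cong) auto
    with near contF have "\<forall>x. \<bar>apply_bcontfun f x - apply_bcontfun (Bcontfun (F n (restrict q (p n)))) x\<bar> \<le> \<epsilon>"
      by (simp add: apply_Bcontfun_continuous)
    moreover have "Bcontfun (F n (restrict q (p n))) \<in> D"
      unfolding D_def by (intro UN_I[of n] imageI restrict_PiE_iff[THEN iffD2]) auto
    ultimately show ?thesis by blast
  qed
  ultimately show ?thesis by blast
qed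

lemma integrable_bcontfun [simp]:
  fixes f :: "'a::metric_space \<Rightarrow>\<^sub>C real"
  shows "integrable (measure_of_bp \<mu>) (apply_bcontfun f)"
proof -
  interpret prob_space "measure_of_bp \<mu>" by simp
  have "apply_bcontfun f \<in> borel_measurable borel" by (rule borel_measurable_continuous_onI) simp
  then show ?thesis
    using norm_bounded[of f] by (intro integrable_const_bound[where B = "norm f"]) auto
qed

lemma integral_bp_close:
  fixes f g :: "'a::metric_space \<Rightarrow>\<^sub>C real"
  assumes "\<And>x. \<bar>apply_bcontfun f x - apply_bcontfun g x\<bar> \<le> \<epsilon>"
  shows "\<bar>bp_mean \<mu> f - bp_mean \<mu> g\<bar> \<le> \<epsilon>"
proof -
  interpret prob_space "measure_of_bp \<mu>" by simp
  have "\<bar>LINT x|measure_of_bp \<mu>. apply_bcontfun f x - apply_bcontfun g x\<bar>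
      \<le> (LINT x|measure_of_bp \<mu>. \<bar>apply_bcontfun f x - apply_bcontfun g x\<bar>)"
    by (rule integral_abs_bound)
  also have "\<dots> \<le> (LINT x|measure_of_bp \<mu>. \<epsilon>)"
    using assms by (intro integral_mono) auto
  also have "\<dots> = \<epsilon>" using prob_space by simp
  finally show ?thesis by simp
qed

text \<open>A uniform approximation of \<open>f\<close> by \<open>d\<close> approximates the means
  simultaneously for all measures, so a countable uniformly dense set of functions and intervals
  with rational ends suffice. The form of the subbasis is recorded because measurability is tested
  on it.\<close>

lemma borel_prob_countable_subbasis:
  "\<exists>B :: 'a::compact_metric_space borel_prob set set. countable B \<and> open = generate_topology B \<and>
    (\<forall>S\<in>B. \<exists>(f :: 'a \<Rightarrow>\<^sub>C real) U. open U \<and>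
      S = {\<mu>. bp_mean \<mu> f \<in> U})"
proof -
  obtain D :: "('a \<Rightarrow>\<^sub>C real) set" where D: "countable D"
    "\<And>f \<epsilon>. \<epsilon> > 0 \<Longrightarrow> \<exists>d\<in>D. \<forall>x. \<bar>apply_bcontfun f x - apply_bcontfun d x\<bar> \<le> \<epsilon>"
    using bcontfun_compact_separable by metis
  define I where "I \<mu> f = bp_mean \<mu> f" for \<mu> and f :: "'a \<Rightarrow>\<^sub>C real"
  define B where "B = (\<lambda>(d, p, q). {\<mu>. I \<mu> d \<in> {real_of_rat p<..<real_of_rat q}}) ` (D \<times> UNIV \<times> UNIV)"
  have "countable B" unfolding B_def using D(1) by (intro countable_image countable_SIGMA) auto
  have basic: "\<exists>f U. open U \<and> S = {\<mu>. I \<mu> f \<in> U}" if "S \<in> B" for S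
    using that unfolding B_def by (auto intro!: exI[of _ "{_<..<_}"])
  have sub: "open S" if "generate_topology B S" for S
    using that
  proof induction
    case (Basis s)
    then show ?case using basic[OF Basis] unfolding open_borel_prob_def I_def
      by (auto intro!: generate_topology.Basis)
  qed auto
  have sup: "generate_topology B S" if "open S" for S
    using that unfolding open_borel_prob_def
  proof induction
    case (Basis s)
    then obtain f U where U: "open U" and s: "s = {\<mu>. I \<mu> f \<in> U}" unfolding I_def by blast
    have "\<exists>b\<in>B. \<mu> \<in> b \<and> b \<subseteq> s" if \<mu>: "\<mu> \<in> s" for \<mu>
    proof -
      have "I \<mu> f \<in> U" using \<mu> s by simp
      with U obtain e where e: "e > 0" "ball (I \<mu> f) e \<subseteq> U" by (meson open_contains_ball)
      \<comment> \<open>The margins are \<open>e / 4\<close>: two of them for exchanging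
        \<open>f\<close> with \<open>d\<close> at \<open>\<nu>\<close> and at \<open>\<mu>\<close>,
        one for the rational interval around the mean of \<open>d\<close>.\<close>
      obtain d where d: "d \<in> D" "\<And>x. \<bar>apply_bcontfun f x - apply_bcontfun d x\<bar> \<le> e / 4"
        using D(2)[of "e / 4" f] e by auto
      have close: "\<bar>I \<nu> f - I \<nu> d\<bar> \<le> e / 4" for \<nu>
        unfolding I_def using d(2) by (rule integral_bp_close)
      obtain p where p: "I \<mu> d - e / 4 < real_of_rat p" "real_of_rat p < I \<mu> d"
        using of_rat_dense[of "I \<mu> d - e / 4" "I \<mu> d"] e by auto
      obtain q where q: "I \<mu> d < real_of_rat q" "real_of_rat q < I \<mu> d + e / 4"
        using of_rat_dense[of "I \<mu> d" "I \<mu> d + e / 4"] e by auto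
      have "{\<nu>. I \<nu> d \<in> {real_of_rat p<..<real_of_rat q}} \<subseteq> s"
      proof
        fix \<nu> assume "\<nu> \<in> {\<nu>. I \<nu> d \<in> {real_of_rat p<..<real_of_rat q}}"
        then have "real_of_rat p < I \<nu> d" "I \<nu> d < real_of_rat q" by auto
        then have "\<bar>I \<nu> f - I \<mu> f\<bar> < e"
          using close[of \<nu>] close[of \<mu>] p q by linarith
        then have "I \<nu> f \<in> ball (I \<mu> f) e" by (simp add: dist_real_def abs_minus_commute)
        with e(2) s show "\<nu> \<in> s" by auto
      qed
      moreover have "{\<nu>. I \<nu> d \<in> {real_of_rat p<..<real_of_rat q}} \<in> B"
        unfolding B_def using d(1) by (intro image_eqI[of _ _ "(d, p, q)"]) auto
      ultimately show ?thesis using p q by (intro bexI) auto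
    qed
    then have "s = \<Union>{b \<in> B. b \<subseteq> s}" by blast
    moreover have "generate_topology B (\<Union>{b \<in> B. b \<subseteq> s})"
      by (intro generate_topology.UN) (auto intro: generate_topology.Basis)
    ultimately show ?case by simp
  qed (auto intro: generate_topology.intros)
  have "open = generate_topology B" using sub sup by blast
  with \<open>countable B\<close> basic show ?thesis unfolding I_def by blast
qed

text \<open>Used for the measurability of the pair of own action and empirical distribution, and for
  a countable neighbourhood base of the limit summary.\<close>

instance borel_prob :: (compact_metric_space) second_countable_topology
proof
  show "\<exists>B :: 'a borel_prob set set. countable B \<and> open = generate_topology B"
    using borel_prob_countable_subbasis by blast
qed

text \<open>Finite intersections of the countable subbasis form a countable base, which generates
  the Borel sets; preimages of subbasic sets are measurable because they only involve a single
  mean.\<close>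

lemma measurable_borel_probI:
  fixes X :: "'b \<Rightarrow> 'a::compact_metric_space borel_prob"
  assumes "\<And>f :: 'a \<Rightarrow>\<^sub>C real. (\<lambda>b. bp_mean (X b) f) \<in> borel_measurable M"
  shows "X \<in> borel_measurable M"
proof -
  obtain B :: "'a borel_prob set set" where B: "countable B" "open = generate_topology B"
    "\<And>S. S \<in> B \<Longrightarrow> \<exists>f :: 'a \<Rightarrow>\<^sub>C real. \<exists>U. open U \<and> S = {\<mu>. bp_mean \<mu> f \<in> U}"
    using borel_prob_countable_subbasis[where 'a = 'a] by metis
  have opB: "open S" if "S \<in> B" for S
    using that by (simp add: B(2) generate_topology.Basis)
  define \<B> where "\<B> = Inter ` {b. finite b \<and> b \<subseteq> B}"
  have pre: "X -` S \<inter> space M \<in> sets M" if S: "S \<in> B" for S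
  proof -
    obtain f :: "'a \<Rightarrow>\<^sub>C real" and U where
      "open U" "S = {\<mu>. bp_mean \<mu> f \<in> U}" using B(3)[OF S] by blast
    then show ?thesis using measurable_sets[OF assms[of f], of U] by (simp add: vimage_def)
  qed
  have countB: "countable \<B>"
    unfolding \<B>_def using B(1) by (intro countable_image countable_Collect_finite_subset)
  have Int_\<B>: "V \<inter> W \<in> \<B>" if V: "V \<in> \<B>" and W: "W \<in> \<B>" for V W
  proof -
    obtain b where b: "finite b" "b \<subseteq> B" "V = \<Inter>b" using V unfolding \<B>_def by blast
    obtain c where c: "finite c" "c \<subseteq> B" "W = \<Inter>c" using W unfolding \<B>_def by blast
    have "V \<inter> W = \<Inter>(b \<union> c)" unfolding b(3) c(3) by (rule Inter_Un_distrib[symmetric])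
    then show ?thesis unfolding \<B>_def using b c by (intro image_eqI[of _ _ "b \<union> c"]) auto
  qed
  have basis: "topological_basis \<B>"
  proof (rule topological_basisI)
    show "open V" if "V \<in> \<B>" for V
      using that opB by (auto simp: \<B>_def intro!: open_Inter)
    fix S :: "'a borel_prob set" and \<mu> assume "open S" "\<mu> \<in> S"
    then show "\<exists>V\<in>\<B>. \<mu> \<in> V \<and> V \<subseteq> S"
      unfolding B(2)
    proof induction
      case UNIV
      then show ?case unfolding \<B>_def by (intro bexI[of _ "\<Inter>{}"]) auto
    next
      case (Int S T)
      then obtain V W where "V \<in> \<B>" "\<mu> \<in> V" "V \<subseteq> S" "W \<in> \<B>" "\<mu> \<in> W" "W \<subseteq> T"
        by (metis IntE)
      with Int_\<B> show ?case by (intro bexI[of _ "V \<inter> W"]) auto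
    next
      case (Basis S)
      then show ?case unfolding \<B>_def by (intro bexI[of _ "\<Inter>{S}"]) auto
    next
      case (UN K)
      then obtain k V where "k \<in> K" "V \<in> \<B>" "\<mu> \<in> V" "V \<subseteq> k" by (metis UnionE)
      then show ?case by (intro bexI[of _ V]) auto
    qed
  qed
  have "X \<in> M \<rightarrow>\<^sub>M sigma UNIV \<B>"
  proof (rule measurable_measure_of)
    fix V assume "V \<in> \<B>"
    then obtain b where b: "finite b" "b \<subseteq> B" "V = \<Inter>b" unfolding \<B>_def by blast
    have "X -` V \<inter> space M = (\<Inter>S\<in>b. X -` S \<inter> space M) \<inter> space M" using b(3) by auto
    also have "\<dots> \<in> sets M"
    proof (cases "b = {}")
      case False
      with b pre show ?thesis
        by (intro sets.Int[OF sets.finite_INT sets.top]) auto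
    qed simp
    finally show "X -` V \<inter> space M \<in> sets M" .
  qed auto
  then show ?thesis by (simp only: borel_eq_countable_basis[OF countB basis])
qed

lemma borel_prob_eqI:
  fixes \<mu> \<nu> :: "'a::compact_metric_space borel_prob"
  assumes "\<And>f :: 'a \<Rightarrow>\<^sub>C real. bp_mean \<mu> f = bp_mean \<nu> f"
  shows "\<mu> = \<nu>"
proof -
  have "measure_of_bp \<mu> = measure_of_bp \<nu>"
  proof (rule measure_eqI_continuous)
    fix h :: "'a \<Rightarrow> real" assume "continuous_on UNIV h"
    then show "(LINT x|measure_of_bp \<mu>. h x) = (LINT x|measure_of_bp \<nu>. h x)"
      using assms[of "Bcontfun h"] by (simp add: apply_Bcontfun_continuous)
  qed (simp_all add: prob_space.finite_measure)
  then show ?thesis by (simp add: measure_of_bp_inject)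
qed

section \<open>Kernels from weights on a binary tree\<close>

text \<open>Enumerate a countable base. By compactness finitely many base sets inside balls of
  radius \<open>\<epsilon> / 2\<close> cover the space, and two points that agree on membership in
  an initial segment containing these sets share one of them. Each set of the enumeration splits the
  cells of one level of the tree.\<close>

lemma ex_separating_open_sets:
  "\<exists>S :: nat \<Rightarrow> 'a::compact_metric_space set. (\<forall>k. open (S k)) \<and>
    (\<forall>\<epsilon>>0. \<exists>k. \<forall>a b. (\<forall>j<k. a \<in> S j \<longleftrightarrow> b \<in> S j) \<longrightarrow> dist a b < \<epsilon>)"
proof -
  obtain B :: "'a set set" where B: "countable B" "topological_basis B"
    using ex_countable_basis by blast
  then have "B \<noteq> {}"
    using topological_basisE[OF B(2) open_UNIV UNIV_I] by blast
  define S where "S = from_nat_into B"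
  have S: "range S = B" unfolding S_def using \<open>B \<noteq> {}\<close> B(1) by (rule range_from_nat_into)
  have "\<exists>k. \<forall>a b. (\<forall>j<k. a \<in> S j \<longleftrightarrow> b \<in> S j) \<longrightarrow> dist a b < \<epsilon>" if "\<epsilon> > 0" for \<epsilon>
  proof -
    have "\<exists>j. a \<in> S j \<and> S j \<subseteq> ball a (\<epsilon> / 2)" for a
      using topological_basisE[OF B(2), of "ball a (\<epsilon> / 2)" a] \<open>\<epsilon> > 0\<close> S
      by (metis centre_in_ball half_gt_zero open_ball rangeE)
    then obtain j where j: "\<And>a. a \<in> S (j a)" "\<And>a. S (j a) \<subseteq> ball a (\<epsilon> / 2)" by metis
    have op: "open (S i)" for i using S B(2) topological_basis_open by blast
    obtain T where T: "finite T" "UNIV \<subseteq> (\<Union>a\<in>T. S (j a))"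
    proof (rule compactE_image[OF compact_UNIV_metric, of UNIV "\<lambda>a. S (j a)"])
      show "UNIV \<subseteq> (\<Union>a. S (j a))" using j(1) by blast
    qed (use op in blast)+
    define k where "k = Suc (Max (j ` T))"
    have "dist a b < \<epsilon>" if ab: "\<forall>i<k. a \<in> S i \<longleftrightarrow> b \<in> S i" for a b
    proof -
      obtain c where c: "c \<in> T" "a \<in> S (j c)" using T(2) by blast
      then have "j c < k" unfolding k_def using T(1) by (simp add: less_Suc_eq_le)
      with ab c(2) have "b \<in> S (j c)" by blast
      with c(2) j(2)[of c] have "a \<in> ball c (\<epsilon> / 2)" "b \<in> ball c (\<epsilon> / 2)" by blast+
      then show ?thesis using dist_triangle_half_r[of c a \<epsilon> b] by simp
    qed
    then show ?thesis by blast
  qed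
  moreover have "open (S k)" for k using S B(2) topological_basis_open by blast
  ultimately show ?thesis by blast
qed

text \<open>The latest decision stands at the head, so that the successors of a node
  \<open>l\<close> are \<open>True # l\<close> and \<open>False # l\<close>.\<close>

primrec address :: "(nat \<Rightarrow> 'a set) \<Rightarrow> nat \<Rightarrow> 'a \<Rightarrow> bool list" where
  "address S 0 a = []"
| "address S (Suc k) a = (a \<in> S k) # address S k a"

definition cell :: "(nat \<Rightarrow> 'a set) \<Rightarrow> bool list \<Rightarrow> 'a set" where
  "cell S l = {a. address S (length l) a = l}"

text \<open>For an empty cell this is an arbitrary point. Such nodes occur in the tree, but the
  weights considered below vanish there.\<close>

definition representative :: "(nat \<Rightarrow> 'a set) \<Rightarrow> bool list \<Rightarrow> 'a" where
  "representative S l = (SOME a. a \<in> cell S l)"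

lemma length_address [simp]: "length (address S k a) = k"
  by (induction k) auto

lemma mem_cell_address [simp]: "a \<in> cell S (address S k a)"
  by (simp add: cell_def)

lemma cell_Nil [simp]: "cell S [] = UNIV"
  by (simp add: cell_def)

lemma cell_Cons: "cell S (b # l) = {a \<in> cell S l. a \<in> S (length l) \<longleftrightarrow> b}"
  by (auto simp: cell_def)

lemma representative_mem: "cell S l \<noteq> {} \<Longrightarrow> representative S l \<in> cell S l"
  unfolding representative_def by (metis ex_in_conv someI_ex)

lemma mem_cell_iff: "length l = k \<Longrightarrow> a \<in> cell S l \<longleftrightarrow> l = address S k a"
  by (auto simp: cell_def)

lemma address_eqD: "address S k a = address S k b \<Longrightarrow> j < k \<Longrightarrow> a \<in> S j \<longleftrightarrow> b \<in> S j"
  by (induction k) (auto simp: less_Suc_eq)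

lemma finite_lists_length [simp]: "finite {l :: bool list. length l = k}"
  using finite_lists_length_eq[of "UNIV :: bool set" k] by simp

lemma cell_measurable [measurable]:
  assumes "\<And>k. open (S k)"
  shows "cell S l \<in> sets borel"
proof (induction l)
  case (Cons b l)
  have "cell S (b # l) = cell S l \<inter> (if b then S (length l) else - S (length l))"
    by (auto simp: cell_Cons)
  also have "\<dots> \<in> sets borel" using Cons assms by auto
  finally show ?case .
qed simp

lemma sum_cells:
  fixes \<phi> :: "bool list \<Rightarrow> real"
  shows "(\<Sum>l | length l = k. \<phi> l * indicator (cell S l) a) = \<phi> (address S k a)"
proof -
  have "(\<Sum>l | length l = k. \<phi> l * indicator (cell S l) a) =
      (\<Sum>l | length l = k. if l = address S k a then \<phi> l else 0)"
    by (intro sum.cong) (auto simp: mem_cell_iff indicator_def)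
  then show ?thesis by simp
qed

text \<open>Nested half-open intervals: the interval of \<open>l\<close> has length \<open>w l\<close> and is split between the two
  successors of \<open>l\<close>, so that a uniformly distributed point of the unit interval selects a branch
  with the probabilities prescribed by \<open>w\<close>.\<close>

primrec left_end :: "(bool list \<Rightarrow> real) \<Rightarrow> bool list \<Rightarrow> real" where
  "left_end w [] = 0"
| "left_end w (b # l) = left_end w l + (if b then w (False # l) else 0)"

definition branch_interval :: "(bool list \<Rightarrow> real) \<Rightarrow> bool list \<Rightarrow> real set" where
  "branch_interval w l = {left_end w l ..< left_end w l + w l}"

definition branch :: "(bool list \<Rightarrow> real) \<Rightarrow> nat \<Rightarrow> real \<Rightarrow> bool list" where
  "branch w k u = (THE l. length l = k \<and> u \<in> branch_interval w l)"

definition branch_limit :: "(nat \<Rightarrow> 'a::metric_space set) \<Rightarrow> (bool list \<Rightarrow> real) \<Rightarrow> real \<Rightarrow> 'a" where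
  "branch_limit S w u = lim (\<lambda>k. representative S (branch w k u))"

definition unit_uniform :: "real measure" where
  "unit_uniform = restrict_space lborel {0..<1}"

definition tree_kernel :: "(nat \<Rightarrow> 'a::metric_space set) \<Rightarrow> (bool list \<Rightarrow> real) \<Rightarrow> 'a borel_prob" where
  "tree_kernel S w = law unit_uniform (branch_limit S w)"

lemma space_unit_uniform [simp]: "space unit_uniform = {0..<1}"
  by (simp add: unit_uniform_def space_restrict_space)

lemma prob_space_unit_uniform: "prob_space unit_uniform"
  by (rule prob_spaceI) (simp add: unit_uniform_def emeasure_restrict_space space_restrict_space)

text \<open>A consistent family of weights, with no countable additivity over cells: mass may run
  along nested cells with empty intersection. Only the emptiness of a single cell constrains its
  weight.\<close>

locale tree_weights =
  fixes S :: "nat \<Rightarrow> 'a::compact_metric_space set" and w :: "bool list \<Rightarrow> real"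
  assumes open_S: "\<And>k. open (S k)"
    and separating: "\<And>\<epsilon>. \<epsilon> > 0 \<Longrightarrow> \<exists>k. \<forall>a b. (\<forall>j<k. a \<in> S j \<longleftrightarrow> b \<in> S j) \<longrightarrow> dist a b < \<epsilon>"
    and w_nonneg: "\<And>l. 0 \<le> w l"
    and w_Nil: "w [] = 1"
    and w_split: "\<And>l. w l = w (True # l) + w (False # l)"
    and w_empty: "\<And>l. cell S l = {} \<Longrightarrow> w l = 0"
begin

lemma branch_interval_split:
  "u \<in> branch_interval w l \<longleftrightarrow> u \<in> branch_interval w (True # l) \<or> u \<in> branch_interval w (False # l)"
  "\<not> (u \<in> branch_interval w (True # l) \<and> u \<in> branch_interval w (False # l))"
  using w_nonneg[of "True # l"] w_nonneg[of "False # l"] w_split[of l]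
  by (auto simp: branch_interval_def)

text \<open>Half-open intervals split into their two successors without gap or overlap, so exactly
  one interval of each level contains \<open>u\<close>.\<close>

lemma ex1_branch:
  assumes "0 \<le> u" "u < 1"
  shows "\<exists>!l. length l = k \<and> u \<in> branch_interval w l"
proof (induction k)
  case 0
  show ?case using assms by (auto simp: branch_interval_def w_Nil)
next
  case (Suc k)
  then obtain l where l: "length l = k" "u \<in> branch_interval w l"
    and uniq: "\<And>l'. length l' = k \<Longrightarrow> u \<in> branch_interval w l' \<Longrightarrow> l' = l" by metis
  from l(2) obtain b where b: "u \<in> branch_interval w (b # l)"
    using branch_interval_split(1)[of u l] by blast
  show ?case
  proof (rule ex1I[of _ "b # l"])
    show "length (b # l) = Suc k \<and> u \<in> branch_interval w (b # l)" using l b by simp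
    fix l' assume l': "length l' = Suc k \<and> u \<in> branch_interval w l'"
    then obtain b' m where m: "l' = b' # m" "length m = k" by (auto simp: length_Suc_conv)
    have "u \<in> branch_interval w m"
      using l' m(1) branch_interval_split(1)[of u m] by (cases b') auto
    then have "m = l" using uniq m(2) by blast
    then show "l' = b # l"
      using l' m(1) b branch_interval_split(2)[of u l] by (cases b'; cases b) auto
  qed
qed

lemma branch:
  assumes "0 \<le> u" "u < 1"
  shows length_branch: "length (branch w k u) = k" and mem_branch: "u \<in> branch_interval w (branch w k u)"
    and branch_unique: "length l = k \<Longrightarrow> u \<in> branch_interval w l \<Longrightarrow> branch w k u = l"
proof -
  have "length (branch w k u) = k \<and> u \<in> branch_interval w (branch w k u)"
    unfolding branch_def using ex1_branch[OF assms] by (rule theI')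
  then show "length (branch w k u) = k" "u \<in> branch_interval w (branch w k u)" by auto
  show "branch w k u = l" if "length l = k" "u \<in> branch_interval w l"
    unfolding branch_def using ex1_branch[OF assms] that by (intro the1_equality) auto
qed

lemma w_branch_pos:
  assumes "0 \<le> u" "u < 1"
  shows "w (branch w k u) > 0"
  using mem_branch[OF assms, of k] by (simp add: branch_interval_def)

lemma representative_branch:
  assumes "0 \<le> u" "u < 1"
  shows "representative S (branch w k u) \<in> cell S (branch w k u)"
  using w_branch_pos[OF assms, of k] w_empty by (intro representative_mem) auto

lemma branch_Suc:
  assumes "0 \<le> u" "u < 1"
  shows "\<exists>b. branch w (Suc k) u = b # branch w k u"
proof -
  obtain b m where m: "branch w (Suc k) u = b # m" "length m = k"
    using length_branch[OF assms, of "Suc k"] by (auto simp: length_Suc_conv)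
  have "u \<in> branch_interval w m"
    using mem_branch[OF assms, of "Suc k"] m(1) branch_interval_split(1)[of u m] by (cases b) auto
  then have "branch w k u = m" using assms m(2) by (intro branch_unique)
  with m(1) show ?thesis by blast
qed

lemma cell_branch_antimono:
  assumes "0 \<le> u" "u < 1" "k \<le> m"
  shows "cell S (branch w m u) \<subseteq> cell S (branch w k u)"
  using \<open>k \<le> m\<close>
proof (induction m rule: dec_induct)
  case (step m)
  obtain b where "branch w (Suc m) u = b # branch w m u" using branch_Suc[OF assms(1,2)] by blast
  then have "cell S (branch w (Suc m) u) \<subseteq> cell S (branch w m u)" by (auto simp: cell_Cons)
  with step show ?case by blast
qed simp

lemma cell_branch_small:
  assumes "\<epsilon> > 0"
  shows "\<exists>k. \<forall>l a b. k \<le> length l \<longrightarrow> a \<in> cell S l \<longrightarrow> b \<in> cell S l \<longrightarrow> dist a b < \<epsilon>"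
proof -
  obtain k where k: "\<And>a b. (\<forall>j<k. a \<in> S j \<longleftrightarrow> b \<in> S j) \<Longrightarrow> dist a b < \<epsilon>"
    using separating[OF assms] by blast
  have "dist a b < \<epsilon>" if "k \<le> length l" "a \<in> cell S l" "b \<in> cell S l" for l a b
    using that address_eqD[of S "length l" a b] by (intro k) (auto simp: cell_def)
  then show ?thesis by blast
qed

text \<open>The cells along a branch are nested and shrink, so their representatives form a Cauchy
  sequence. Its limit need not lie in the cells themselves.\<close>

lemma branch_limit:
  assumes u: "0 \<le> u" "u < 1"
  shows "(\<lambda>k. representative S (branch w k u)) \<longlonglongrightarrow> branch_limit S w u"
proof -
  have "Cauchy (\<lambda>k. representative S (branch w k u))"
  proof (rule metric_CauchyI)
    fix \<epsilon> :: real assume "\<epsilon> > 0"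
    then obtain k where k: "\<And>l a b. k \<le> length l \<Longrightarrow> a \<in> cell S l \<Longrightarrow> b \<in> cell S l \<Longrightarrow> dist a b < \<epsilon>"
      using cell_branch_small by metis
    have "representative S (branch w m u) \<in> cell S (branch w k u)" if "k \<le> m" for m
      using representative_branch[OF u, of m] cell_branch_antimono[OF u that] by blast
    then show "\<exists>M. \<forall>m\<ge>M. \<forall>n\<ge>M. dist (representative S (branch w m u)) (representative S (branch w n u)) < \<epsilon>"
      using k[of "branch w k u"] length_branch[OF u, of k] by (intro exI[of _ k]) auto
  qed
  then show ?thesis
    unfolding branch_limit_def by (simp add: Cauchy_convergent convergent_LIMSEQ_iff[symmetric])
qed

lemma representative_branch_measurable [measurable]:
  "(\<lambda>u. representative S (branch w k u)) \<in> borel_measurable unit_uniform"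
proof (rule measurableI)
  fix V :: "'a set" assume "V \<in> sets borel"
  have "(\<lambda>u. representative S (branch w k u)) -` V \<inter> space unit_uniform =
      (\<Union>l\<in>{l. length l = k \<and> representative S l \<in> V}. branch_interval w l \<inter> {0..<1})"
  proof (intro set_eqI iffI)
    fix u assume "u \<in> (\<lambda>u. representative S (branch w k u)) -` V \<inter> space unit_uniform"
    then have "representative S (branch w k u) \<in> V" "0 \<le> u" "u < 1" by auto
    then show "u \<in> (\<Union>l\<in>{l. length l = k \<and> representative S l \<in> V}. branch_interval w l \<inter> {0..<1})"
      by (intro UN_I[of "branch w k u"]) (simp_all add: length_branch mem_branch)
  next
    fix u assume "u \<in> (\<Union>l\<in>{l. length l = k \<and> representative S l \<in> V}. branch_interval w l \<inter> {0..<1})"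
    then obtain l where l: "length l = k" "representative S l \<in> V" "u \<in> branch_interval w l" "0 \<le> u" "u < 1"
      by auto
    then have "branch w k u = l" by (intro branch_unique)
    with l show "u \<in> (\<lambda>u. representative S (branch w k u)) -` V \<inter> space unit_uniform" by simp
  qed
  also have "\<dots> \<in> sets unit_uniform"
  proof (intro sets.finite_UN)
    show "branch_interval w l \<inter> {0..<1} \<in> sets unit_uniform" for l
      by (auto simp: unit_uniform_def sets_restrict_space branch_interval_def Int_commute)
  qed auto
  finally show "(\<lambda>u. representative S (branch w k u)) -` V \<inter> space unit_uniform \<in> sets unit_uniform" .
qed auto

lemma branch_limit_measurable [measurable]: "branch_limit S w \<in> borel_measurable unit_uniform"
  using branch_limit by (intro borel_measurable_LIMSEQ_metric[OF representative_branch_measurable]) auto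

lemma measure_of_bp_tree_kernel: "measure_of_bp (tree_kernel S w) = distr unit_uniform borel (branch_limit S w)"
  unfolding tree_kernel_def by (intro measure_of_bp_law prob_space_unit_uniform branch_limit_measurable)

lemma branch_interval_unit: "branch_interval w l \<subseteq> {0..<1}"
proof (induction l)
  case (Cons b l)
  have "branch_interval w (b # l) \<subseteq> branch_interval w l"
    using branch_interval_split(1)[of _ l] by (cases b) (auto simp only: subset_iff)
  with Cons show ?case by blast
qed (simp add: branch_interval_def w_Nil)

lemma measure_branch_interval: "measure unit_uniform (branch_interval w l) = w l"
  using branch_interval_unit[of l] w_nonneg[of l]
  by (simp add: unit_uniform_def measure_restrict_space branch_interval_def)

text \<open>At level \<open>k\<close> a random branch passes through \<open>l\<close> with
  probability \<open>w l\<close>, so the finite sum is an expectation and dominated convergence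
  applies. The formula also exhibits the means of the kernel as limits of finite sums in the
  weights, whence its measurability when the weights depend on a parameter.\<close>

lemma tendsto_integral_tree_kernel:
  fixes f :: "'a \<Rightarrow>\<^sub>C real"
  shows "(\<lambda>k. \<Sum>l | length l = k. w l * apply_bcontfun f (representative S l))
    \<longlonglongrightarrow> bp_mean (tree_kernel S w) f"
proof -
  interpret U: prob_space unit_uniform by (rule prob_space_unit_uniform)
  have [measurable]: "apply_bcontfun f \<in> borel_measurable borel" by (rule borel_measurable_continuous_onI) simp
  have "(LINT u|unit_uniform. apply_bcontfun f (representative S (branch w k u))) =
      (\<Sum>l | length l = k. w l * apply_bcontfun f (representative S l))" for k
  proof -
    have J: "branch_interval w l \<in> sets unit_uniform" for l
      using branch_interval_unit[of l]
      by (auto simp: unit_uniform_def sets_restrict_space branch_interval_def image_iff intro!: bexI[of _ "branch_interval w l"])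
    have "(LINT u|unit_uniform. apply_bcontfun f (representative S (branch w k u))) =
        (LINT u|unit_uniform. (\<Sum>l | length l = k. apply_bcontfun f (representative S l) * indicator (branch_interval w l) u))"
    proof (rule Bochner_Integration.integral_cong[OF refl])
      fix u assume "u \<in> space unit_uniform"
      then have u: "0 \<le> u" "u < 1" by auto
      have "(\<Sum>l | length l = k. apply_bcontfun f (representative S l) * indicator (branch_interval w l) u) =
          (\<Sum>l | length l = k. if l = branch w k u then apply_bcontfun f (representative S l) else 0)"
        using mem_branch[OF u, of k] branch_unique[OF u] by (intro sum.cong) (auto simp: indicator_def)
      then show "apply_bcontfun f (representative S (branch w k u)) =
          (\<Sum>l | length l = k. apply_bcontfun f (representative S l) * indicator (branch_interval w l) u)"
        using length_branch[OF u] by simp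
    qed
    also have "\<dots> = (\<Sum>l | length l = k. apply_bcontfun f (representative S l) * w l)"
      using J measure_branch_interval U.emeasure_finite
      by (subst Bochner_Integration.integral_sum) (auto simp: less_top[symmetric] Int_absorb2 branch_interval_unit)
    finally show ?thesis by (simp add: mult.commute)
  qed
  moreover have "(\<lambda>k. LINT u|unit_uniform. apply_bcontfun f (representative S (branch w k u)))
      \<longlonglongrightarrow> (LINT u|unit_uniform. apply_bcontfun f (branch_limit S w u))"
  proof (rule integral_dominated_convergence[where w = "\<lambda>_. norm f"])
    show "AE u in unit_uniform. (\<lambda>k. apply_bcontfun f (representative S (branch w k u)))
        \<longlonglongrightarrow> apply_bcontfun f (branch_limit S w u)"
      using branch_limit
      by (intro AE_I2 continuous_on_tendsto_compose[OF continuous_on_apply_bcontfun[of UNIV f]]) auto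
    show "AE u in unit_uniform. norm (apply_bcontfun f (representative S (branch w k u))) \<le> norm f" for k
      by (intro AE_I2 norm_bounded)
  qed auto
  ultimately show ?thesis by (simp add: measure_of_bp_tree_kernel integral_distr)
qed

text \<open>Every cell on a branch has positive weight, so it contains a point where
  \<open>\<Phi>\<close> is small; these points follow the representatives to the branch limit, and
  continuity yields the value 0 there. Small values suffice, as an infimum over a cell need not be
  attained.\<close>

lemma tree_kernel_concentrated:
  fixes \<Phi> :: "'a \<Rightarrow> real"
  assumes \<Phi>: "continuous_on UNIV \<Phi>" and nonneg: "\<And>a. 0 \<le> \<Phi> a"
    and small: "\<And>l \<epsilon>. w l > 0 \<Longrightarrow> \<epsilon> > 0 \<Longrightarrow> \<exists>a\<in>cell S l. \<Phi> a < \<epsilon>"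
  shows "AE a in measure_of_bp (tree_kernel S w). \<Phi> a = 0"
proof -
  have "\<Phi> (branch_limit S w u) = 0" if u: "0 \<le> u" "u < 1" for u
  proof -
    have "\<exists>a. a \<in> cell S (branch w k u) \<and> \<Phi> a < 1 / real (Suc k)" for k
      using small[OF w_branch_pos[OF u, of k], of "1 / real (Suc k)"] by auto
    then obtain a where a: "\<And>k. a k \<in> cell S (branch w k u)" "\<And>k. \<Phi> (a k) < 1 / real (Suc k)" by metis
    have "(\<lambda>k. dist (representative S (branch w k u)) (a k)) \<longlonglongrightarrow> 0"
    proof (rule metric_LIMSEQ_I)
      fix \<epsilon> :: real assume "\<epsilon> > 0"
      then obtain k where k: "\<And>l a b. k \<le> length l \<Longrightarrow> a \<in> cell S l \<Longrightarrow> b \<in> cell S l \<Longrightarrow> dist a b < \<epsilon>"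
        using cell_branch_small by metis
      show "\<exists>n0. \<forall>n\<ge>n0. dist (dist (representative S (branch w n u)) (a n)) 0 < \<epsilon>"
        using k[OF _ representative_branch[OF u] a(1)] length_branch[OF u] by (intro exI[of _ k]) auto
    qed
    from tendsto_add[OF this tendsto_dist_iff[THEN iffD1, OF branch_limit[OF u]]]
    have "(\<lambda>k. dist (representative S (branch w k u)) (a k) +
        dist (representative S (branch w k u)) (branch_limit S w u)) \<longlonglongrightarrow> 0" by simp
    then have "(\<lambda>k. dist (a k) (branch_limit S w u)) \<longlonglongrightarrow> 0"
      by (rule tendsto_sandwich[OF _ _ tendsto_const, rotated 2])
        (auto intro!: always_eventually simp: dist_commute[of "representative S _" "a _"] dist_triangle)
    then have "a \<longlonglongrightarrow> branch_limit S w u" by (rule tendsto_dist_iff[THEN iffD2])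
    then have "(\<lambda>k. \<Phi> (a k)) \<longlonglongrightarrow> \<Phi> (branch_limit S w u)"
      by (intro continuous_on_tendsto_compose[OF \<Phi>]) auto
    moreover have "(\<lambda>k. \<Phi> (a k)) \<longlonglongrightarrow> 0"
    proof (rule tendsto_sandwich[OF _ _ tendsto_const LIMSEQ_inverse_real_of_nat])
      show "\<forall>\<^sub>F k in sequentially. \<Phi> (a k) \<le> inverse (real (Suc k))"
        using a(2) by (intro always_eventually allI less_imp_le) (simp add: inverse_eq_divide)
    qed (simp add: nonneg)
    ultimately show ?thesis by (rule LIMSEQ_unique)
  qed
  moreover have [measurable]: "\<Phi> \<in> borel_measurable borel" using \<Phi> by (rule borel_measurable_continuous_onI)
  ultimately show ?thesis
    unfolding measure_of_bp_tree_kernel by (subst AE_distr_iff) auto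
qed

end

lemma sum_lists_length_Suc:
  fixes \<phi> :: "bool list \<Rightarrow> 'c::comm_monoid_add"
  shows "(\<Sum>l | length l = Suc k. \<phi> l) = (\<Sum>l | length l = k. \<phi> (True # l) + \<phi> (False # l))"
proof -
  have "{l :: bool list. length l = Suc k} = Cons True ` {l. length l = k} \<union> Cons False ` {l. length l = k}"
    by (auto simp: length_Suc_conv)
  then have "(\<Sum>l | length l = Suc k. \<phi> l) =
      (\<Sum>l\<in>Cons True ` {l. length l = k}. \<phi> l) + (\<Sum>l\<in>Cons False ` {l. length l = k}. \<phi> l)"
    by (simp only:) (subst sum.union_disjoint, auto)
  then show ?thesis by (simp add: sum.reindex sum.distrib)
qed

lemma (in tree_weights) sum_weights: "(\<Sum>l | length l = k. w l) = 1"
proof (induction k)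
  case (Suc k)
  then show ?case by (simp add: sum_lists_length_Suc w_split[symmetric])
qed (simp add: w_Nil)

lemma (in tree_weights) abs_tree_sum_le:
  fixes f :: "'a \<Rightarrow>\<^sub>C real"
  shows "\<bar>\<Sum>l | length l = k. w l * apply_bcontfun f (representative S l)\<bar> \<le> norm f"
proof -
  have "\<bar>\<Sum>l | length l = k. w l * apply_bcontfun f (representative S l)\<bar> \<le>
      (\<Sum>l | length l = k. \<bar>w l * apply_bcontfun f (representative S l)\<bar>)" by (rule sum_abs)
  also have "\<dots> \<le> (\<Sum>l | length l = k. w l * norm f)"
    using w_nonneg norm_bounded[of f] by (intro sum_mono) (auto simp: abs_mult intro!: mult_left_mono)
  also have "\<dots> = norm f" by (simp add: sum_distrib_right[symmetric] sum_weights)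
  finally show ?thesis .
qed

section \<open>Independent play in finite games\<close>

lemma measurable_integral_bp:
  fixes f :: "'a::metric_space \<Rightarrow>\<^sub>C real"
  assumes "g \<in> borel_measurable M"
  shows "(\<lambda>i. bp_mean (g i) f) \<in> borel_measurable M"
  by (rule measurable_compose[OF assms borel_measurable_continuous_onI[OF continuous_on_integral_bp]])

lemma abs_integral_bp_le: "\<bar>LINT x|measure_of_bp \<mu>. apply_bcontfun f x\<bar> \<le> norm f"
  for f :: "'a::metric_space \<Rightarrow>\<^sub>C real"
  using integral_bp_close[of f 0 "norm f" \<mu>] norm_bounded[of f] by simp

text \<open>Both kinds of summary are monadic composites of the player measure with the kernel
  \<open>g\<close>, so the integral formula for \<open>\<bind>\<close> covers them together.\<close>

lemma integral_mixture:
  fixes f :: "'a::metric_space \<Rightarrow>\<^sub>C real"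
  assumes M: "prob_space M" and g: "g \<in> borel_measurable M"
    and N: "\<And>B. B \<in> sets borel \<Longrightarrow>
      emeasure (measure_of_bp \<nu>) B = (\<integral>\<^sup>+ i. emeasure (measure_of_bp (g i)) B \<partial>M)"
  shows "bp_mean \<nu> f =
    (LINT i|M. bp_mean (g i) f)"
proof -
  interpret M: prob_space M by (rule M)
  have K: "(\<lambda>i. measure_of_bp (g i)) \<in> M \<rightarrow>\<^sub>M subprob_algebra borel"
    using measurable_compose[OF g measurable_prob_algebraD[OF measurable_measure_of_bp]] .
  have bind: "measure_of_bp \<nu> = M \<bind> (\<lambda>i. measure_of_bp (g i))"
  proof (rule measure_eqI)
    show "sets (measure_of_bp \<nu>) = sets (M \<bind> (\<lambda>i. measure_of_bp (g i)))"
      using sets_bind[OF sets_kernel[OF K] M.not_empty] by simp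
    show "emeasure (measure_of_bp \<nu>) B = emeasure (M \<bind> (\<lambda>i. measure_of_bp (g i))) B"
      if "B \<in> sets (measure_of_bp \<nu>)" for B
      using that N M.not_empty by (simp add: emeasure_bind[OF _ K])
  qed
  \<comment> \<open>The formula for composites concerns nonnegative integrands; adding the norm
    makes \<open>f\<close> one.\<close>
  define h where "h x = apply_bcontfun f x + norm f" for x
  have [measurable]: "apply_bcontfun f \<in> borel_measurable borel"
    by (rule borel_measurable_continuous_onI) simp
  have h_meas[measurable]: "h \<in> borel_measurable borel" unfolding h_def by measurable
  have h0: "0 \<le> h x" for x using norm_bounded[of f x] by (simp add: h_def)
  have inth: "integrable (measure_of_bp \<mu>) h" for \<mu>
  proof -
    interpret prob_space "measure_of_bp \<mu>" by simp
    show ?thesis unfolding h_def by simp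
  qed
  have eqh: "(LINT x|measure_of_bp \<mu>. h x) = bp_mean \<mu> f + norm f" for \<mu>
  proof -
    interpret prob_space "measure_of_bp \<mu>" by simp
    show ?thesis unfolding h_def using prob_space by simp
  qed
  have m: "(\<lambda>i. bp_mean (g i) f) \<in> borel_measurable M"
    using g by (rule measurable_integral_bp)
  then have intI: "integrable M (\<lambda>i. bp_mean (g i) f)"
    using abs_integral_bp_le[of _ f] by (intro M.integrable_const_bound[where B = "norm f"]) auto
  have intIh: "integrable M (\<lambda>i. LINT x|measure_of_bp (g i). h x)"
    using intI by (simp add: eqh)
  have nnh: "0 \<le> (LINT x|measure_of_bp \<mu>. h x)" for \<mu>
    using h0 by (rule Bochner_Integration.integral_nonneg)
  have "ennreal (LINT x|measure_of_bp \<nu>. h x) = (\<integral>\<^sup>+ x. ennreal (h x) \<partial>measure_of_bp \<nu>)"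
    using h0 inth by (intro nn_integral_eq_integral[symmetric]) auto
  also have "\<dots> = (\<integral>\<^sup>+ i. \<integral>\<^sup>+ x. ennreal (h x) \<partial>measure_of_bp (g i) \<partial>M)"
    unfolding bind using K by (intro nn_integral_bind) measurable
  also have "\<dots> = (\<integral>\<^sup>+ i. ennreal (LINT x|measure_of_bp (g i). h x) \<partial>M)"
    using h0 inth by (intro nn_integral_cong nn_integral_eq_integral) auto
  also have "\<dots> = ennreal (LINT i|M. (LINT x|measure_of_bp (g i). h x))"
    using intIh nnh by (intro nn_integral_eq_integral) simp_all
  finally have "(LINT x|measure_of_bp \<nu>. h x) = (LINT i|M. (LINT x|measure_of_bp (g i). h x))"
    using nnh by simp
  then show ?thesis using intI M.prob_space by (simp add: eqh)
qed

lemma integral_large_summary: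
  fixes f :: "'a::metric_space \<Rightarrow>\<^sub>C real"
  assumes "prob_space M" "g \<in> borel_measurable M"
  shows "bp_mean (large_summary M g) f =
    (LINT i|M. bp_mean (g i) f)"
  using assms by (intro integral_mixture emeasure_large_summary)

lemma finite_player_space_integrable:
  fixes h :: "'j \<Rightarrow> real"
  assumes "finite_player_space P"
  shows "integrable P h" "(LINT i|P. h i) = (\<Sum>i\<in>space P. measure P {i} * h i)"
proof -
  interpret prob_space P using assms by (simp add: finite_player_space_def)
  have fin: "finite (space P)" and sets: "sets P = Pow (space P)"
    using assms by (auto simp: finite_player_space_def)
  have eq: "h i = (\<Sum>j\<in>space P. h j * indicator {j} i)" if "i \<in> space P" for i
    using fin that by (simp add: indicator_def sum.If_cases if_distrib[of "(*) _"] cong: if_cong)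
  have int: "integrable P (\<lambda>i. \<Sum>j\<in>space P. h j * indicator {j} i)"
    using sets emeasure_finite by (intro Bochner_Integration.integrable_sum integrable_mult_right) (auto simp: less_top[symmetric])
  show "integrable P h"
    using int by (subst Bochner_Integration.integrable_cong[OF refl eq]) auto
  have "(LINT i|P. h i) = (LINT i|P. (\<Sum>j\<in>space P. h j * indicator {j} i))"
    by (rule Bochner_Integration.integral_cong[OF refl eq])
  also have "\<dots> = (\<Sum>i\<in>space P. measure P {i} * h i)"
    using sets emeasure_finite
    by (subst Bochner_Integration.integral_sum) (auto simp: less_top[symmetric] mult.commute intro!: sum.cong)
  finally show "(LINT i|P. h i) = (\<Sum>i\<in>space P. measure P {i} * h i)" .
qed

lemma finite_player_space_sum: "finite_player_space P \<Longrightarrow> (\<Sum>i\<in>space P. measure P {i}) = 1"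
  using finite_player_space_integrable(2)[of P "\<lambda>_. 1"]
  by (simp add: finite_player_space_def prob_space.prob_space)

lemma finite_player_space_measurable:
  assumes "finite_player_space P" shows "g \<in> borel_measurable P"
  using assms by (auto simp: finite_player_space_def measurable_def)

lemma integral_finite_summary:
  fixes f :: "'a::metric_space \<Rightarrow>\<^sub>C real"
  assumes P: "finite_player_space P"
  shows "bp_mean (finite_summary P g) f =
    (\<Sum>i\<in>space P. measure P {i} * bp_mean (g i) f)"
proof -
  interpret prob_space P using P by (simp add: finite_player_space_def)
  have fin: "finite (space P)" and sets: "sets P = Pow (space P)"
    using P by (auto simp: finite_player_space_def)
  have "bp_mean (finite_summary P g) f =
    (LINT i|P. bp_mean (g i) f)"
  proof (rule integral_mixture[OF prob_space_axioms finite_player_space_measurable[OF P]])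
    fix B :: "'a set" assume B: "B \<in> sets borel"
    have "(\<integral>\<^sup>+ i. emeasure (measure_of_bp (g i)) B \<partial>P) =
        (\<integral>\<^sup>+ i. ennreal (measure (measure_of_bp (g i)) B) \<partial>P)"
      by (intro nn_integral_cong finite_measure.emeasure_eq_measure prob_space.finite_measure) simp
    also have "\<dots> = ennreal (LINT i|P. measure (measure_of_bp (g i)) B)"
      by (intro nn_integral_eq_integral finite_player_space_integrable(1)[OF P]) auto
    also have "\<dots> = (\<Sum>i\<in>space P. emeasure P {i} * emeasure (measure_of_bp (g i)) B)"
      unfolding finite_player_space_integrable(2)[OF P]
      by (subst sum_ennreal[symmetric])
        (auto intro!: sum.cong simp: ennreal_mult emeasure_eq_measure finite_measure.emeasure_eq_measure[OF prob_space.finite_measure])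
    finally show "emeasure (measure_of_bp (finite_summary P g)) B = (\<integral>\<^sup>+ i. emeasure (measure_of_bp (g i)) B \<partial>P)"
      using emeasure_finite_summary[OF P B, of g] by simp
  qed
  then show ?thesis by (simp add: finite_player_space_integrable(2)[OF P])
qed

lemma integral_dirac: "bp_mean (dirac a) f = apply_bcontfun f a"
  for f :: "'a::metric_space \<Rightarrow>\<^sub>C real"
proof -
  have "apply_bcontfun f \<in> borel_measurable borel" by (rule borel_measurable_continuous_onI) simp
  then show ?thesis unfolding measure_of_bp_dirac by (simp add: integral_return)
qed

section \<open>Concentration of the empirical distribution under independent play\<close>

abbreviation profile_measure :: "'j measure \<Rightarrow> ('j \<Rightarrow> 'a::metric_space borel_prob) \<Rightarrow> ('j \<Rightarrow> 'a) measure" where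
  "profile_measure P \<gamma> \<equiv> \<Pi>\<^sub>M j\<in>space P. measure_of_bp (\<gamma> j)"

abbreviation empirical :: "'j measure \<Rightarrow> ('j \<Rightarrow> 'a::metric_space) \<Rightarrow> 'a borel_prob" where
  "empirical P \<omega> \<equiv> finite_summary P (\<lambda>j. dirac (\<omega> j))"

abbreviation miss_prob :: "'j measure \<Rightarrow> ('j \<Rightarrow> 'a::metric_space borel_prob) \<Rightarrow> 'a borel_prob set \<Rightarrow> real" where
  "miss_prob P \<gamma> N \<equiv> measure (profile_measure P \<gamma>)
     {\<omega> \<in> space (profile_measure P \<gamma>). empirical P \<omega> \<notin> N}"

lemma prob_space_profile_measure: "prob_space (profile_measure P \<gamma>)"
  by (intro prob_space_PiM) simp

lemma integral_empirical:
  fixes f :: "'a::metric_space \<Rightarrow>\<^sub>C real"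
  assumes "finite_player_space P"
  shows "bp_mean (empirical P \<omega>) f =
    (\<Sum>j\<in>space P. measure P {j} * apply_bcontfun f (\<omega> j))"
  by (simp add: integral_finite_summary[OF assms] integral_dirac)

lemma measurable_coordinate:
  assumes "j \<in> space P" "h \<in> borel_measurable borel"
  shows "(\<lambda>\<omega>. h (\<omega> j)) \<in> borel_measurable (profile_measure P \<gamma>)"
  using assms by (intro measurable_PiM_component_rev) (simp_all cong: measurable_cong_sets)

lemma measurable_empirical:
  fixes \<gamma> :: "'j \<Rightarrow> 'a::compact_metric_space borel_prob"
  assumes "finite_player_space P"
  shows "empirical P \<in> borel_measurable (profile_measure P \<gamma>)"
proof (rule measurable_borel_probI)
  fix f :: "'a \<Rightarrow>\<^sub>C real"
  have "apply_bcontfun f \<in> borel_measurable borel" by (rule borel_measurable_continuous_onI) simp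
  then show "(\<lambda>\<omega>. LINT x|measure_of_bp (empirical P \<omega>). apply_bcontfun f x) \<in> borel_measurable (profile_measure P \<gamma>)"
    unfolding integral_empirical[OF assms]
    by (intro borel_measurable_sum borel_measurable_times borel_measurable_const measurable_coordinate)
qed

lemma integral_coordinate:
  fixes f :: "'a::metric_space \<Rightarrow> real"
  assumes "j \<in> space P" "f \<in> borel_measurable borel"
  shows "(LINT \<omega>|profile_measure P \<gamma>. f (\<omega> j)) = (LINT x|measure_of_bp (\<gamma> j). f x)"
proof -
  have "(LINT x|measure_of_bp (\<gamma> j). f x) =
      (LINT x|distr (profile_measure P \<gamma>) (measure_of_bp (\<gamma> j)) (\<lambda>\<omega>. \<omega> j). f x)"
    using assms(1) by (subst distr_PiM_component) auto
  also have "\<dots> = (LINT \<omega>|profile_measure P \<gamma>. f (\<omega> j))"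
    using assms by (intro integral_distr) (auto intro: measurable_component_singleton cong: measurable_cong_sets)
  finally show ?thesis ..
qed

lemma integral_coordinate_product:
  fixes f g :: "'a::metric_space \<Rightarrow> real"
  assumes "finite (space P)" "j \<in> space P" "k \<in> space P" "j \<noteq> k"
    and "integrable (measure_of_bp (\<gamma> j)) f" "integrable (measure_of_bp (\<gamma> k)) g"
  shows "(LINT \<omega>|profile_measure P \<gamma>. f (\<omega> j) * g (\<omega> k)) =
    (LINT x|measure_of_bp (\<gamma> j). f x) * (LINT x|measure_of_bp (\<gamma> k). g x)"
proof -
  interpret product_prob_space "\<lambda>j. measure_of_bp (\<gamma> j)"
    by (intro product_prob_spaceI) simp
  \<comment> \<open>One factor per player, all but two of them constantly 1, so that the product
    formula for integrals applies.\<close>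
  define F where "F i = (if i = j then f else if i = k then g else (\<lambda>_. 1))" for i
  have prod: "(\<Prod>i\<in>space P. G i) = G j * G k" if "\<And>i. i \<noteq> j \<Longrightarrow> i \<noteq> k \<Longrightarrow> G i = (1 :: real)" for G
  proof -
    have "(\<Prod>i\<in>space P. G i) = (\<Prod>i\<in>{j, k}. G i)"
      using assms(1-3) that by (intro prod.mono_neutral_right) auto
    then show ?thesis using assms(4) by simp
  qed
  have "(LINT \<omega>|profile_measure P \<gamma>. (\<Prod>i\<in>space P. F i (\<omega> i))) =
      (\<Prod>i\<in>space P. LINT x|measure_of_bp (\<gamma> i). F i x)"
    using assms by (intro product_integral_prod) (auto simp: F_def)
  also have "\<dots> = (LINT x|measure_of_bp (\<gamma> j). f x) * (LINT x|measure_of_bp (\<gamma> k). g x)"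
    using assms(4) M.prob_space by (subst prod) (auto simp: F_def)
  finally show ?thesis
    using assms(4) by (subst (asm) prod) (auto simp: F_def)
qed

text \<open>Chebyshev's inequality. The centred terms \<open>X j (\<omega> j)\<close> are
  independent, so cross terms vanish, and the variance is at most the sum of the squared player
  weights times \<open>(2 * norm f)\<^sup>2\<close>; since the weights sum to 1 and are at most
  \<open>\<delta>\<close>, so is the sum of their squares.\<close>

lemma empirical_deviation:
  fixes f :: "'a::metric_space \<Rightarrow>\<^sub>C real"
  assumes P: "finite_player_space P" and "\<epsilon> > 0" and m: "\<And>j. j \<in> space P \<Longrightarrow> measure P {j} \<le> \<delta>"
  shows "measure (profile_measure P \<gamma>)
     {\<omega> \<in> space (profile_measure P \<gamma>).
        \<epsilon> \<le> \<bar>bp_mean (empirical P \<omega>) f -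
              bp_mean (finite_summary P \<gamma>) f\<bar>}
     \<le> \<delta> * (2 * norm f)\<^sup>2 / \<epsilon>\<^sup>2"
proof -
  interpret \<Omega>: prob_space "profile_measure P \<gamma>" by (rule prob_space_profile_measure)
  have fin: "finite (space P)" using P by (simp add: finite_player_space_def)
  have f_meas: "apply_bcontfun f \<in> borel_measurable borel" by (rule borel_measurable_continuous_onI) simp
  define X where "X j x = apply_bcontfun f x - bp_mean (\<gamma> j) f" for j x
  define Z where "Z \<omega> = (\<Sum>j\<in>space P. measure P {j} * X j (\<omega> j))" for \<omega>
  have X_meas: "X j \<in> borel_measurable borel" for j unfolding X_def using f_meas by measurable
  have X_le: "\<bar>X j x\<bar> \<le> 2 * norm f" for j x
    using norm_bounded[of f x] abs_integral_bp_le[of "\<gamma> j" f] by (simp add: X_def)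
  have XX_le: "\<bar>X j x * X k y\<bar> \<le> (2 * norm f)\<^sup>2" for j x k y
    unfolding abs_mult power2_eq_square by (intro mult_mono X_le) auto
  have intX: "integrable (measure_of_bp (\<gamma> j)) (X j)" for j
  proof -
    interpret prob_space "measure_of_bp (\<gamma> j)" by simp
    show ?thesis unfolding X_def by simp
  qed
  have X0: "(LINT x|measure_of_bp (\<gamma> j). X j x) = 0" for j
  proof -
    interpret prob_space "measure_of_bp (\<gamma> j)" by simp
    show ?thesis unfolding X_def using prob_space by simp
  qed
  have intXX: "integrable (profile_measure P \<gamma>) (\<lambda>\<omega>. X j (\<omega> j) * X k (\<omega> k))"
    if "j \<in> space P" "k \<in> space P" for j k
    using XX_le that
    by (intro \<Omega>.integrable_const_bound[where B = "(2 * norm f)\<^sup>2"] AE_I2 borel_measurable_times measurable_coordinate X_meas) auto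
  have Zsq: "(Z \<omega>)\<^sup>2 = (\<Sum>j\<in>space P. \<Sum>k\<in>space P. measure P {j} * measure P {k} * (X j (\<omega> j) * X k (\<omega> k)))" for \<omega>
    by (simp add: Z_def power2_eq_square sum_product mult_ac)
  have intZ: "integrable (profile_measure P \<gamma>) (\<lambda>\<omega>. (Z \<omega>)\<^sup>2)"
    unfolding Zsq using intXX by (intro Bochner_Integration.integrable_sum integrable_mult_right) auto
  have "(LINT \<omega>|profile_measure P \<gamma>. (Z \<omega>)\<^sup>2) =
      (\<Sum>j\<in>space P. \<Sum>k\<in>space P. measure P {j} * measure P {k} * (LINT \<omega>|profile_measure P \<gamma>. X j (\<omega> j) * X k (\<omega> k)))"
    unfolding Zsq using intXX by (simp add: Bochner_Integration.integral_sum)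
  also have "\<dots> \<le> (\<Sum>j\<in>space P. measure P {j} * (\<delta> * (2 * norm f)\<^sup>2))"
  proof (rule sum_mono)
    fix j assume j: "j \<in> space P"
    have "(\<Sum>k\<in>space P. measure P {j} * measure P {k} * (LINT \<omega>|profile_measure P \<gamma>. X j (\<omega> j) * X k (\<omega> k))) =
        (\<Sum>k\<in>space P. if k = j then measure P {j} * measure P {j} * (LINT \<omega>|profile_measure P \<gamma>. X j (\<omega> j) * X j (\<omega> j)) else 0)"
      using fin j intX X0 by (intro sum.cong refl) (auto simp: integral_coordinate_product)
    also have "\<dots> = measure P {j} * (measure P {j} * (LINT \<omega>|profile_measure P \<gamma>. X j (\<omega> j) * X j (\<omega> j)))"
      using fin j by simp
    also have "\<dots> \<le> measure P {j} * (\<delta> * (2 * norm f)\<^sup>2)"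
    proof (intro mult_left_mono mult_mono m j)
      have "(LINT \<omega>|profile_measure P \<gamma>. X j (\<omega> j) * X j (\<omega> j)) \<le> (LINT \<omega>|profile_measure P \<gamma>. (2 * norm f)\<^sup>2)"
        using XX_le[of j _ j] by (intro integral_mono intXX j) (auto simp: abs_le_iff)
      then show "(LINT \<omega>|profile_measure P \<gamma>. X j (\<omega> j) * X j (\<omega> j)) \<le> (2 * norm f)\<^sup>2"
        using \<Omega>.prob_space by simp
      show "0 \<le> \<delta>" using m[OF j] measure_nonneg[of P "{j}"] by linarith
    qed (auto simp: integral_nonneg_AE)
    finally show "(\<Sum>k\<in>space P. measure P {j} * measure P {k} * (LINT \<omega>|profile_measure P \<gamma>. X j (\<omega> j) * X k (\<omega> k)))
        \<le> measure P {j} * (\<delta> * (2 * norm f)\<^sup>2)" .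
  qed
  also have "\<dots> = \<delta> * (2 * norm f)\<^sup>2"
    by (simp add: sum_distrib_right[symmetric] finite_player_space_sum[OF P])
  finally have var: "(LINT \<omega>|profile_measure P \<gamma>. (Z \<omega>)\<^sup>2) \<le> \<delta> * (2 * norm f)\<^sup>2" .
  have Z: "bp_mean (empirical P \<omega>) f -
      bp_mean (finite_summary P \<gamma>) f = Z \<omega>" for \<omega>
    by (simp add: integral_empirical[OF P] integral_finite_summary[OF P] Z_def X_def right_diff_distrib sum_subtractf)
  have sq: "\<epsilon> \<le> \<bar>z\<bar> \<longleftrightarrow> \<epsilon>\<^sup>2 \<le> z\<^sup>2" for z :: real
    using \<open>\<epsilon> > 0\<close> abs_le_square_iff[of \<epsilon> z] by simp
  have "measure (profile_measure P \<gamma>) {\<omega> \<in> space (profile_measure P \<gamma>). \<epsilon>\<^sup>2 \<le> (Z \<omega>)\<^sup>2}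
      \<le> (LINT \<omega>|profile_measure P \<gamma>. (Z \<omega>)\<^sup>2) / \<epsilon>\<^sup>2"
    using intZ \<open>\<epsilon> > 0\<close> by (intro integral_Markov_inequality_measure[where A = "{}"]) auto
  also have "\<dots> \<le> \<delta> * (2 * norm f)\<^sup>2 / \<epsilon>\<^sup>2" using var by (rule divide_right_mono) simp
  finally show ?thesis unfolding Z sq .
qed

text \<open>Induction along the generation of the weak topology: the miss probability is subadditive
  over intersections and decreases when the neighbourhood grows, which leaves subbasic sets, where a
  single mean has to be controlled.\<close>

lemma empirical_concentration:
  fixes P :: "nat \<Rightarrow> 'j measure" and \<gamma> :: "nat \<Rightarrow> 'j \<Rightarrow> 'a::compact_metric_space borel_prob"
  assumes P: "\<And>n. n > 0 \<Longrightarrow> finite_player_space (P n)"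
    and small: "(\<lambda>n. SUP i\<in>space (P n). measure (P n) {i}) \<longlonglongrightarrow> 0"
    and lim: "(\<lambda>n. finite_summary (P n) (\<gamma> n)) \<longlonglongrightarrow> \<tau>"
    and "open N" "\<tau> \<in> N"
  shows "(\<lambda>n. miss_prob (P n) (\<gamma> n) N) \<longlonglongrightarrow> 0"
    (is "?L N")
proof -
  define E where "E n N = {\<omega> \<in> space (profile_measure (P n) (\<gamma> n)). empirical (P n) \<omega> \<notin> N}" for n N
  define m where "m n N = measure (profile_measure (P n) (\<gamma> n)) (E n N)" for n N
  have sets: "E n N \<in> sets (profile_measure (P n) (\<gamma> n))" if "n > 0" "open N" for n N
  proof -
    have "empirical (P n) -` (- N) \<inter> space (profile_measure (P n) (\<gamma> n)) \<in> sets (profile_measure (P n) (\<gamma> n))"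
      using that by (intro measurable_sets[OF measurable_empirical[OF P]]) auto
    then show ?thesis unfolding E_def by (simp add: vimage_def Int_def conj_commute)
  qed
  have m0: "0 \<le> m n N" for n N by (simp add: m_def)
  have m_mono: "m n N \<le> m n N'" if "n > 0" "open N'" "N' \<subseteq> N" for n N N'
  proof -
    interpret prob_space "profile_measure (P n) (\<gamma> n)" by (rule prob_space_profile_measure)
    show ?thesis unfolding m_def using sets that by (intro finite_measure_mono) (auto simp: E_def)
  qed
  have to0: "(\<lambda>n. m n N) \<longlonglongrightarrow> 0" if b: "b \<longlonglongrightarrow> 0" and le: "\<And>n. n > 0 \<Longrightarrow> m n N \<le> b n" for b N
  proof (rule tendsto_sandwich[OF _ _ tendsto_const b])
    show "\<forall>\<^sub>F n in sequentially. m n N \<le> b n"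
      using eventually_gt_at_top[of 0] by eventually_elim (rule le)
  qed (simp add: m0)
  have "generate_topology {{\<mu>. bp_mean \<mu> f \<in> U} |(f :: 'a \<Rightarrow>\<^sub>C real) U. open U} N"
    using \<open>open N\<close> by (simp add: open_borel_prob_def)
  then have "(\<lambda>n. m n N) \<longlonglongrightarrow> 0" using \<open>\<tau> \<in> N\<close>
  proof induction
    case UNIV
    then show ?case by (simp add: m_def E_def)
  next
    case (Int N N')
    then have op: "open N" "open N'" by (simp_all add: open_borel_prob_def)
    have "(\<lambda>n. m n N + m n N') \<longlonglongrightarrow> 0" using Int tendsto_add[of "\<lambda>n. m n N" 0 sequentially "\<lambda>n. m n N'" 0] by simp
    moreover have "m n (N \<inter> N') \<le> m n N + m n N'" if "n > 0" for n
    proof -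
      interpret prob_space "profile_measure (P n) (\<gamma> n)" by (rule prob_space_profile_measure)
      have "E n (N \<inter> N') = E n N \<union> E n N'" by (auto simp: E_def)
      then show ?thesis unfolding m_def using sets[OF that] op by (simp add: measure_Un_le)
    qed
    ultimately show ?case
      by (rule to0)
  next
    case (UN K)
    then obtain N where N: "N \<in> K" "\<tau> \<in> N" by blast
    with UN have lim: "(\<lambda>n. m n N) \<longlonglongrightarrow> 0" and op: "open N" by (auto simp: open_borel_prob_def)
    have "m n (\<Union>K) \<le> m n N" if "n > 0" for n using m_mono[OF that op] N by blast
    with lim show ?case by (rule to0)
  next
    case (Basis N)
    then obtain f :: "'a \<Rightarrow>\<^sub>C real" and U where U: "open U"
      and N: "N = {\<mu>. bp_mean \<mu> f \<in> U}" by blast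
    define I where "I \<mu> = bp_mean \<mu> f" for \<mu>
    have "I \<tau> \<in> U" using Basis N by (simp add: I_def)
    with U obtain \<epsilon> where \<epsilon>: "\<epsilon> > 0" "ball (I \<tau>) \<epsilon> \<subseteq> U" by (meson open_contains_ball)
    define \<delta> where "\<delta> n = (SUP i\<in>space (P n). measure (P n) {i})" for n
    have "(\<lambda>n. I (finite_summary (P n) (\<gamma> n))) \<longlonglongrightarrow> I \<tau>"
      using lim unfolding tendsto_borel_prob_iff I_def by blast
    then have "\<forall>\<^sub>F n in sequentially. \<bar>I (finite_summary (P n) (\<gamma> n)) - I \<tau>\<bar> < \<epsilon> / 2"
      using \<epsilon> by (auto simp: tendsto_iff dist_real_def dest: spec[of _ "\<epsilon> / 2"])
    then have "\<forall>\<^sub>F n in sequentially. m n N \<le> \<delta> n * (2 * norm f)\<^sup>2 / (\<epsilon> / 2)\<^sup>2"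
      using eventually_gt_at_top[of 0]
    proof eventually_elim
      case (elim n)
      interpret prob_space "profile_measure (P n) (\<gamma> n)" by (rule prob_space_profile_measure)
      have Pn: "finite_player_space (P n)" using P elim by simp
      \<comment> \<open>One half of \<open>\<epsilon>\<close> absorbs the distance of the mean under
        the finite summary from its limit, the other half is left to the random fluctuation.\<close>
      let ?D = "{\<omega> \<in> space (profile_measure (P n) (\<gamma> n)). \<epsilon> / 2 \<le> \<bar>I (empirical (P n) \<omega>) - I (finite_summary (P n) (\<gamma> n))\<bar>}"
      have [measurable]: "(\<lambda>\<omega>. I (empirical (P n) \<omega>)) \<in> borel_measurable (profile_measure (P n) (\<gamma> n))"
        unfolding I_def by (rule measurable_integral_bp[OF measurable_empirical[OF Pn]])
      have D: "?D \<in> sets (profile_measure (P n) (\<gamma> n))" by measurable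
      have "E n N \<subseteq> ?D"
      proof
        fix \<omega> assume "\<omega> \<in> E n N"
        then have "\<omega> \<in> space (profile_measure (P n) (\<gamma> n))" "I (empirical (P n) \<omega>) \<notin> U"
          by (auto simp: E_def N I_def)
        moreover from this have "\<epsilon> \<le> \<bar>I (empirical (P n) \<omega>) - I \<tau>\<bar>"
          using \<epsilon>(2) by (auto simp: subset_iff dist_real_def abs_minus_commute not_less[symmetric])
        moreover from this have "\<epsilon> / 2 \<le> \<bar>I (empirical (P n) \<omega>) - I (finite_summary (P n) (\<gamma> n))\<bar>"
          using elim(1) by linarith
        ultimately show "\<omega> \<in> ?D" by blast
      qed
      then have "m n N \<le> prob ?D" unfolding m_def using D by (rule finite_measure_mono)
      also have "\<dots> \<le> \<delta> n * (2 * norm f)\<^sup>2 / (\<epsilon> / 2)\<^sup>2"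
        unfolding I_def
      proof (rule empirical_deviation[OF Pn])
        show "measure (P n) {j} \<le> \<delta> n" if "j \<in> space (P n)" for j
          unfolding \<delta>_def using Pn that
          by (intro cSUP_upper bdd_above_finite) (auto simp: finite_player_space_def)
      qed (use \<epsilon> in simp)
      finally show "m n N \<le> \<delta> n * (2 * norm f)\<^sup>2 / (\<epsilon> / 2)\<^sup>2" .
    qed
    moreover have "(\<lambda>n. \<delta> n * (2 * norm f)\<^sup>2 / (\<epsilon> / 2)\<^sup>2) \<longlonglongrightarrow> 0 * (2 * norm f)\<^sup>2 / (\<epsilon> / 2)\<^sup>2"
      using small \<epsilon> unfolding \<delta>_def by (intro tendsto_intros) auto
    then have "(\<lambda>n. \<delta> n * (2 * norm f)\<^sup>2 / (\<epsilon> / 2)\<^sup>2) \<longlonglongrightarrow> 0" by simp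
    ultimately show ?case
      by (rule tendsto_sandwich[OF always_eventually _ tendsto_const, rotated]) (simp add: m0)
  qed
  then show ?thesis unfolding m_def E_def .
qed

text \<open>A single player carries at most the largest weight, so a change of strategy moves every
  mean by at most this weight times \<open>2 * norm f\<close>. Deviator and deviation may vary with
  \<open>n\<close>, which is what uniformity over deviations will need.\<close>

lemma finite_summary_update_tendsto:
  fixes P :: "nat \<Rightarrow> 'j measure" and \<gamma> :: "nat \<Rightarrow> 'j \<Rightarrow> 'a::metric_space borel_prob"
  assumes P: "\<And>n. n > 0 \<Longrightarrow> finite_player_space (P n)"
    and small: "(\<lambda>n. SUP i\<in>space (P n). measure (P n) {i}) \<longlonglongrightarrow> 0"
    and lim: "(\<lambda>n. finite_summary (P n) (\<gamma> n)) \<longlonglongrightarrow> \<tau>"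
    and i: "\<And>n. n > 0 \<Longrightarrow> i n \<in> space (P n)"
  shows "(\<lambda>n. finite_summary (P n) ((\<gamma> n)(i n := \<mu> n))) \<longlonglongrightarrow> \<tau>"
  unfolding tendsto_borel_prob_iff
proof
  fix f :: "'a \<Rightarrow>\<^sub>C real"
  define I where "I \<mu> = bp_mean \<mu> f" for \<mu>
  define \<delta> where "\<delta> n = (SUP i\<in>space (P n). measure (P n) {i})" for n
  have le: "\<bar>I (finite_summary (P n) ((\<gamma> n)(i n := \<mu> n))) - I (finite_summary (P n) (\<gamma> n))\<bar> \<le> \<delta> n * (2 * norm f)"
    if "n > 0" for n
  proof -
    have Pn: "finite_player_space (P n)" using P that by simp
    have fin: "finite (space (P n))" using Pn by (simp add: finite_player_space_def)
    have "I (finite_summary (P n) ((\<gamma> n)(i n := \<mu> n))) - I (finite_summary (P n) (\<gamma> n)) =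
        (\<Sum>j\<in>space (P n). if j = i n then measure (P n) {i n} * (I (\<mu> n) - I (\<gamma> n (i n))) else 0)"
      unfolding I_def integral_finite_summary[OF Pn] sum_subtractf[symmetric]
      by (intro sum.cong) (auto simp: right_diff_distrib)
    also have "\<dots> = measure (P n) {i n} * (I (\<mu> n) - I (\<gamma> n (i n)))"
      using fin i[OF that] by simp
    also have "\<bar>\<dots>\<bar> \<le> \<delta> n * (2 * norm f)"
      unfolding abs_mult
    proof (intro mult_mono)
      have "measure (P n) {i n} \<le> \<delta> n"
        unfolding \<delta>_def using fin i[OF that] by (intro cSUP_upper bdd_above_finite) auto
      then show "\<bar>measure (P n) {i n}\<bar> \<le> \<delta> n" "0 \<le> \<delta> n"
        using measure_nonneg[of "P n" "{i n}"] by linarith+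
      show "\<bar>I (\<mu> n) - I (\<gamma> n (i n))\<bar> \<le> 2 * norm f"
        using abs_integral_bp_le[of "\<mu> n" f] abs_integral_bp_le[of "\<gamma> n (i n)" f] unfolding I_def by linarith
    qed simp
    finally show ?thesis .
  qed
  have "\<forall>\<^sub>F n in sequentially. norm (I (finite_summary (P n) ((\<gamma> n)(i n := \<mu> n))) -
      I (finite_summary (P n) (\<gamma> n))) \<le> \<delta> n * (2 * norm f)"
    using eventually_gt_at_top[of 0] by eventually_elim (use le in simp)
  moreover have "(\<lambda>n. \<delta> n * (2 * norm f)) \<longlonglongrightarrow> 0"
    using tendsto_mult_left_zero[OF small] unfolding \<delta>_def .
  ultimately have "(\<lambda>n. I (finite_summary (P n) ((\<gamma> n)(i n := \<mu> n))) - I (finite_summary (P n) (\<gamma> n))) \<longlonglongrightarrow> 0"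
    by (rule Lim_null_comparison)
  moreover have "(\<lambda>n. I (finite_summary (P n) (\<gamma> n))) \<longlonglongrightarrow> I \<tau>"
    using lim unfolding tendsto_borel_prob_iff I_def by blast
  ultimately show "(\<lambda>n. bp_mean (finite_summary (P n) ((\<gamma> n)(i n := \<mu> n))) f)
      \<longlonglongrightarrow> bp_mean \<tau> f"
    unfolding I_def by (rule Lim_transform[rotated])
qed

text \<open>Uniformity comes from a choice: for each \<open>n\<close> pick a deviator and a
  deviation that violate the bound whenever some do. Concentration along the sequence of these picks
  shows that from some \<open>n\<close> on there is no violation.\<close>

lemma deviation_concentration:
  fixes P :: "nat \<Rightarrow> 'j measure" and \<gamma> :: "nat \<Rightarrow> 'j \<Rightarrow> 'a::compact_metric_space borel_prob"
  assumes P: "\<And>n. n > 0 \<Longrightarrow> finite_player_space (P n)"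
    and small: "(\<lambda>n. SUP i\<in>space (P n). measure (P n) {i}) \<longlonglongrightarrow> 0"
    and lim: "(\<lambda>n. finite_summary (P n) (\<gamma> n)) \<longlonglongrightarrow> \<tau>"
    and N: "open N" "\<tau> \<in> N" and "\<epsilon> > 0"
  shows "\<forall>\<^sub>F n in sequentially. \<forall>i\<in>space (P n). \<forall>\<mu>.
    miss_prob (P n) ((\<gamma> n)(i := \<mu>)) N \<le> \<epsilon>"
proof -
  define r where "r n i \<mu> = miss_prob (P n) ((\<gamma> n)(i := \<mu>)) N" for n i \<mu>
  have "\<exists>i \<mu>. i \<in> space (P n) \<and> ((\<exists>i\<in>space (P n). \<exists>\<mu>. \<epsilon> < r n i \<mu>) \<longrightarrow> \<epsilon> < r n i \<mu>)" if "n > 0" for n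
  proof -
    have "space (P n) \<noteq> {}"
      using P[OF that] by (auto simp: finite_player_space_def dest: prob_space.not_empty)
    then show ?thesis by blast
  qed
  then obtain i \<mu> where i: "\<And>n. n > 0 \<Longrightarrow> i n \<in> space (P n)"
    and worst: "\<And>n. n > 0 \<Longrightarrow> (\<exists>i\<in>space (P n). \<exists>\<mu>. \<epsilon> < r n i \<mu>) \<Longrightarrow> \<epsilon> < r n (i n) (\<mu> n)"
    by metis
  have "(\<lambda>n. r n (i n) (\<mu> n)) \<longlonglongrightarrow> 0"
    unfolding r_def by (intro empirical_concentration[OF P small _ N] finite_summary_update_tendsto[OF P small lim i])
  then have "\<forall>\<^sub>F n in sequentially. r n (i n) (\<mu> n) < \<epsilon>"
    using \<open>\<epsilon> > 0\<close> by (rule order_tendstoD)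
  then have "\<forall>\<^sub>F n in sequentially. \<forall>i\<in>space (P n). \<forall>\<mu>. r n i \<mu> \<le> \<epsilon>"
    using eventually_gt_at_top[of 0]
    by eventually_elim (use worst in \<open>meson not_le order.asym\<close>)
  then show ?thesis unfolding r_def .
qed

section \<open>Expected payoffs compared with payoffs at the limit summary\<close>

lemma AE_probs_on:
  assumes "\<mu> \<in> probs_on K"
  shows "AE a in measure_of_bp \<mu>. a \<in> K"
proof -
  interpret prob_space "measure_of_bp \<mu>" by simp
  show ?thesis using assms by (intro AE_prob_1) (simp add: probs_on_def)
qed

lemma actions_borel [measurable]: "set_of_compacts K \<in> sets borel"
  by (intro borel_closed compact_imp_closed) simp

lemma dirac_probs_on: "a \<in> set_of_compacts K \<Longrightarrow> dirac a \<in> probs_on (set_of_compacts K)"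
  by (simp add: probs_on_def measure_of_bp_dirac measure_return)

lemma continuous_on_payoff_slice: "continuous_on UNIV (\<lambda>a. apply_bcontfun u (a, \<tau>))"
  by (rule continuous_on_compose2[OF continuous_on_apply_bcontfun[of UNIV u]]) (auto intro: continuous_intros)

lemma integrable_payoff_slice:
  fixes u :: "('a::metric_space \<times> 'a borel_prob) \<Rightarrow>\<^sub>C real"
  shows "integrable (measure_of_bp \<mu>) (\<lambda>a. apply_bcontfun u (a, \<tau>))"
proof -
  interpret prob_space "measure_of_bp \<mu>" by simp
  have "(\<lambda>a. apply_bcontfun u (a, \<tau>)) \<in> borel_measurable borel"
    by (rule borel_measurable_continuous_onI[OF continuous_on_payoff_slice])
  then show ?thesis using norm_bounded[of u] by (intro integrable_const_bound[where B = "norm u"]) auto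
qed

lemma measurable_payoff_empirical:
  fixes \<gamma> :: "'j \<Rightarrow> 'a::compact_metric_space borel_prob"
  assumes P: "finite_player_space P" and i: "i \<in> space P"
  shows "(\<lambda>\<omega>. apply_bcontfun u (\<omega> i, empirical P \<omega>)) \<in> borel_measurable (profile_measure P \<gamma>)"
proof (rule measurable_compose[of "\<lambda>\<omega>. (\<omega> i, empirical P \<omega>)" _ borel])
  show "(\<lambda>\<omega>. (\<omega> i, empirical P \<omega>)) \<in> borel_measurable (profile_measure P \<gamma>)"
    using measurable_coordinate[OF i, of "\<lambda>x. x"] measurable_empirical[OF P]
    by (intro borel_measurable_Pair) auto
qed (rule borel_measurable_continuous_onI, simp)

text \<open>Almost every action profile lies in the product of the action sets, so the restriction
  of the domain of integration disappears.\<close>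

lemma expected_payoff_eq:
  fixes \<gamma> :: "'j \<Rightarrow> 'a::compact_metric_space borel_prob"
  assumes P: "finite_player_space P" and i: "i \<in> space P"
    and \<gamma>: "\<And>j. j \<in> space P \<Longrightarrow> \<gamma> j \<in> probs_on (actions (G j))"
  shows "expected_payoff P G i \<gamma> = (LINT \<omega>|profile_measure P \<gamma>. payoff (G i) (\<omega> i, empirical P \<omega>))"
  unfolding expected_payoff_def set_lebesgue_integral_def
proof (rule integral_cong_AE)
  have fin: "finite (space P)" using P by (simp add: finite_player_space_def)
  have S: "(\<Pi>\<^sub>E j\<in>space P. actions (G j)) \<in> sets (profile_measure P \<gamma>)"
    using fin by (intro sets_PiM_I_finite) auto
  show "(\<lambda>\<omega>. payoff (G i) (\<omega> i, empirical P \<omega>)) \<in> borel_measurable (profile_measure P \<gamma>)"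
    using P i by (rule measurable_payoff_empirical)
  then show "(\<lambda>\<omega>. indicator (\<Pi>\<^sub>E j\<in>space P. actions (G j)) \<omega> *\<^sub>R payoff (G i) (\<omega> i, empirical P \<omega>))
      \<in> borel_measurable (profile_measure P \<gamma>)"
    using S by (intro borel_measurable_scaleR borel_measurable_indicator)
  have "AE \<omega> in profile_measure P \<gamma>. \<forall>j\<in>space P. \<omega> j \<in> actions (G j)"
    using fin by (intro AE_finite_allI AE_PiM_component AE_probs_on \<gamma>) auto
  then show "AE \<omega> in profile_measure P \<gamma>.
      indicator (\<Pi>\<^sub>E j\<in>space P. actions (G j)) \<omega> *\<^sub>R payoff (G i) (\<omega> i, empirical P \<omega>) =
      payoff (G i) (\<omega> i, empirical P \<omega>)"
    using AE_space by eventually_elim (auto simp: space_PiM PiE_iff)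
qed

text \<open>While the empirical distribution stays in \<open>N\<close>, replacing it by
  \<open>\<tau>\<close> costs at most \<open>\<eta>\<close>; otherwise the trivial bound of twice
  the norm is paid, with the miss probability.\<close>

lemma expected_payoff_approx:
  fixes \<gamma> :: "'j \<Rightarrow> 'a::compact_metric_space borel_prob"
  assumes P: "finite_player_space P" and i: "i \<in> space P"
    and \<gamma>: "\<And>j. j \<in> space P \<Longrightarrow> \<gamma> j \<in> probs_on (actions (G j))"
    and N: "open N" and osc: "\<And>a \<nu>. \<nu> \<in> N \<Longrightarrow> \<bar>payoff (G i) (a, \<nu>) - payoff (G i) (a, \<tau>)\<bar> \<le> \<eta>" and "0 \<le> \<eta>"
  shows "\<bar>expected_payoff P G i \<gamma> - (LINT a|measure_of_bp (\<gamma> i). payoff (G i) (a, \<tau>))\<bar> \<le>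
    \<eta> + 2 * norm (snd (G i)) * miss_prob P \<gamma> N"
proof -
  interpret prob_space "profile_measure P \<gamma>" by (rule prob_space_profile_measure)
  let ?E = "{\<omega> \<in> space (profile_measure P \<gamma>). empirical P \<omega> \<notin> N}"
  let ?u = "payoff (G i)" and ?B = "norm (snd (G i))"
  have E: "?E \<in> sets (profile_measure P \<gamma>)"
  proof -
    have "empirical P -` (- N) \<inter> space (profile_measure P \<gamma>) \<in> sets (profile_measure P \<gamma>)"
      using N by (intro measurable_sets[OF measurable_empirical[OF P]]) auto
    then show ?thesis by (simp add: vimage_def Int_def conj_commute)
  qed
  have b: "\<bar>?u p\<bar> \<le> ?B" for p using norm_bounded[of "snd (G i)" p] by simp
  have slice: "(\<lambda>a. ?u (a, \<tau>)) \<in> borel_measurable borel"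
    by (rule borel_measurable_continuous_onI[OF continuous_on_payoff_slice])
  have int1: "integrable (profile_measure P \<gamma>) (\<lambda>\<omega>. ?u (\<omega> i, empirical P \<omega>))"
    using measurable_payoff_empirical[OF P i] b by (intro integrable_const_bound[where B = ?B]) auto
  have int2: "integrable (profile_measure P \<gamma>) (\<lambda>\<omega>. ?u (\<omega> i, \<tau>))"
    using measurable_coordinate[OF i slice] b by (intro integrable_const_bound[where B = ?B]) auto
  have "expected_payoff P G i \<gamma> - (LINT a|measure_of_bp (\<gamma> i). ?u (a, \<tau>)) =
      (LINT \<omega>|profile_measure P \<gamma>. ?u (\<omega> i, empirical P \<omega>) - ?u (\<omega> i, \<tau>))"
    using int1 int2 by (simp add: expected_payoff_eq[OF P i \<gamma>] integral_coordinate[OF i slice])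
  also have "\<bar>\<dots>\<bar> \<le> (LINT \<omega>|profile_measure P \<gamma>. \<bar>?u (\<omega> i, empirical P \<omega>) - ?u (\<omega> i, \<tau>)\<bar>)"
    by (rule integral_abs_bound)
  also have "\<dots> \<le> (LINT \<omega>|profile_measure P \<gamma>. \<eta> + 2 * ?B * indicator ?E \<omega>)"
  proof (rule integral_mono)
    show "integrable (profile_measure P \<gamma>) (\<lambda>\<omega>. \<eta> + 2 * ?B * indicator ?E \<omega>)"
      using E emeasure_finite by (auto simp: less_top[symmetric])
    fix \<omega> assume "\<omega> \<in> space (profile_measure P \<gamma>)"
    then show "\<bar>?u (\<omega> i, empirical P \<omega>) - ?u (\<omega> i, \<tau>)\<bar> \<le> \<eta> + 2 * ?B * indicator ?E \<omega>"
      using osc[of "empirical P \<omega>" "\<omega> i"] b[of "(\<omega> i, empirical P \<omega>)"] b[of "(\<omega> i, \<tau>)"] \<open>0 \<le> \<eta>\<close>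
      by (cases "empirical P \<omega> \<in> N") auto
  qed (use int1 int2 in auto)
  also have "\<dots> = \<eta> + 2 * ?B * prob ?E"
    using E emeasure_finite prob_space by (auto simp: less_top[symmetric])
  finally show ?thesis .
qed

text \<open>The equilibrium inequality against the pure deviation to \<open>b\<close> involves
  random empirical distributions; replacing them by \<open>\<tau>\<close> costs
  \<open>\<eta> + 2 * norm (snd (G i)) * r\<close> on each side. The equilibrium profile itself is
  covered as the trivial deviation to \<open>g i\<close>.\<close>

lemma finite_nash_regret:
  fixes g :: "'j \<Rightarrow> 'a::compact_metric_space borel_prob"
  assumes P: "finite_player_space P" and nash: "finite_nash P G g" and i: "i \<in> space P"
    and b: "b \<in> actions (G i)"
    and N: "open N" and osc: "\<And>a \<nu>. \<nu> \<in> N \<Longrightarrow> \<bar>payoff (G i) (a, \<nu>) - payoff (G i) (a, \<tau>)\<bar> \<le> \<eta>" and "0 \<le> \<eta>"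
    and r: "\<And>\<mu>. miss_prob P (g(i := \<mu>)) N \<le> r"
  shows "payoff (G i) (b, \<tau>) - (LINT a|measure_of_bp (g i). payoff (G i) (a, \<tau>)) \<le>
    2 * \<eta> + 4 * r * norm (snd (G i))"
proof -
  have prof: "g j \<in> probs_on (actions (G j))" if "j \<in> space P" for j
    using nash that by (auto simp: finite_nash_def finite_profile_def)
  have dir: "dirac b \<in> probs_on (actions (G i))" using b by (rule dirac_probs_on)
  have "expected_payoff P G i (g(i := dirac b)) \<le> expected_payoff P G i g"
    using nash i dir by (auto simp: finite_nash_def)
  moreover have approx: "\<bar>expected_payoff P G i (g(i := \<mu>)) - (LINT a|measure_of_bp \<mu>. payoff (G i) (a, \<tau>))\<bar> \<le>
      \<eta> + 2 * norm (snd (G i)) * r" if "\<mu> \<in> probs_on (actions (G i))" for \<mu>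
  proof -
    have "\<bar>expected_payoff P G i (g(i := \<mu>)) - (LINT a|measure_of_bp ((g(i := \<mu>)) i). payoff (G i) (a, \<tau>))\<bar> \<le>
      \<eta> + 2 * norm (snd (G i)) * miss_prob P (g(i := \<mu>)) N"
    proof (rule expected_payoff_approx[OF P i])
      show "(g(i := \<mu>)) j \<in> probs_on (actions (G j))" if "j \<in> space P" for j
        using prof[OF that] \<open>\<mu> \<in> probs_on (actions (G i))\<close> by simp
    qed (fact N osc \<open>0 \<le> \<eta>\<close>)+
    also have "\<dots> \<le> \<eta> + 2 * norm (snd (G i)) * r"
      using r by (intro add_left_mono mult_left_mono) auto
    finally show ?thesis by simp
  qed
  moreover have "(LINT a|measure_of_bp (dirac b). payoff (G i) (a, \<tau>)) = payoff (G i) (b, \<tau>)"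
    unfolding measure_of_bp_dirac
    by (intro integral_return borel_measurable_continuous_onI continuous_on_payoff_slice) simp
  ultimately show ?thesis
    using approx[OF dir] approx[OF prof[OF i]] by (simp add: algebra_simps)
qed

section \<open>Regret\<close>

text \<open>The supremum over actions and over \<open>N\<close> makes the drift of a payoff from its
  value at \<open>\<tau>\<close> a Lipschitz function of the payoff, hence usable in test functions
  on the space of games. This stands in for a modulus of continuity common to all players.\<close>

definition oscillation ::
    "'a::metric_space borel_prob \<Rightarrow> 'a borel_prob set \<Rightarrow> (('a \<times> 'a borel_prob) \<Rightarrow>\<^sub>C real) \<Rightarrow> real" where
  "oscillation \<tau> N u = (SUP p\<in>UNIV \<times> N. \<bar>apply_bcontfun u p - apply_bcontfun u (fst p, \<tau>)\<bar>)"

lemma oscillation_bdd_above: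
  fixes u :: "('a::metric_space \<times> 'a borel_prob) \<Rightarrow>\<^sub>C real"
  shows "bdd_above ((\<lambda>p. \<bar>apply_bcontfun u p - apply_bcontfun u (fst p, \<tau>)\<bar>) ` (UNIV \<times> N))"
proof (rule bdd_aboveI2)
  fix p
  show "\<bar>apply_bcontfun u p - apply_bcontfun u (fst p, \<tau>)\<bar> \<le> 2 * norm u"
    using norm_bounded[of u p] norm_bounded[of u "(fst p, \<tau>)"] by simp
qed

lemma oscillation_upper: "\<nu> \<in> N \<Longrightarrow> \<bar>apply_bcontfun u (a, \<nu>) - apply_bcontfun u (a, \<tau>)\<bar> \<le> oscillation \<tau> N u"
  unfolding oscillation_def
  using cSUP_upper[OF _ oscillation_bdd_above, of "(a, \<nu>)" N u \<tau>] by simp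

lemma oscillation_nonneg: "\<tau> \<in> N \<Longrightarrow> 0 \<le> oscillation \<tau> N u"
  using oscillation_upper[of \<tau> N u undefined \<tau>] by simp

lemma oscillation_least:
  assumes "N \<noteq> {}" "\<And>a \<nu>. \<nu> \<in> N \<Longrightarrow> \<bar>apply_bcontfun u (a, \<nu>) - apply_bcontfun u (a, \<tau>)\<bar> \<le> c"
  shows "oscillation \<tau> N u \<le> c"
  unfolding oscillation_def using assms by (intro cSUP_least) auto

lemma oscillation_lipschitz:
  assumes "N \<noteq> {}"
  shows "\<bar>oscillation \<tau> N u - oscillation \<tau> N v\<bar> \<le> 2 * dist u v"
proof -
  have "oscillation \<tau> N u \<le> oscillation \<tau> N v + 2 * dist u v" for u v :: "('a \<times> 'a borel_prob) \<Rightarrow>\<^sub>C real"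
  proof (rule oscillation_least[OF assms])
    fix a \<nu> assume "\<nu> \<in> N"
    then have "\<bar>apply_bcontfun v (a, \<nu>) - apply_bcontfun v (a, \<tau>)\<bar> \<le> oscillation \<tau> N v"
      by (rule oscillation_upper)
    moreover have "\<bar>apply_bcontfun u p - apply_bcontfun v p\<bar> \<le> dist u v" for p
      using dist_bounded[of u p v] by (simp add: dist_real_def)
    from this[of "(a, \<nu>)"] this[of "(a, \<tau>)"]
    have "\<bar>apply_bcontfun u (a, \<nu>) - apply_bcontfun v (a, \<nu>)\<bar> \<le> dist u v"
      "\<bar>apply_bcontfun u (a, \<tau>) - apply_bcontfun v (a, \<tau>)\<bar> \<le> dist u v" .
    ultimately show "\<bar>apply_bcontfun u (a, \<nu>) - apply_bcontfun u (a, \<tau>)\<bar> \<le> oscillation \<tau> N v + 2 * dist u v"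
      by linarith
  qed
  from this[of u v] this[of v u] show ?thesis by (simp add: dist_commute abs_le_iff)
qed

lemma continuous_on_oscillation:
  assumes "N \<noteq> {}" "continuous_on UNIV f"
  shows "continuous_on UNIV (\<lambda>x. oscillation \<tau> N (f x))"
proof -
  have "continuous_on UNIV (oscillation \<tau> N)"
  proof (rule continuous_onI)
    fix u :: "('a \<times> 'a borel_prob) \<Rightarrow>\<^sub>C real" and e :: real assume "e > 0"
    show "\<exists>d>0. \<forall>v\<in>UNIV. dist v u < d \<longrightarrow> dist (oscillation \<tau> N v) (oscillation \<tau> N u) \<le> e"
    proof (intro exI[of _ "e / 2"] conjI ballI impI)
      fix v assume "dist v u < e / 2"
      then show "dist (oscillation \<tau> N v) (oscillation \<tau> N u) \<le> e"
        using oscillation_lipschitz[OF assms(1), of \<tau> v u] by (simp add: dist_real_def)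
    qed (use \<open>e > 0\<close> in simp)
  qed
  then show ?thesis using continuous_on_compose2[OF _ assms(2)] by blast
qed

text \<open>A tube argument: compactness of the action space yields a neighbourhood of
  \<open>\<tau>\<close> that works for all actions at once. The coordinates are swapped to put the
  compact factor second.\<close>

lemma oscillation_small:
  fixes u :: "('a::compact_metric_space \<times> 'a borel_prob) \<Rightarrow>\<^sub>C real"
  assumes "\<epsilon> > 0"
  obtains X where "open X" "\<tau> \<in> X" "\<And>N. N \<subseteq> X \<Longrightarrow> N \<noteq> {} \<Longrightarrow> oscillation \<tau> N u \<le> \<epsilon>"
proof -
  define F where "F = (\<lambda>(\<nu>, a). apply_bcontfun u (a, \<nu>))"
  have "continuous_on (UNIV \<times> UNIV) F"
    unfolding F_def split_beta
    by (rule continuous_on_compose2[OF continuous_on_apply_bcontfun[of UNIV u]]) (auto intro!: continuous_intros)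
  then obtain X where X: "\<tau> \<in> X" "open X"
    "\<forall>\<nu>\<in>X \<inter> UNIV. \<forall>a\<in>UNIV. dist (F (\<nu>, a)) (F (\<tau>, a)) \<le> \<epsilon>"
    by (rule continuous_on_prod_compactE[OF _ compact_UNIV_metric UNIV_I \<open>\<epsilon> > 0\<close>])
  show thesis
  proof (rule that[OF X(2,1)])
    show "oscillation \<tau> N u \<le> \<epsilon>" if "N \<subseteq> X" "N \<noteq> {}" for N
      using X(3) that by (intro oscillation_least) (auto simp: F_def dist_real_def subset_iff)
  qed
qed

section \<open>Best payoffs and regret as functions of the characteristic\<close>

definition best_payoff :: "'a::metric_space borel_prob \<Rightarrow> 'a characteristic \<Rightarrow> real" where
  "best_payoff \<tau> c = (SUP a\<in>actions c. payoff c (a, \<tau>))"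

lemma best_payoff_attained:
  obtains b where "b \<in> actions c" "payoff c (b, \<tau>) = best_payoff \<tau> c"
proof -
  have "continuous_on (actions c) (\<lambda>a. payoff c (a, \<tau>))"
    by (rule continuous_on_compose2[OF continuous_on_apply_bcontfun[of UNIV "snd c"]]) (auto intro!: continuous_intros)
  then obtain b where b: "b \<in> actions c" "\<And>a. a \<in> actions c \<Longrightarrow> payoff c (a, \<tau>) \<le> payoff c (b, \<tau>)"
    using continuous_attains_sup[of "actions c" "\<lambda>a. payoff c (a, \<tau>)"] by auto
  then have "best_payoff \<tau> c = payoff c (b, \<tau>)"
    unfolding best_payoff_def by (intro cSup_eq_maximum) auto
  with b that show thesis by metis
qed

lemma best_payoff_upper: "a \<in> actions c \<Longrightarrow> payoff c (a, \<tau>) \<le> best_payoff \<tau> c"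
  unfolding best_payoff_def
proof (rule cSUP_upper)
  show "bdd_above ((\<lambda>a. payoff c (a, \<tau>)) ` actions c)"
    using norm_bounded[of "snd c"] by (intro bdd_aboveI2[where M = "norm (snd c)"]) (auto simp: abs_le_iff)
qed

lemma compacts_infdist_le:
  fixes K L :: "'a::metric_space compacts"
  assumes "a \<in> set_of_compacts K"
  shows "infdist a (set_of_compacts L) \<le> dist K L"
  using hausdorff_dist_le_iff[of "set_of_compacts K" "set_of_compacts L" "dist K L"] assms
  by (simp add: dist_compacts_def)

lemma compacts_near:
  fixes K L :: "'a::metric_space compacts"
  assumes "a \<in> set_of_compacts K" "dist K L < \<delta>"
  shows "\<exists>b\<in>set_of_compacts L. dist a b < \<delta>"
proof -
  have "infdist a (set_of_compacts L) < \<delta>" using compacts_infdist_le[OF assms(1)] assms(2) by (rule le_less_trans)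
  then show ?thesis by (simp add: infdist_notempty cINF_less_iff)
qed

lemma infdist_compacts_lipschitz:
  fixes K L :: "'a::metric_space compacts"
  shows "\<bar>infdist a (set_of_compacts K) - infdist a (set_of_compacts L)\<bar> \<le> dist K L"
proof -
  have "infdist a (set_of_compacts K) - dist K L \<le> infdist a (set_of_compacts L)" for K L :: "'a compacts"
    unfolding infdist_notempty[OF set_of_compacts_nonempty[of L]]
  proof (rule cINF_greatest)
    fix b assume "b \<in> set_of_compacts L"
    then have "infdist b (set_of_compacts K) \<le> dist L K" by (rule compacts_infdist_le)
    then show "infdist a (set_of_compacts K) - dist K L \<le> dist a b"
      using infdist_triangle[of a "set_of_compacts K" b] by (simp add: dist_commute)
  qed simp
  from this[of K L] this[of L K] show ?thesis by (simp add: dist_commute abs_le_iff)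
qed

text \<open>A case of Berge's maximum theorem. A maximiser of either game has a feasible action of
  the other game within \<open>\<delta>\<close>, by Hausdorff closeness; moving to it costs
  \<open>e / 2\<close> by uniform continuity of the payoff of \<open>c\<close>, and exchanging the
  payoffs costs another \<open>e / 2\<close>.\<close>

lemma continuous_on_best_payoff:
  fixes \<tau> :: "'a::compact_metric_space borel_prob"
  shows "continuous_on UNIV (best_payoff \<tau>)"
proof (rule continuous_onI)
  fix c :: "'a characteristic" and e :: real assume "e > 0"
  have "continuous_on UNIV (\<lambda>a. payoff c (a, \<tau>))"
    by (rule continuous_on_compose2[OF continuous_on_apply_bcontfun[of UNIV "snd c"]]) (auto intro!: continuous_intros)
  then have "uniformly_continuous_on UNIV (\<lambda>a. payoff c (a, \<tau>))"
    by (rule compact_uniformly_continuous[OF _ compact_UNIV_metric])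
  then obtain \<delta> where \<delta>: "\<delta> > 0"
    "\<And>a b. dist a b < \<delta> \<Longrightarrow> dist (payoff c (a, \<tau>)) (payoff c (b, \<tau>)) < e / 2"
    unfolding uniformly_continuous_on_def using \<open>e > 0\<close> by (metis UNIV_I half_gt_zero)
  show "\<exists>d>0. \<forall>c'\<in>UNIV. dist c' c < d \<longrightarrow> dist (best_payoff \<tau> c') (best_payoff \<tau> c) \<le> e"
  proof (intro exI[of _ "min \<delta> (e / 2)"] conjI ballI impI)
    fix c' :: "'a characteristic" assume "dist c' c < min \<delta> (e / 2)"
    then have d: "dist (fst c') (fst c) < \<delta>" "dist (snd c') (snd c) < e / 2"
      using dist_fst_le[of c' c] dist_snd_le[of c' c] by auto
    have u: "\<bar>payoff c' p - payoff c p\<bar> < e / 2" for p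
      using dist_bounded[of "snd c'" p "snd c"] d(2) by (simp add: dist_real_def)
    obtain b where b: "b \<in> actions c" "payoff c (b, \<tau>) = best_payoff \<tau> c" by (rule best_payoff_attained)
    obtain b' where b': "b' \<in> actions c'" "payoff c' (b', \<tau>) = best_payoff \<tau> c'" by (rule best_payoff_attained)
    obtain a' where a': "a' \<in> actions c'" "dist b a' < \<delta>"
      using compacts_near[OF b(1), of "fst c'" \<delta>] d(1) by (auto simp: dist_commute)
    obtain a where a: "a \<in> actions c" "dist b' a < \<delta>"
      using compacts_near[OF b'(1), of "fst c" \<delta>] d(1) by auto
    have "payoff c (b, \<tau>) - e / 2 < payoff c (a', \<tau>)" "payoff c (b', \<tau>) - e / 2 < payoff c (a, \<tau>)"
      using \<delta>(2)[OF a'(2)] \<delta>(2)[OF a(2)] unfolding dist_real_def by linarith+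
    moreover have "payoff c (a, \<tau>) \<le> best_payoff \<tau> c" "payoff c' (a', \<tau>) \<le> best_payoff \<tau> c'"
      using a(1) a'(1) by (auto intro: best_payoff_upper)
    moreover note u[of "(b', \<tau>)"] u[of "(a', \<tau>)"]
    ultimately show "dist (best_payoff \<tau> c') (best_payoff \<tau> c) \<le> e"
      using b(2) b'(2) unfolding dist_real_def by linarith
  qed (use \<delta> \<open>e > 0\<close> in simp)
qed

text \<open>The distance term charges infeasible actions, so that vanishing regret means feasible
  and optimal at once, while continuity in the action is kept. The truncation at 0 concerns
  infeasible actions, whose payoff may exceed the best feasible one.\<close>

definition regret :: "'a::metric_space borel_prob \<Rightarrow> 'a characteristic \<Rightarrow> 'a \<Rightarrow> real" where
  "regret \<tau> c a = infdist a (actions c) + max 0 (best_payoff \<tau> c - payoff c (a, \<tau>))"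

text \<open>The infimum removes the action and leaves a function of the characteristic alone, which
  can be tested against the mass of the cell; the cap at 1 makes it an admissible bounded test
  function.\<close>

definition cell_regret :: "'a::metric_space borel_prob \<Rightarrow> 'a set \<Rightarrow> 'a characteristic \<Rightarrow> real" where
  "cell_regret \<tau> B c = min 1 (INF a\<in>B. regret \<tau> c a)"

lemma regret_nonneg: "0 \<le> regret \<tau> c a"
  unfolding regret_def using infdist_nonneg[of a "actions c"] by simp

lemma regret_actions: "a \<in> actions c \<Longrightarrow> regret \<tau> c a = best_payoff \<tau> c - payoff c (a, \<tau>)"
  using best_payoff_upper[of a c \<tau>] by (simp add: regret_def)

lemma regret_eq_0D:
  assumes "regret \<tau> c a = 0"
  shows "a \<in> actions c" "payoff c (a, \<tau>) = best_payoff \<tau> c"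
proof -
  have "infdist a (actions c) = 0" "best_payoff \<tau> c \<le> payoff c (a, \<tau>)"
    using assms infdist_nonneg[of a "actions c"] unfolding regret_def by linarith+
  then show "a \<in> actions c"
    using in_closed_iff_infdist_zero[of "actions c" a] by (simp add: compact_imp_closed)
  then show "payoff c (a, \<tau>) = best_payoff \<tau> c"
    using best_payoff_upper[of a c \<tau>] \<open>best_payoff \<tau> c \<le> payoff c (a, \<tau>)\<close> by simp
qed

lemma continuous_on_regret: "continuous_on UNIV (regret \<tau> c)"
  unfolding regret_def
  by (intro continuous_intros continuous_on_compose2[OF continuous_on_apply_bcontfun[of UNIV "snd c"]]) auto

lemma bdd_below_regret: "bdd_below (regret \<tau> c ` B)"
  using regret_nonneg by (intro bdd_belowI2[where m = 0])

lemma cell_regret_bounds: "B \<noteq> {} \<Longrightarrow> 0 \<le> cell_regret \<tau> B c \<and> cell_regret \<tau> B c \<le> 1"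
  unfolding cell_regret_def by (auto intro!: cINF_greatest regret_nonneg)

lemma cell_regret_le: "a \<in> B \<Longrightarrow> cell_regret \<tau> B c \<le> min 1 (regret \<tau> c a)"
  unfolding cell_regret_def by (intro min.mono order_refl cINF_lower bdd_below_regret)

lemma cell_regret_eq_0D:
  assumes "cell_regret \<tau> B c = 0" "B \<noteq> {}" "\<epsilon> > 0"
  shows "\<exists>a\<in>B. regret \<tau> c a < \<epsilon>"
proof -
  have "(INF a\<in>B. regret \<tau> c a) < \<epsilon>" using assms(1,3) by (simp add: cell_regret_def min_def split: if_splits)
  then show ?thesis using assms(2) by (simp add: cINF_less_iff bdd_below_regret)
qed

text \<open>Passing from \<open>c\<close> to \<open>c'\<close> changes the regret by at most
  \<open>\<rho> c'\<close>, whatever the action, and infima inherit such a bound. It tends to 0 by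
  continuity of \<open>best_payoff\<close> and of the two component distances.\<close>

lemma continuous_on_cell_regret:
  fixes \<tau> :: "'a::compact_metric_space borel_prob"
  assumes B: "B \<noteq> {}"
  shows "continuous_on UNIV (cell_regret \<tau> B)"
  unfolding continuous_on_def
proof
  fix c :: "'a characteristic"
  define \<rho> where "\<rho> c' = dist (fst c') (fst c) + \<bar>best_payoff \<tau> c' - best_payoff \<tau> c\<bar> + dist (snd c') (snd c)" for c'
  have le: "cell_regret \<tau> B c1 \<le> cell_regret \<tau> B c2 + r"
    if r: "0 \<le> r" "\<And>a. regret \<tau> c1 a \<le> regret \<tau> c2 a + r" for c1 c2 r
  proof -
    have "(INF a\<in>B. regret \<tau> c1 a) - r \<le> (INF a\<in>B. regret \<tau> c2 a)"
    proof (rule cINF_greatest[OF B])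
      fix a assume "a \<in> B"
      then have "(INF a\<in>B. regret \<tau> c1 a) \<le> regret \<tau> c1 a" by (rule cINF_lower[OF bdd_below_regret])
      then show "(INF a\<in>B. regret \<tau> c1 a) - r \<le> regret \<tau> c2 a" using r(2)[of a] by linarith
    qed
    then show ?thesis using r(1) unfolding cell_regret_def by (simp add: min_def)
  qed
  have near: "\<bar>regret \<tau> c' a - regret \<tau> c a\<bar> \<le> \<rho> c'" for c' a
    using infdist_compacts_lipschitz[of a "fst c'" "fst c"] dist_bounded[of "snd c'" "(a, \<tau>)" "snd c"]
    unfolding regret_def \<rho>_def dist_real_def by linarith
  have \<rho>0: "0 \<le> \<rho> c'" for c' by (simp add: \<rho>_def)
  have bound: "dist (cell_regret \<tau> B c') (cell_regret \<tau> B c) \<le> \<rho> c'" for c'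
  proof -
    have "cell_regret \<tau> B c' \<le> cell_regret \<tau> B c + \<rho> c'"
      by (rule le[OF \<rho>0]) (use near in \<open>simp add: abs_le_iff algebra_simps\<close>)
    moreover have "cell_regret \<tau> B c \<le> cell_regret \<tau> B c' + \<rho> c'"
      by (rule le[OF \<rho>0]) (use near in \<open>simp add: abs_le_iff algebra_simps\<close>)
    ultimately show ?thesis by (simp add: dist_real_def abs_le_iff)
  qed
  have cont: "(best_payoff \<tau> \<longlongrightarrow> best_payoff \<tau> c) (at c)"
    using continuous_on_best_payoff[of \<tau>] unfolding continuous_on_def by blast
  have "(\<rho> \<longlongrightarrow> dist (fst c) (fst c) + \<bar>best_payoff \<tau> c - best_payoff \<tau> c\<bar> + dist (snd c) (snd c)) (at c)"
    unfolding \<rho>_def by (intro tendsto_intros cont)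
  then have "(\<rho> \<longlongrightarrow> 0) (at c)" by simp
  then have "((\<lambda>c'. dist (cell_regret \<tau> B c') (cell_regret \<tau> B c)) \<longlongrightarrow> 0) (at c)"
    by (rule tendsto_sandwich[OF _ _ tendsto_const, rotated 2]) (auto intro: always_eventually bound)
  then show "(cell_regret \<tau> B \<longlongrightarrow> cell_regret \<tau> B c) (at c)"
    by (rule tendsto_dist_iff[THEN iffD2])
qed

section \<open>Sequences of equilibria\<close>

lemma tendsto_borel_prob_continuous:
  fixes h :: "'x::topological_space \<Rightarrow> real"
  assumes lim: "(X \<longlongrightarrow> \<mu>) F" and h: "continuous_on UNIV h" and h01: "\<And>x. 0 \<le> h x \<and> h x \<le> 1"
  shows "((\<lambda>n. LINT x|measure_of_bp (X n). h x) \<longlongrightarrow> (LINT x|measure_of_bp \<mu>. h x)) F"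
proof -
  have "h \<in> bcontfun" using h h01 by (intro bcontfun_normI[where b = 1]) auto
  then have "apply_bcontfun (Bcontfun h) = h" by (rule Bcontfun_inverse)
  then show ?thesis using lim unfolding tendsto_borel_prob_iff by metis
qed

lemma integral_law_finite:
  fixes h :: "'x::topological_space \<Rightarrow> real"
  assumes P: "finite_player_space P" and h: "h \<in> borel_measurable borel"
  shows "(LINT x|measure_of_bp (law P X). h x) = (\<Sum>i\<in>space P. measure P {i} * h (X i))"
proof -
  have X: "X \<in> borel_measurable P" using P by (auto simp: finite_player_space_def measurable_def)
  have "prob_space P" using P by (simp add: finite_player_space_def)
  then show ?thesis
    using X h by (simp add: measure_of_bp_law integral_distr finite_player_space_integrable(2)[OF P])
qed

lemma integrable_regret:
  fixes \<tau> :: "'a::compact_metric_space borel_prob"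
  shows "integrable (measure_of_bp \<mu>) (regret \<tau> c)"
  using integrable_bcontfun[of \<mu> "Bcontfun (regret \<tau> c)"]
  by (simp add: apply_Bcontfun_continuous continuous_on_regret)

text \<open>A Markov inequality: on \<open>B\<close> the regret is at least
  \<open>cell_regret \<tau> B c\<close>, elsewhere it is nonnegative. The bound by 1 holds because
  both factors on the left are at most 1.\<close>

lemma cell_regret_mass:
  fixes \<tau> :: "'a::compact_metric_space borel_prob"
  assumes B: "B \<in> sets borel" "B \<noteq> {}"
  shows "cell_regret \<tau> B c * measure (measure_of_bp \<mu>) B \<le> min 1 (LINT a|measure_of_bp \<mu>. regret \<tau> c a)"
proof -
  interpret prob_space "measure_of_bp \<mu>" by simp
  have cr: "0 \<le> cell_regret \<tau> B c" "cell_regret \<tau> B c \<le> 1" using cell_regret_bounds[OF B(2), of \<tau> c] by auto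
  have "cell_regret \<tau> B c * measure (measure_of_bp \<mu>) B = (LINT a|measure_of_bp \<mu>. cell_regret \<tau> B c * indicator B a)"
    using B(1) by simp
  also have "\<dots> \<le> (LINT a|measure_of_bp \<mu>. regret \<tau> c a)"
  proof (rule integral_mono[OF _ integrable_regret])
    show "integrable (measure_of_bp \<mu>) (\<lambda>a. cell_regret \<tau> B c * indicator B a)"
      using B(1) emeasure_finite by (auto simp: less_top[symmetric])
    show "cell_regret \<tau> B c * indicator B a \<le> regret \<tau> c a" for a
      using cell_regret_le[of a B \<tau> c] regret_nonneg[of \<tau> c a] by (cases "a \<in> B") auto
  qed
  finally show ?thesis
    using cr by (intro min.boundedI mult_le_one) auto
qed

section \<open>Vanishing mean regret along the sequence of equilibria\<close>

locale game_sequence =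
  fixes Q :: "('a::compact_metric_space) characteristic borel_prob"
    and P :: "nat \<Rightarrow> 'j measure" and Gn :: "nat \<Rightarrow> 'j \<Rightarrow> 'a characteristic"
    and gn :: "nat \<Rightarrow> 'j \<Rightarrow> 'a borel_prob" and \<tau> :: "'a borel_prob"
  assumes P: "\<And>n. n > 0 \<Longrightarrow> finite_player_space (P n)"
    and small: "(\<lambda>n. SUP i\<in>space (P n). measure (P n) {i}) \<longlonglongrightarrow> 0"
    and law: "(\<lambda>n. law (P n) (Gn n)) \<longlonglongrightarrow> Q"
    and nash: "\<And>n. n > 0 \<Longrightarrow> finite_nash (P n) (Gn n) (gn n)"
    and summary: "(\<lambda>n. finite_summary (P n) (gn n)) \<longlonglongrightarrow> \<tau>"
begin

lemma integral_regret:
  assumes "n > 0" "i \<in> space (P n)"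
  shows "(LINT a|measure_of_bp (gn n i). regret \<tau> (Gn n i) a) =
    best_payoff \<tau> (Gn n i) - (LINT a|measure_of_bp (gn n i). payoff (Gn n i) (a, \<tau>))"
proof -
  interpret prob_space "measure_of_bp (gn n i)" by simp
  have slice: "integrable (measure_of_bp (gn n i)) (\<lambda>a. payoff (Gn n i) (a, \<tau>))" by (rule integrable_payoff_slice)
  have "gn n i \<in> probs_on (actions (Gn n i))"
    using nash[OF assms(1)] assms(2) by (simp add: finite_nash_def finite_profile_def)
  then have "(LINT a|measure_of_bp (gn n i). regret \<tau> (Gn n i) a) =
      (LINT a|measure_of_bp (gn n i). best_payoff \<tau> (Gn n i) - payoff (Gn n i) (a, \<tau>))"
    using integrable_regret[of "gn n i" \<tau> "Gn n i"] slice
    by (intro integral_cong_AE) (auto dest!: AE_probs_on elim!: eventually_mono simp: regret_actions)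
  also have "\<dots> = best_payoff \<tau> (Gn n i) - (LINT a|measure_of_bp (gn n i). payoff (Gn n i) (a, \<tau>))"
    using slice prob_space by simp
  finally show ?thesis .
qed

text \<open>The regret bound from the finite games depends on the player through the oscillation and
  the norm of the payoff, with no uniformity over players. It is however continuous in the
  characteristic, and its capped version has an integral against the limit law that tends to 0 as
  the neighbourhoods of \<open>\<tau>\<close> shrink.\<close>

lemma mean_regret_vanishes:
  "(\<lambda>n. \<Sum>i\<in>space (P n). measure (P n) {i} * min 1 (LINT a|measure_of_bp (gn n i). regret \<tau> (Gn n i) a)) \<longlonglongrightarrow> 0"
    (is "?R \<longlonglongrightarrow> 0")
proof -
  obtain A :: "nat \<Rightarrow> 'a borel_prob set" where A: "\<And>m. open (A m)" "\<And>m. \<tau> \<in> A m"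
    "\<And>X. open X \<Longrightarrow> \<tau> \<in> X \<Longrightarrow> eventually (\<lambda>m. A m \<subseteq> X) sequentially"
    by (rule countable_basis_at_decseq[of \<tau>]) blast
  have ne: "A m \<noteq> {}" for m using A(2) by blast
  \<comment> \<open>The bound of \<open>finite_nash_regret\<close> with the oscillation for
    \<open>\<eta>\<close> and \<open>inverse (real (Suc m))\<close> for \<open>r\<close>. The cap at
    1 makes it a test function although the norms of payoffs have no common bound.\<close>
  define \<Psi> where "\<Psi> m c = min 1 (2 * oscillation \<tau> (A m) (snd c) + 4 * inverse (real (Suc m)) * norm (snd c))"
    for m and c :: "'a characteristic"
  have \<Psi>_cont: "continuous_on UNIV (\<Psi> m)" for m
    unfolding \<Psi>_def by (intro continuous_intros continuous_on_oscillation ne)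
  have [measurable]: "\<Psi> m \<in> borel_measurable borel" for m
    using \<Psi>_cont by (rule borel_measurable_continuous_onI)
  have \<Psi>01: "0 \<le> \<Psi> m c \<and> \<Psi> m c \<le> 1" for m c
    using oscillation_nonneg[OF A(2)] by (auto simp: \<Psi>_def)
  have "(\<lambda>m. \<Psi> m c) \<longlonglongrightarrow> 0" for c
  proof -
    have "(\<lambda>m. oscillation \<tau> (A m) (snd c)) \<longlonglongrightarrow> 0"
    proof (rule order_tendstoI)
      fix y :: real assume "0 < y"
      then have "0 < y / 2" by simp
      then obtain X where X: "open X" "\<tau> \<in> X" "\<And>N. N \<subseteq> X \<Longrightarrow> N \<noteq> {} \<Longrightarrow> oscillation \<tau> N (snd c) \<le> y / 2"
        by (rule oscillation_small[where \<tau> = \<tau> and u = "snd c"]) blast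
      from A(3)[OF X(1,2)] show "\<forall>\<^sub>F m in sequentially. oscillation \<tau> (A m) (snd c) < y"
      proof eventually_elim
        case (elim m)
        from X(3)[OF this ne] \<open>0 < y\<close> show ?case by linarith
      qed
    next
      fix y :: real assume "y < 0"
      then show "\<forall>\<^sub>F m in sequentially. y < oscillation \<tau> (A m) (snd c)"
        by (intro always_eventually allI less_le_trans[OF _ oscillation_nonneg[OF A(2)]])
    qed
    then have "(\<lambda>m. \<Psi> m c) \<longlonglongrightarrow> min 1 (2 * 0 + 4 * 0 * norm (snd c))"
      unfolding \<Psi>_def by (intro tendsto_intros LIMSEQ_inverse_real_of_nat)
    then show ?thesis by simp
  qed
  then have "(\<lambda>m. LINT c|measure_of_bp Q. \<Psi> m c) \<longlonglongrightarrow> (LINT c|measure_of_bp Q. 0)"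
    using \<Psi>01 prob_space.finite_measure[OF prob_space_measure_of_bp[of Q]]
    by (intro integral_dominated_convergence[where w = "\<lambda>_. 1"]) (auto intro: finite_measure.integrable_const)
  then have \<Psi>Q: "(\<lambda>m. LINT c|measure_of_bp Q. \<Psi> m c) \<longlonglongrightarrow> 0" by simp
  have R0: "0 \<le> ?R n" for n
    by (intro sum_nonneg mult_nonneg_nonneg min.boundedI Bochner_Integration.integral_nonneg regret_nonneg) simp_all
  show ?thesis
  proof (rule order_tendstoI)
    show "\<forall>\<^sub>F n in sequentially. y < ?R n" if "y < 0" for y
      by (intro always_eventually allI less_le_trans[OF that R0])
    fix y :: real assume "0 < y"
    \<comment> \<open>The index \<open>m\<close> is fixed by the limit law before \<open>n\<close>
      grows; weak convergence then has to handle the single continuous function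
      \<open>\<Psi> m\<close>.\<close>
    from order_tendstoD(2)[OF \<Psi>Q this] obtain m where m: "(LINT c|measure_of_bp Q. \<Psi> m c) < y"
      by (auto simp: eventually_sequentially)
    have "(\<lambda>n. LINT c|measure_of_bp (law (P n) (Gn n)). \<Psi> m c) \<longlonglongrightarrow> (LINT c|measure_of_bp Q. \<Psi> m c)"
      by (rule tendsto_borel_prob_continuous[OF law \<Psi>_cont \<Psi>01])
    from order_tendstoD(2)[OF this m]
    have "\<forall>\<^sub>F n in sequentially. (LINT c|measure_of_bp (law (P n) (Gn n)). \<Psi> m c) < y" .
    moreover have "\<forall>\<^sub>F n in sequentially. \<forall>i\<in>space (P n). \<forall>\<mu>.
        miss_prob (P n) ((gn n)(i := \<mu>)) (A m) \<le> inverse (real (Suc m))"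
      by (rule deviation_concentration[OF P small summary A(1,2)]) simp_all
    ultimately show "\<forall>\<^sub>F n in sequentially. ?R n < y"
      using eventually_gt_at_top[of 0]
    proof eventually_elim
      case (elim n)
      have Pn: "finite_player_space (P n)" using P elim by simp
      have "?R n \<le> (\<Sum>i\<in>space (P n). measure (P n) {i} * \<Psi> m (Gn n i))"
      proof (intro sum_mono mult_left_mono)
        fix i assume i: "i \<in> space (P n)"
        obtain b where b: "b \<in> actions (Gn n i)" "payoff (Gn n i) (b, \<tau>) = best_payoff \<tau> (Gn n i)"
          by (rule best_payoff_attained)
        have "payoff (Gn n i) (b, \<tau>) - (LINT a|measure_of_bp (gn n i). payoff (Gn n i) (a, \<tau>))
            \<le> 2 * oscillation \<tau> (A m) (snd (Gn n i)) + 4 * inverse (real (Suc m)) * norm (snd (Gn n i))"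
          using elim i
          by (intro finite_nash_regret[OF Pn nash i b(1) A(1)[of m]] oscillation_upper oscillation_nonneg A) auto
        then show "min 1 (LINT a|measure_of_bp (gn n i). regret \<tau> (Gn n i) a) \<le> \<Psi> m (Gn n i)"
          using integral_regret[OF elim(3) i] b(2) by (simp add: \<Psi>_def)
      qed simp
      also have "\<dots> = (LINT c|measure_of_bp (law (P n) (Gn n)). \<Psi> m c)"
        by (rule integral_law_finite[OF Pn, symmetric]) measurable
      finally show "?R n < y" using elim(1) by simp
    qed
  qed
qed

text \<open>The joint law of characteristic and action, tested against \<open>h\<close> in the first
  and a cell in the second. As player spaces are finite, the sum makes sense for every function
  \<open>h\<close>, measurable or not. With the default 0 at \<open>n = 0\<close>, a bound of
  \<open>h\<close> bounds the sequence at every index.\<close>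

definition cell_mass :: "(nat \<Rightarrow> 'a set) \<Rightarrow> nat \<Rightarrow> bool list \<Rightarrow> ('a characteristic \<Rightarrow> real) \<Rightarrow> real" where
  "cell_mass S n l h = (if n = 0 then 0 else
     (\<Sum>i\<in>space (P n). measure (P n) {i} * (h (Gn n i) * measure (measure_of_bp (gn n i)) (cell S l))))"

lemma cell_mass_bounded:
  assumes "bounded (range h)"
  shows "bounded (range (\<lambda>n. cell_mass S n l h))"
proof -
  obtain B where B: "\<And>c. \<bar>h c\<bar> \<le> B" using assms by (auto simp: bounded_iff)
  have B0: "0 \<le> B" using B[of undefined] by linarith
  have "\<bar>cell_mass S n l h\<bar> \<le> B" for n
  proof (cases "n = 0")
    case False
    have "\<bar>cell_mass S n l h\<bar> \<le>
        (\<Sum>i\<in>space (P n). \<bar>measure (P n) {i} * (h (Gn n i) * measure (measure_of_bp (gn n i)) (cell S l))\<bar>)"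
      using False by (simp add: cell_mass_def sum_abs)
    also have "\<dots> \<le> (\<Sum>i\<in>space (P n). measure (P n) {i} * B)"
    proof (rule sum_mono)
      fix i
      have "\<bar>h (Gn n i)\<bar> * measure (measure_of_bp (gn n i)) (cell S l) \<le> B * 1"
        using B B0 prob_space.prob_le_1[OF prob_space_measure_of_bp] by (intro mult_mono) auto
      then show "\<bar>measure (P n) {i} * (h (Gn n i) * measure (measure_of_bp (gn n i)) (cell S l))\<bar> \<le> measure (P n) {i} * B"
        by (simp add: abs_mult mult_left_mono)
    qed
    also have "\<dots> = B"
      using False P[of n] by (simp add: sum_distrib_right[symmetric] finite_player_space_sum)
    finally show ?thesis .
  qed (use B0 in \<open>simp add: cell_mass_def\<close>)
  then show ?thesis by (auto simp: bounded_iff intro!: exI[of _ B])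
qed

end

section \<open>Limits of the cell masses along the filter, and the kernel they define\<close>

locale limit_functional = game_sequence Q P Gn gn \<tau>
  for Q :: "('a::compact_metric_space) characteristic borel_prob"
    and P :: "nat \<Rightarrow> 'j measure" and Gn gn \<tau> +
  fixes S :: "nat \<Rightarrow> 'a set" and F :: "nat filter"
  assumes open_S: "\<And>k. open (S k)"
    and separating: "\<And>\<epsilon>. \<epsilon> > 0 \<Longrightarrow> \<exists>k. \<forall>a b. (\<forall>j<k. a \<in> S j \<longleftrightarrow> b \<in> S j) \<longrightarrow> dist a b < \<epsilon>"
    and F_bot: "F \<noteq> bot" and F_le: "F \<le> sequentially"
    and F_conv: "\<And>l h. bounded (range h) \<Longrightarrow> \<exists>L. ((\<lambda>n. cell_mass S n l h) \<longlongrightarrow> L) F"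
begin

definition limit_mass :: "bool list \<Rightarrow> ('a characteristic \<Rightarrow> real) \<Rightarrow> real" where
  "limit_mass l h = Lim F (\<lambda>n. cell_mass S n l h)"

lemma eventually_F_gt_0: "eventually (\<lambda>n. 0 < n) F"
  using eventually_gt_at_top[of 0] F_le by (simp add: le_filter_def)

lemma limit_mass: "bounded (range h) \<Longrightarrow> ((\<lambda>n. cell_mass S n l h) \<longlongrightarrow> limit_mass l h) F"
  unfolding limit_mass_def using F_conv[of h l] tendsto_Lim[OF F_bot] by metis

lemma limit_massI: "((\<lambda>n. cell_mass S n l h) \<longlongrightarrow> L) F \<Longrightarrow> limit_mass l h = L"
  unfolding limit_mass_def by (rule tendsto_Lim[OF F_bot])

lemma bounded_01: "(\<And>c. 0 \<le> h c \<and> h c \<le> (1 :: real)) \<Longrightarrow> bounded (range h)"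
  by (auto simp: bounded_iff intro!: exI[of _ 1])

lemma limit_mass_add:
  assumes "bounded (range f)" "bounded (range h)"
  shows "limit_mass l (\<lambda>c. f c + h c) = limit_mass l f + limit_mass l h"
proof (rule limit_massI)
  have "cell_mass S n l (\<lambda>c. f c + h c) = cell_mass S n l f + cell_mass S n l h" for n
    by (simp add: cell_mass_def sum.distrib[symmetric] algebra_simps)
  then show "((\<lambda>n. cell_mass S n l (\<lambda>c. f c + h c)) \<longlongrightarrow> limit_mass l f + limit_mass l h) F"
    using assms by (simp add: tendsto_add limit_mass)
qed

lemma limit_mass_scale:
  assumes "bounded (range f)"
  shows "limit_mass l (\<lambda>c. r * f c) = r * limit_mass l f"
proof (rule limit_massI)
  have "cell_mass S n l (\<lambda>c. r * f c) = r * cell_mass S n l f" for n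
    by (simp add: cell_mass_def sum_distrib_left algebra_simps)
  then show "((\<lambda>n. cell_mass S n l (\<lambda>c. r * f c)) \<longlongrightarrow> r * limit_mass l f) F"
    using assms by (simp add: tendsto_mult_left limit_mass)
qed

lemma limit_mass_nonneg:
  assumes "bounded (range f)" "\<And>c. 0 \<le> f c"
  shows "0 \<le> limit_mass l f"
proof (rule tendsto_lowerbound[OF limit_mass[OF assms(1)] _ F_bot])
  show "\<forall>\<^sub>F n in F. 0 \<le> cell_mass S n l f"
    by (intro always_eventually) (auto simp: cell_mass_def intro!: sum_nonneg mult_nonneg_nonneg assms(2))
qed

lemma cell_mass_Nil:
  assumes "n > 0" "h \<in> borel_measurable borel"
  shows "cell_mass S n [] h = (LINT c|measure_of_bp (law (P n) (Gn n)). h c)"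
proof -
  have "measure (measure_of_bp \<mu>) UNIV = 1" for \<mu> :: "'a borel_prob"
    using prob_space.prob_space[OF prob_space_measure_of_bp[of \<mu>]] by simp
  then show ?thesis using assms by (simp add: cell_mass_def integral_law_finite[OF P])
qed

text \<open>The root cell is the whole action space, so its mass sees only the law of the
  characteristics, and convergence along \<open>sequentially\<close> passes to the finer
  filter.\<close>

lemma limit_mass_Nil:
  assumes h: "continuous_on UNIV h" "\<And>c. 0 \<le> h c \<and> h c \<le> 1"
  shows "limit_mass [] h = (LINT c|measure_of_bp Q. h c)"
proof (rule limit_massI)
  have "((\<lambda>n. LINT c|measure_of_bp (law (P n) (Gn n)). h c) \<longlongrightarrow> (LINT c|measure_of_bp Q. h c)) F"
    using tendsto_borel_prob_continuous[OF law h] F_le by (rule tendsto_mono[rotated])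
  moreover have "\<forall>\<^sub>F n in F. (LINT c|measure_of_bp (law (P n) (Gn n)). h c) = cell_mass S n [] h"
    using eventually_F_gt_0 by eventually_elim (simp add: cell_mass_Nil borel_measurable_continuous_onI h(1))
  ultimately show "((\<lambda>n. cell_mass S n [] h) \<longlongrightarrow> (LINT c|measure_of_bp Q. h c)) F"
    by (rule Lim_transform_eventually)
qed

lemma cell_borel: "cell S l \<in> sets borel"
  using open_S by (rule cell_measurable)

lemma limit_mass_split:
  assumes "bounded (range h)"
  shows "limit_mass l h = limit_mass (True # l) h + limit_mass (False # l) h"
proof (rule limit_massI)
  have split: "measure (measure_of_bp \<mu>) (cell S l) =
      measure (measure_of_bp \<mu>) (cell S (True # l)) + measure (measure_of_bp \<mu>) (cell S (False # l))" for \<mu>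
  proof -
    interpret prob_space "measure_of_bp \<mu>" by simp
    have "cell S l = cell S (True # l) \<union> cell S (False # l)" by (auto simp: cell_Cons)
    also have "prob \<dots> = prob (cell S (True # l)) + prob (cell S (False # l))"
      by (intro finite_measure_Union) (simp_all add: cell_borel, auto simp: cell_Cons)
    finally show ?thesis .
  qed
  have "cell_mass S n l h = cell_mass S n (True # l) h + cell_mass S n (False # l) h" for n
    by (simp add: cell_mass_def split[of "gn n _"] sum.distrib[symmetric] algebra_simps)
  then show "((\<lambda>n. cell_mass S n l h) \<longlongrightarrow> limit_mass (True # l) h + limit_mass (False # l) h) F"
    using assms by (simp add: tendsto_add limit_mass)
qed

lemma limit_mass_empty:
  assumes "cell S l = {}"
  shows "limit_mass l h = 0"
proof (rule limit_massI)
  have "cell_mass S n l h = 0" for n using assms by (simp add: cell_mass_def)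
  then show "((\<lambda>n. cell_mass S n l h) \<longlongrightarrow> 0) F" by simp
qed

text \<open>Every cell is contained in the root cell, whose limit mass is \<open>Q\<close> on
  continuous functions; this is the domination from which the densities arise.\<close>

lemma limit_mass_le:
  assumes h: "continuous_on UNIV h" "\<And>c. 0 \<le> h c \<and> h c \<le> 1"
  shows "limit_mass l h \<le> (LINT c|measure_of_bp Q. h c)"
proof -
  have b: "bounded (range h)" using h(2) by (rule bounded_01)
  have "limit_mass l h \<le> limit_mass [] h"
  proof (rule tendsto_le[OF F_bot limit_mass[OF b] limit_mass[OF b]])
    have "cell_mass S n l h \<le> cell_mass S n [] h" for n
      unfolding cell_mass_def
      by (auto intro!: sum_mono mult_left_mono finite_measure.finite_measure_mono prob_space.finite_measure
          h(2)[THEN conjunct1])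
    then show "\<forall>\<^sub>F n in F. cell_mass S n l h \<le> cell_mass S n [] h" by simp
  qed
  then show ?thesis using limit_mass_Nil[OF h] by simp
qed

text \<open>The equilibrium property enters the limit here: summed over players, the Markov
  inequality bounds the tested cell mass by the mean regret, which vanishes.\<close>

lemma limit_mass_regret:
  assumes "cell S l \<noteq> {}"
  shows "limit_mass l (cell_regret \<tau> (cell S l)) = 0"
proof (rule antisym)
  have cr: "\<And>c. 0 \<le> cell_regret \<tau> (cell S l) c \<and> cell_regret \<tau> (cell S l) c \<le> 1"
    using cell_regret_bounds[OF assms] by blast
  have b: "bounded (range (cell_regret \<tau> (cell S l)))" using cr by (rule bounded_01)
  show "0 \<le> limit_mass l (cell_regret \<tau> (cell S l))" using b cr by (intro limit_mass_nonneg) auto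
  show "limit_mass l (cell_regret \<tau> (cell S l)) \<le> 0"
  proof (rule tendsto_le[OF F_bot tendsto_mono[OF F_le mean_regret_vanishes] limit_mass[OF b]])
    show "\<forall>\<^sub>F n in F. cell_mass S n l (cell_regret \<tau> (cell S l)) \<le>
        (\<Sum>i\<in>space (P n). measure (P n) {i} * min 1 (LINT a|measure_of_bp (gn n i). regret \<tau> (Gn n i) a))"
      using eventually_F_gt_0
      by eventually_elim
        (auto simp: cell_mass_def intro!: sum_mono mult_left_mono cell_regret_mass[OF cell_borel assms])
  qed
qed

lemma representative_close:
  assumes "\<epsilon> > 0"
  shows "\<exists>k0. \<forall>k\<ge>k0. \<forall>a. dist a (representative S (address S k a)) < \<epsilon>"
proof -
  obtain k0 where k0: "\<And>a b. (\<forall>j<k0. a \<in> S j \<longleftrightarrow> b \<in> S j) \<Longrightarrow> dist a b < \<epsilon>"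
    using separating[OF assms] by blast
  have "dist a (representative S (address S k a)) < \<epsilon>" if "k \<ge> k0" for k a
  proof (rule k0, intro allI impI)
    fix j assume "j < k0"
    have "cell S (address S k a) \<noteq> {}" by (metis mem_cell_address empty_iff)
    then have "representative S (address S k a) \<in> cell S (address S k a)" by (rule representative_mem)
    then have "address S k (representative S (address S k a)) = address S k a" by (simp add: cell_def)
    from address_eqD[OF this, of j] show "a \<in> S j \<longleftrightarrow> representative S (address S k a) \<in> S j"
      using \<open>j < k0\<close> that by auto
  qed
  then show ?thesis by blast
qed

text \<open>On the cells of a deep level \<open>f\<close> is nearly constant, so its mean under any
  measure is nearly a finite combination of cell masses. The error does not depend on
  \<open>n\<close>, hence survives the limit along \<open>F\<close>, and only afterwards does the
  level tend to infinity; no convergence of measures on the cells is involved.\<close>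

lemma tendsto_limit_mass_summary:
  fixes f :: "'a \<Rightarrow>\<^sub>C real"
  shows "(\<lambda>k. \<Sum>l | length l = k. apply_bcontfun f (representative S l) * limit_mass l (\<lambda>_. 1))
    \<longlonglongrightarrow> bp_mean \<tau> f"
proof (rule metric_LIMSEQ_I)
  fix \<epsilon> :: real assume "\<epsilon> > 0"
  then have e2: "\<epsilon> / 2 > 0" by simp
  have "uniformly_continuous_on UNIV (apply_bcontfun f)"
    by (intro compact_uniformly_continuous compact_UNIV_metric) simp
  then obtain \<delta> where \<delta>: "\<delta> > 0"
    "\<And>a b. dist a b < \<delta> \<Longrightarrow> dist (apply_bcontfun f a) (apply_bcontfun f b) < \<epsilon> / 2"
    unfolding uniformly_continuous_on_def using e2 by (metis UNIV_I)
  obtain k0 where k0: "\<And>k a. k \<ge> k0 \<Longrightarrow> dist a (representative S (address S k a)) < \<delta>"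
    using representative_close[OF \<delta>(1)] by blast
  have f_meas: "apply_bcontfun f \<in> borel_measurable borel" by (rule borel_measurable_continuous_onI) simp
  have est: "\<bar>(\<Sum>l | length l = k. apply_bcontfun f (representative S l) * limit_mass l (\<lambda>_. 1)) -
      bp_mean \<tau> f\<bar> \<le> \<epsilon> / 2" if k: "k \<ge> k0" for k
  proof -
    define I where "I \<mu> = bp_mean \<mu> f" for \<mu>
    \<comment> \<open>The integral of the step function that takes on each cell the value of
      \<open>f\<close> at its representative. As its distance from the mean of \<open>f\<close> is
      bounded for every measure alike, the bound carries over to averages over players.\<close>
    define T where "T \<mu> = (\<Sum>l | length l = k. apply_bcontfun f (representative S l) * measure (measure_of_bp \<mu>) (cell S l))" for \<mu>
    have TI: "\<bar>T \<mu> - I \<mu>\<bar> \<le> \<epsilon> / 2" for \<mu>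
    proof -
      interpret prob_space "measure_of_bp \<mu>" by simp
      have i: "integrable (measure_of_bp \<mu>) (\<lambda>a. apply_bcontfun f (representative S l) * indicator (cell S l) a)" for l
        using cell_borel emeasure_finite by (auto simp: less_top[symmetric])
      have i2: "integrable (measure_of_bp \<mu>) (\<lambda>a. \<Sum>l | length l = k. apply_bcontfun f (representative S l) * indicator (cell S l) a)"
        using i by (intro Bochner_Integration.integrable_sum)
      have "T \<mu> = (LINT a|measure_of_bp \<mu>. (\<Sum>l | length l = k. apply_bcontfun f (representative S l) * indicator (cell S l) a))"
        using i cell_borel by (subst Bochner_Integration.integral_sum) (auto simp: T_def)
      then have "T \<mu> - I \<mu> = (LINT a|measure_of_bp \<mu>. (\<Sum>l | length l = k. apply_bcontfun f (representative S l) * indicator (cell S l) a) - apply_bcontfun f a)"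
        using i2 by (simp add: I_def)
      also have "\<bar>\<dots>\<bar> \<le> (LINT a|measure_of_bp \<mu>. \<bar>(\<Sum>l | length l = k. apply_bcontfun f (representative S l) * indicator (cell S l) a) - apply_bcontfun f a\<bar>)"
        by (rule integral_abs_bound)
      also have "\<dots> \<le> (LINT a|measure_of_bp \<mu>. \<epsilon> / 2)"
      proof (rule integral_mono)
        show "\<bar>(\<Sum>l | length l = k. apply_bcontfun f (representative S l) * indicator (cell S l) a) - apply_bcontfun f a\<bar> \<le> \<epsilon> / 2" for a
          using \<delta>(2)[OF k0[OF k, of a]] unfolding sum_cells by (simp add: dist_real_def abs_minus_commute)
      qed (use i2 in auto)
      finally show ?thesis using prob_space by simp
    qed
    have lim1: "((\<lambda>n. \<Sum>l | length l = k. apply_bcontfun f (representative S l) * cell_mass S n l (\<lambda>_. 1)) \<longlongrightarrow>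
        (\<Sum>l | length l = k. apply_bcontfun f (representative S l) * limit_mass l (\<lambda>_. 1))) F"
      by (intro tendsto_sum tendsto_mult tendsto_const limit_mass bounded_01) simp
    have lim2: "((\<lambda>n. I (finite_summary (P n) (gn n))) \<longlongrightarrow> I \<tau>) F"
      using tendsto_mono[OF F_le summary] unfolding tendsto_borel_prob_iff I_def by blast
    have "((\<lambda>n. \<bar>(\<Sum>l | length l = k. apply_bcontfun f (representative S l) * cell_mass S n l (\<lambda>_. 1)) -
        I (finite_summary (P n) (gn n))\<bar>) \<longlongrightarrow>
        \<bar>(\<Sum>l | length l = k. apply_bcontfun f (representative S l) * limit_mass l (\<lambda>_. 1)) - I \<tau>\<bar>) F"
      by (intro tendsto_rabs tendsto_diff lim1 lim2)
    moreover have "\<forall>\<^sub>F n in F. \<bar>(\<Sum>l | length l = k. apply_bcontfun f (representative S l) * cell_mass S n l (\<lambda>_. 1)) -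
        I (finite_summary (P n) (gn n))\<bar> \<le> \<epsilon> / 2"
      using eventually_F_gt_0
    proof eventually_elim
      case (elim n)
      have Pn: "finite_player_space (P n)" using P elim by simp
      have "(\<Sum>l | length l = k. apply_bcontfun f (representative S l) * cell_mass S n l (\<lambda>_. 1)) =
          (\<Sum>l | length l = k. \<Sum>i\<in>space (P n). measure (P n) {i} *
            (apply_bcontfun f (representative S l) * measure (measure_of_bp (gn n i)) (cell S l)))"
        using elim by (simp add: cell_mass_def sum_distrib_left algebra_simps)
      also have "\<dots> = (\<Sum>i\<in>space (P n). measure (P n) {i} * T (gn n i))"
        unfolding T_def sum_distrib_left by (rule sum.swap)
      finally have "(\<Sum>l | length l = k. apply_bcontfun f (representative S l) * cell_mass S n l (\<lambda>_. 1)) -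
          I (finite_summary (P n) (gn n)) = (\<Sum>i\<in>space (P n). measure (P n) {i} * (T (gn n i) - I (gn n i)))"
        by (simp add: I_def integral_finite_summary[OF Pn] sum_subtractf right_diff_distrib)
      also have "\<bar>\<dots>\<bar> \<le> (\<Sum>i\<in>space (P n). \<bar>measure (P n) {i} * (T (gn n i) - I (gn n i))\<bar>)"
        by (rule sum_abs)
      also have "\<dots> \<le> (\<Sum>i\<in>space (P n). measure (P n) {i} * (\<epsilon> / 2))"
        unfolding abs_mult abs_of_nonneg[OF measure_nonneg] by (intro sum_mono mult_left_mono TI) simp
      also have "\<dots> = \<epsilon> / 2" using finite_player_space_sum[OF Pn] by (simp only: sum_distrib_right[symmetric] mult_1)
      finally show ?case .
    qed
    ultimately show ?thesis unfolding I_def[symmetric] by (rule tendsto_upperbound[OF _ _ F_bot])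
  qed
  have "\<epsilon> / 2 < \<epsilon>" using \<open>\<epsilon> > 0\<close> by simp
  then show "\<exists>k0. \<forall>k\<ge>k0. dist (\<Sum>l | length l = k. apply_bcontfun f (representative S l) * limit_mass l (\<lambda>_. 1))
      (bp_mean \<tau> f) < \<epsilon>"
    using est unfolding dist_real_def by (meson le_less_trans)
qed

text \<open>Each density is unique only up to a null set, so the tree identities, inherited from the
  limit masses, hold almost surely at first. The tree has countably many nodes, and one exceptional
  null set serves them all.\<close>

lemma ex_weights:
  "\<exists>W. (\<forall>l. W l \<in> borel_measurable borel) \<and> (\<forall>c. tree_weights S (\<lambda>l. W l c)) \<and>
    (\<forall>l h. continuous_on UNIV h \<longrightarrow> (\<forall>c. 0 \<le> h c \<and> h c \<le> 1) \<longrightarrow>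
      limit_mass l h = (LINT c|measure_of_bp Q. h c * W l c))"
proof -
  interpret Q: prob_space "measure_of_bp Q" by simp
  have fQ: "finite_measure (measure_of_bp Q)" by unfold_locales
  define D where "D l w \<longleftrightarrow> w \<in> borel_measurable borel \<and> (\<forall>c. 0 \<le> w c \<and> w c \<le> 1) \<and>
      (\<forall>h. continuous_on UNIV h \<longrightarrow> (\<forall>c. 0 \<le> h c \<and> h c \<le> 1) \<longrightarrow>
        limit_mass l h = (LINT c|measure_of_bp Q. h c * w c))" for l w
  have "\<exists>w. D l w" for l
    unfolding D_def
  proof (rule dominated_functional_density[of "measure_of_bp Q" "limit_mass l"])
    show "limit_mass l (\<lambda>x. f x + h x) = limit_mass l f + limit_mass l h"
      if "bounded (range f)" "bounded (range h)" for f h using that by (rule limit_mass_add)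
    show "limit_mass l (\<lambda>x. r * f x) = r * limit_mass l f" if "bounded (range f)" for f r
      using that by (rule limit_mass_scale)
    show "0 \<le> limit_mass l f" if "bounded (range f)" "\<And>x. 0 \<le> f x" for f
      using that by (rule limit_mass_nonneg)
    show "limit_mass l h \<le> (LINT x|measure_of_bp Q. h x)"
      if "continuous_on UNIV h" "\<And>x. 0 \<le> h x \<and> h x \<le> 1" for h
      using that by (rule limit_mass_le)
    show "prob_space (measure_of_bp Q)" "sets (measure_of_bp Q) = sets borel" by simp_all
  qed blast
  then obtain w where "\<And>l. D l (w l)" by metis
  then have w_meas[measurable]: "\<And>l. w l \<in> borel_measurable borel"
    and w01: "\<And>l c. 0 \<le> w l c \<and> w l c \<le> 1"
    and w: "\<And>l h. continuous_on UNIV h \<Longrightarrow> (\<And>c. 0 \<le> h c \<and> h c \<le> 1) \<Longrightarrow>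
      limit_mass l h = (LINT c|measure_of_bp Q. h c * w l c)"
    unfolding D_def by blast+
  have int: "integrable (measure_of_bp Q) (\<lambda>c. h c * w l c)"
    if "continuous_on UNIV h" "\<And>c. 0 \<le> h c \<and> h c \<le> 1" for h l
  proof (rule Q.integrable_const_bound[where B = 1])
    show "AE c in measure_of_bp Q. norm (h c * w l c) \<le> 1"
      using that(2) w01 by (intro AE_I2) (auto simp: abs_mult intro!: mult_le_one)
    have [measurable]: "h \<in> borel_measurable borel" using that(1) by (rule borel_measurable_continuous_onI)
    show "(\<lambda>c. h c * w l c) \<in> borel_measurable (measure_of_bp Q)" by measurable
  qed
  define good where "good c \<longleftrightarrow> w [] c = 1 \<and> (\<forall>l. w l c = w (True # l) c + w (False # l) c) \<and>
    (\<forall>l. cell S l = {} \<longrightarrow> w l c = 0)" for c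
  have good_meas[measurable]: "{c. good c} \<in> sets borel"
  proof -
    have "{c \<in> space borel. good c} \<in> sets borel" unfolding good_def by measurable
    then show ?thesis by simp
  qed
  have 1: "AE c in measure_of_bp Q. w [] c = 1"
  proof (rule density_unique_continuous[OF fQ, of "w []" 1 "\<lambda>_. 1"])
    fix h :: "'a characteristic \<Rightarrow> real" assume h: "continuous_on UNIV h" "\<And>x. 0 \<le> h x \<and> h x \<le> 1"
    show "(LINT c|measure_of_bp Q. h c * w [] c) = (LINT c|measure_of_bp Q. h c * 1)"
      using w[OF h, of "[]"] limit_mass_Nil[OF h] by simp
  qed (use w01 in auto)
  have 2: "AE c in measure_of_bp Q. w l c = w (True # l) c + w (False # l) c" for l
  proof (rule density_unique_continuous[OF fQ, of "w l" 2 "\<lambda>c. w (True # l) c + w (False # l) c"])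
    show "0 \<le> w l c \<and> w l c \<le> 2" for c using w01[of l c] by simp
    show "0 \<le> w (True # l) c + w (False # l) c \<and> w (True # l) c + w (False # l) c \<le> 2" for c
      using w01[of "True # l" c] w01[of "False # l" c] by simp
    fix h :: "'a characteristic \<Rightarrow> real" assume h: "continuous_on UNIV h" "\<And>x. 0 \<le> h x \<and> h x \<le> 1"
    show "(LINT c|measure_of_bp Q. h c * w l c) = (LINT c|measure_of_bp Q. h c * (w (True # l) c + w (False # l) c))"
      using w[OF h, of l] w[OF h, of "True # l"] w[OF h, of "False # l"] limit_mass_split[OF bounded_01[OF h(2)], of l] int[OF h]
      by (simp add: distrib_left)
  qed auto
  have 3: "AE c in measure_of_bp Q. cell S l = {} \<longrightarrow> w l c = 0" for l
  proof (cases "cell S l = {}")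
    case True
    have "AE c in measure_of_bp Q. w l c = 0"
    proof (rule density_unique_continuous[OF fQ, of "w l" 1 "\<lambda>_. 0"])
      fix h :: "'a characteristic \<Rightarrow> real" assume h: "continuous_on UNIV h" "\<And>x. 0 \<le> h x \<and> h x \<le> 1"
      show "(LINT c|measure_of_bp Q. h c * w l c) = (LINT c|measure_of_bp Q. h c * 0)"
        using w[OF h, of l] limit_mass_empty[OF True] by simp
    qed (use w01 in auto)
    then show ?thesis by (auto elim: eventually_mono)
  qed simp
  have good: "AE c in measure_of_bp Q. good c"
    unfolding good_def using 1 2 3 by (simp add: AE_all_countable)
  \<comment> \<open>Off the good set, put all mass on one branch to obtain tree weights everywhere.\<close>
  define W where "W l c = (if good c then w l c else of_bool (l = address S (length l) undefined))" for l c
  have "W l \<in> borel_measurable borel" for l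
  proof -
    have "W l = (\<lambda>c. if c \<in> {c. good c} then w l c else of_bool (l = address S (length l) undefined))"
      by (auto simp: W_def)
    also have "\<dots> \<in> borel_measurable borel" by measurable
    finally show ?thesis .
  qed
  moreover have "tree_weights S (\<lambda>l. W l c)" for c
  proof (unfold_locales)
    show "0 \<le> W l c" for l using w01 by (simp add: W_def)
    have goodD: "w [] c = 1" "w l c = w (True # l) c + w (False # l) c" "cell S l = {} \<Longrightarrow> w l c = 0"
      if "good c" for l
      using that unfolding good_def by blast+
    show "W [] c = 1" using goodD(1) by (simp add: W_def)
    show "W l c = W (True # l) c + W (False # l) c" for l
    proof (cases "good c")
      case True
      then show ?thesis unfolding W_def using goodD(2)[of l] by simp
    qed (auto simp: W_def)
    show "W l c = 0" if "cell S l = {}" for l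
    proof -
      have "l \<noteq> address S (length l) undefined" using that mem_cell_address by (metis empty_iff)
      then show ?thesis using goodD(3)[OF _ that] by (simp add: W_def)
    qed
  qed (use open_S separating in blast)+
  moreover have "limit_mass l h = (LINT c|measure_of_bp Q. h c * W l c)"
    if h: "continuous_on UNIV h" "\<forall>c. 0 \<le> h c \<and> h c \<le> 1" for l h
  proof -
    have [measurable]: "h \<in> borel_measurable borel" using h(1) by (rule borel_measurable_continuous_onI)
    have "(LINT c|measure_of_bp Q. h c * w l c) = (LINT c|measure_of_bp Q. h c * W l c)"
    proof (rule integral_cong_AE)
      show "AE c in measure_of_bp Q. h c * w l c = h c * W l c"
        using good by eventually_elim (simp add: W_def)
      show "(\<lambda>c. h c * W l c) \<in> borel_measurable (measure_of_bp Q)"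
        using \<open>W l \<in> borel_measurable borel\<close> by simp
    qed simp
    then show ?thesis using w[OF h(1)] h(2) by simp
  qed
  ultimately show ?thesis by blast
qed

text \<open>The weights at \<open>c\<close> define the kernel at \<open>c\<close>. The product of
  cell regret and weight is nonnegative with integral 0, so for almost every \<open>c\<close> each
  cell of positive weight contains actions of arbitrarily small regret, and the branch limits have
  none. The summary is recovered by interchanging the level limit with the integral.\<close>

lemma ex_limit_kernel:
  "\<exists>\<kappa>. \<kappa> \<in> borel_measurable borel \<and>
    (AE c in measure_of_bp Q. AE a in measure_of_bp (\<kappa> c). regret \<tau> c a = 0) \<and>
    (\<forall>f :: 'a \<Rightarrow>\<^sub>C real. (LINT c|measure_of_bp Q. bp_mean (\<kappa> c) f) =
      bp_mean \<tau> f)"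
proof -
  interpret Q: prob_space "measure_of_bp Q" by simp
  obtain W where W_meas[measurable]: "\<And>l. W l \<in> borel_measurable borel"
    and tree: "\<And>c. tree_weights S (\<lambda>l. W l c)"
    and W: "\<And>l h. continuous_on UNIV h \<Longrightarrow> (\<And>c. 0 \<le> h c \<and> h c \<le> 1) \<Longrightarrow>
      limit_mass l h = (LINT c|measure_of_bp Q. h c * W l c)"
    using ex_weights by blast
  have W0: "0 \<le> W l c" for l c using tree_weights.w_nonneg[OF tree] .
  define \<kappa> where "\<kappa> c = tree_kernel S (\<lambda>l. W l c)" for c
  have lim: "(\<lambda>k. \<Sum>l | length l = k. W l c * apply_bcontfun f (representative S l))
      \<longlonglongrightarrow> bp_mean (\<kappa> c) f" for c and f :: "'a \<Rightarrow>\<^sub>C real"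
    unfolding \<kappa>_def by (rule tree_weights.tendsto_integral_tree_kernel[OF tree])
  have \<kappa>_meas: "\<kappa> \<in> borel_measurable borel"
  proof (rule measurable_borel_probI)
    show "(\<lambda>c. bp_mean (\<kappa> c) f) \<in> borel_measurable borel" for f :: "'a \<Rightarrow>\<^sub>C real"
      by (rule borel_measurable_LIMSEQ_real[OF lim]) measurable
  qed
  have W1: "W l c \<le> 1" for l c
  proof -
    have "W l c \<le> (\<Sum>l' | length l' = length l. W l' c)"
      using W0 by (intro member_le_sum[where f = "\<lambda>l'. W l' c"]) auto
    then show ?thesis using tree_weights.sum_weights[OF tree] by simp
  qed
  have intW: "integrable (measure_of_bp Q) (W l)" for l
    using W0 W1 by (intro Q.integrable_const_bound[where B = 1] AE_I2) simp_all
  have "AE c in measure_of_bp Q. cell S l \<noteq> {} \<longrightarrow> cell_regret \<tau> (cell S l) c * W l c = 0" for l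
  proof (cases "cell S l = {}")
    case False
    have cont: "continuous_on UNIV (cell_regret \<tau> (cell S l))" using False by (rule continuous_on_cell_regret)
    have cr: "0 \<le> cell_regret \<tau> (cell S l) c \<and> cell_regret \<tau> (cell S l) c \<le> 1" for c
      using False by (rule cell_regret_bounds)
    have [measurable]: "cell_regret \<tau> (cell S l) \<in> borel_measurable borel"
      using cont by (rule borel_measurable_continuous_onI)
    have i: "integrable (measure_of_bp Q) (\<lambda>c. cell_regret \<tau> (cell S l) c * W l c)"
    proof (rule Q.integrable_const_bound[where B = 1])
      have "\<bar>cell_regret \<tau> (cell S l) c * W l c\<bar> \<le> 1" for c
        using cr[of c] W0[of l c] W1[of l c] by (simp add: mult_le_one)
      then show "AE c in measure_of_bp Q. norm (cell_regret \<tau> (cell S l) c * W l c) \<le> 1" by simp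
    qed measurable
    have "(LINT c|measure_of_bp Q. cell_regret \<tau> (cell S l) c * W l c) = 0"
      using W[OF cont cr, of l] limit_mass_regret[OF False] by simp
    moreover have "AE c in measure_of_bp Q. 0 \<le> cell_regret \<tau> (cell S l) c * W l c"
      by (intro AE_I2 mult_nonneg_nonneg W0 cr[THEN conjunct1])
    ultimately have "AE c in measure_of_bp Q. cell_regret \<tau> (cell S l) c * W l c = 0"
      using integral_nonneg_eq_0_iff_AE[OF i] by blast
    then show ?thesis by (rule AE_mp) simp
  qed simp
  \<comment> \<open>The nodes are countable in number, so the exceptional sets combine into one null
    set.\<close>
  then have "AE c in measure_of_bp Q. \<forall>l. cell S l \<noteq> {} \<longrightarrow> cell_regret \<tau> (cell S l) c * W l c = 0"
    unfolding AE_all_countable by blast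
  then have "AE c in measure_of_bp Q. AE a in measure_of_bp (\<kappa> c). regret \<tau> c a = 0"
  proof eventually_elim
    case (elim c)
    show ?case
      unfolding \<kappa>_def
    proof (rule tree_weights.tree_kernel_concentrated[OF tree continuous_on_regret regret_nonneg])
      fix l and \<epsilon> :: real assume l: "W l c > 0" and "\<epsilon> > 0"
      have ne: "cell S l \<noteq> {}" using l tree_weights.w_empty[OF tree[of c], of l] by auto
      then have "cell_regret \<tau> (cell S l) c = 0" using elim l by auto
      then show "\<exists>a\<in>cell S l. regret \<tau> c a < \<epsilon>" using ne \<open>\<epsilon> > 0\<close> by (rule cell_regret_eq_0D)
    qed
  qed
  moreover have "(LINT c|measure_of_bp Q. bp_mean (\<kappa> c) f) =
      bp_mean \<tau> f" for f :: "'a \<Rightarrow>\<^sub>C real"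
  proof (rule LIMSEQ_unique)
    have "(\<lambda>k. LINT c|measure_of_bp Q. (\<Sum>l | length l = k. W l c * apply_bcontfun f (representative S l)))
        \<longlonglongrightarrow> (LINT c|measure_of_bp Q. bp_mean (\<kappa> c) f)"
    proof (rule integral_dominated_convergence[where w = "\<lambda>_. norm f"])
      show "(\<lambda>c. bp_mean (\<kappa> c) f) \<in> borel_measurable (measure_of_bp Q)"
        using measurable_integral_bp[OF \<kappa>_meas, of f] by simp
      show "AE c in measure_of_bp Q. norm (\<Sum>l | length l = k. W l c * apply_bcontfun f (representative S l)) \<le> norm f" for k
        using tree_weights.abs_tree_sum_le[OF tree] by (intro AE_I2) simp
    qed (use lim in simp_all)
    then show "(\<lambda>k. \<Sum>l | length l = k. apply_bcontfun f (representative S l) * limit_mass l (\<lambda>_. 1))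
        \<longlonglongrightarrow> (LINT c|measure_of_bp Q. bp_mean (\<kappa> c) f)"
      using intW W[of "\<lambda>_. 1"] by (simp add: Bochner_Integration.integral_sum mult.commute)
  qed (rule tendsto_limit_mass_summary)
  ultimately show ?thesis using \<kappa>_meas by blast
qed

end

section \<open>The equilibrium of the large game\<close>

lemma (in game_sequence) ex_equilibrium_kernel:
  "\<exists>\<kappa>. \<kappa> \<in> borel_measurable borel \<and>
    (AE c in measure_of_bp Q. AE a in measure_of_bp (\<kappa> c). regret \<tau> c a = 0) \<and>
    (\<forall>f :: 'a \<Rightarrow>\<^sub>C real. (LINT c|measure_of_bp Q. bp_mean (\<kappa> c) f) =
      bp_mean \<tau> f)"
proof -
  obtain S :: "nat \<Rightarrow> 'a set" where S: "\<And>k. open (S k)"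
    "\<And>\<epsilon>. \<epsilon> > 0 \<Longrightarrow> \<exists>k. \<forall>a b. (\<forall>j<k. a \<in> S j \<longleftrightarrow> b \<in> S j) \<longrightarrow> dist a b < \<epsilon>"
    using ex_separating_open_sets[where 'a = 'a] by blast
  \<comment> \<open>A node together with a test function forms one index, so that a single filter
    serves all pairs at once.\<close>
  define X where "X n p = cell_mass S n (fst p) (snd p)" for n p
  obtain F where F: "F \<noteq> bot" "F \<le> sequentially"
    "\<And>p. bounded (range (\<lambda>n. X n p)) \<Longrightarrow> \<exists>L. ((\<lambda>n. X n p) \<longlongrightarrow> L) F"
    by (rule ex_filter_bounded_sequences_converge[of X]) blast
  interpret limit_functional Q P Gn gn \<tau> S F
  proof (unfold_locales)
    fix l and h :: "'a characteristic \<Rightarrow> real" assume "bounded (range h)"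
    then show "\<exists>L. ((\<lambda>n. cell_mass S n l h) \<longlongrightarrow> L) F"
      using F(3)[of "(l, h)"] cell_mass_bounded[of h S l] by (simp add: X_def)
  qed (fact S F)+
  show ?thesis by (rule ex_limit_kernel)
qed

text \<open>Without regret the strategy is carried by feasible maximisers and earns exactly
  \<open>best_payoff\<close>, which bounds the payoff of every feasible strategy from above.\<close>

lemma zero_regret_optimal:
  fixes \<tau> :: "'a::compact_metric_space borel_prob"
  assumes zero: "AE a in measure_of_bp \<nu>. regret \<tau> c a = 0"
  shows "\<nu> \<in> probs_on (actions c)"
    and "\<mu> \<in> probs_on (actions c) \<Longrightarrow>
      (LINT a:actions c|measure_of_bp \<mu>. payoff c (a, \<tau>)) \<le> (LINT a:actions c|measure_of_bp \<nu>. payoff c (a, \<tau>))"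
proof -
  interpret \<nu>: prob_space "measure_of_bp \<nu>" by simp
  have "AE a in measure_of_bp \<nu>. a \<in> actions c"
    using zero by (rule AE_mp) (auto dest: regret_eq_0D)
  then show "\<nu> \<in> probs_on (actions c)" by (simp add: probs_on_def \<nu>.prob_eq_1)
  have slice: "(\<lambda>a. payoff c (a, \<tau>)) \<in> borel_measurable borel"
    by (rule borel_measurable_continuous_onI[OF continuous_on_payoff_slice])
  have "(LINT a:actions c|measure_of_bp \<nu>. payoff c (a, \<tau>)) = (LINT a|measure_of_bp \<nu>. best_payoff \<tau> c)"
    unfolding set_lebesgue_integral_def
  proof (rule integral_cong_AE)
    show "AE a in measure_of_bp \<nu>. indicat_real (actions c) a *\<^sub>R payoff c (a, \<tau>) = best_payoff \<tau> c"
      using zero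
    proof eventually_elim
      case (elim a)
      show ?case using regret_eq_0D[OF elim] by simp
    qed
  qed (use slice in simp_all)
  then have \<nu>: "(LINT a:actions c|measure_of_bp \<nu>. payoff c (a, \<tau>)) = best_payoff \<tau> c"
    using \<nu>.prob_space by simp
  assume \<mu>: "\<mu> \<in> probs_on (actions c)"
  interpret \<mu>: prob_space "measure_of_bp \<mu>" by simp
  have "(LINT a:actions c|measure_of_bp \<mu>. payoff c (a, \<tau>)) \<le> (LINT a|measure_of_bp \<mu>. best_payoff \<tau> c)"
    unfolding set_lebesgue_integral_def
  proof (rule integral_mono_AE)
    show "integrable (measure_of_bp \<mu>) (\<lambda>a. indicat_real (actions c) a *\<^sub>R payoff c (a, \<tau>))"
      by (intro integrable_mult_indicator integrable_payoff_slice) simp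
    show "AE a in measure_of_bp \<mu>. indicat_real (actions c) a *\<^sub>R payoff c (a, \<tau>) \<le> best_payoff \<tau> c"
      using AE_probs_on[OF \<mu>] by (rule AE_mp) (auto intro: best_payoff_upper)
  qed simp
  then show "(LINT a:actions c|measure_of_bp \<mu>. payoff c (a, \<tau>)) \<le> (LINT a:actions c|measure_of_bp \<nu>. payoff c (a, \<tau>))"
    using \<nu> \<mu>.prob_space by simp
qed

theorem theorem1:
  fixes M :: "'i measure"
    and G :: "'i \<Rightarrow> ('a::compact_metric_space) characteristic"
    and P :: "nat \<Rightarrow> 'j measure"
    and Gn :: "nat \<Rightarrow> 'j \<Rightarrow> 'a characteristic"
    and gn :: "nat \<Rightarrow> 'j \<Rightarrow> 'a borel_prob"
    and \<tau> :: "'a borel_prob"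
  assumes "large_game M G"
    and "\<And>n. n > 0 \<Longrightarrow> finite_player_space (P n)"
    and "\<And>n. n > 0 \<Longrightarrow> card (space (P n)) = n"
    and "(\<lambda>n. SUP i\<in>space (P n). measure (P n) {i}) \<longlonglongrightarrow> 0"
    and "(\<lambda>n. law (P n) (Gn n)) \<longlonglongrightarrow> law M G"
    and "\<And>n. n > 0 \<Longrightarrow> finite_nash (P n) (Gn n) (gn n)"
    and "(\<lambda>n. finite_summary (P n) (gn n)) \<longlonglongrightarrow> \<tau>"
  shows "\<exists>g. large_nash M G g \<and> large_summary M g = \<tau>"
proof -
  have M: "prob_space M" and G[measurable]: "G \<in> M \<rightarrow>\<^sub>M borel"
    using assms(1) by (simp_all add: large_game_def)
  interpret game_sequence "law M G" P Gn gn \<tau>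
    using assms by unfold_locales
  have Q: "measure_of_bp (law M G) = distr M borel G"
    using M G by (rule measure_of_bp_law)
  obtain \<kappa> :: "'a characteristic \<Rightarrow> 'a borel_prob" where \<kappa>: "\<kappa> \<in> borel_measurable borel"
    and zero: "AE c in distr M borel G. AE a in measure_of_bp (\<kappa> c). regret \<tau> c a = 0"
    and mean: "\<And>f :: 'a \<Rightarrow>\<^sub>C real. (LINT c|distr M borel G. bp_mean (\<kappa> c) f) =
      bp_mean \<tau> f"
    using ex_equilibrium_kernel unfolding Q by blast
  \<comment> \<open>A player's strategy depends on the characteristic only. Since the limit law is
    the image of \<open>M\<close> under \<open>G\<close>, what holds for almost every characteristic
    holds for almost every player, and the mean over characteristics becomes the societal
    summary.\<close>
  define g where "g i = \<kappa> (G i)" for i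
  have g: "g \<in> M \<rightarrow>\<^sub>M borel"
    unfolding g_def using G \<kappa> by (rule measurable_compose)
  have summary: "large_summary M g = \<tau>"
  proof (rule borel_prob_eqI)
    fix f :: "'a \<Rightarrow>\<^sub>C real"
    have "(LINT i|M. bp_mean (\<kappa> (G i)) f) =
        (LINT c|distr M borel G. bp_mean (\<kappa> c) f)"
      by (rule integral_distr[OF G measurable_integral_bp[OF \<kappa>], symmetric])
    then show "bp_mean (large_summary M g) f = bp_mean \<tau> f"
      using integral_large_summary[OF M g, of f] mean[of f] by (simp add: g_def)
  qed
  have "AE i in M. AE a in measure_of_bp (g i). regret \<tau> (G i) a = 0"
    unfolding g_def using G zero by (rule AE_distrD)
  then have "large_nash M G g"
    unfolding large_nash_def large_profile_def summary
    using g by (auto elim!: eventually_mono intro: zero_regret_optimal)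
  with summary show ?thesis by blast
qed

end
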